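(* Assume $\mathrm{char}\,k=0$. Then $\mathcal M_0(\mathbb P^3;0,2)$ has two irreducible components, both $8$-dimensional, intersecting along a $7$-dimensional variety.
   Context: $k$ is an algebraically closed field. Let $V$ be a $k$-vector space of dimension $2$. The scheme $\tilde\mu^{-1}(0)$ of ADHM $(0,2)$-data for $\mathbb P^1$ is the scheme of pairs $(\tilde B_1,\tilde B_2)$ with $\tilde B_1,\tilde B_2\in\mathrm{End}(V)\otimes H^0(\mathbb P^1,\mathcal O(1))$ and $[\tilde B_1,\tilde B_2]=0$ in $\mathrm{End}(V)\otimes H^0(\mathbb P^1,\mathcal O(2))$. Equivalently, writing $\tilde B_k=B_{1k}\otimes x_0+B_{2k}\otimes x_1$ for a basis $x_0,x_1$ of $H^0(\mathbb P^1,\mathcal O(1))$, it is the scheme of quadruples of $2\times2$ matrices with $[B_{11},B_{12}]=0$, $[B_{21},B_{22}]=0$, $[B_{11},B_{22}]+[B_{21},B_{12}]=0$. $\mathrm{GL}(V)$ acts by simultaneous conjugation, and $\mathcal M_0(\mathbb P^3;0,2)=\tilde\mu^{-1}(0)/\mathrm{GL}(V)=\mathrm{Spec}\,k[\tilde\mu^{-1}(0)]^{\mathrm{GL}(V)}$ is the affine GIT quotient (the moduli space of perverse instantons of rank $0$ with $c=2$). *)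

theory Defs
  imports
    "HOL-Analysis.Analysis"
    "HOL-Algebra.Algebraic_Closure_Type"
    "HOL-Library.Poly_Mapping"
    "HOL-Library.Extended_Nat"
begin

section \<open>Irreducible components and Krull dimension of a topological space\<close>

definition irreducible_in :: "'a topology \<Rightarrow> 'a set \<Rightarrow> bool" where
  "irreducible_in T S \<longleftrightarrow>
     S \<subseteq> topspace T \<and> S \<noteq> {} \<and>
     (\<forall>C D. closedin T C \<longrightarrow> closedin T D \<longrightarrow> S \<subseteq> C \<union> D \<longrightarrow> S \<subseteq> C \<or> S \<subseteq> D)"

definition irreducible_components :: "'a topology \<Rightarrow> 'a set set" where
  "irreducible_components T =
     {S. irreducible_in T S \<and> (\<forall>S'. irreducible_in T S' \<longrightarrow> S \<subseteq> S' \<longrightarrow> S' = S)}"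

text \<open>Supremum of the lengths \<open>n\<close> of chains \<open>Z 0 \<subset> \<dots> \<subset> Z n\<close> of irreducible closed
  subsets. The empty space gets dimension \<open>0\<close>.\<close>

definition krull_dim :: "'a topology \<Rightarrow> enat" where
  "krull_dim T =
     (SUP n \<in> {n. \<exists>Z. (\<forall>i\<le>n. closedin T (Z i) \<and> irreducible_in T (Z i)) \<and>
                       (\<forall>i<n. Z i \<subset> Z (Suc i))}. enat n)"

section \<open>The prime spectrum\<close>

definition prime_spectrum :: "('a, 'b) ring_scheme \<Rightarrow> 'a set set" where
  "prime_spectrum A = {P. primeideal P A}"

definition zariski :: "('a, 'b) ring_scheme \<Rightarrow> 'a set topology" where
  "zariski A =
     topology (\<lambda>U. \<exists>S \<subseteq> carrier A. U = {P \<in> prime_spectrum A. \<not> S \<subseteq> P})"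

lemma istopology_zariski:
  "istopology (\<lambda>U. \<exists>S \<subseteq> carrier A. U = {P \<in> prime_spectrum A. \<not> S \<subseteq> P})"
  unfolding istopology_def
proof (intro conjI allI impI)
  fix U V
  assume "\<exists>S\<subseteq>carrier A. U = {P \<in> prime_spectrum A. \<not> S \<subseteq> P}"
    and "\<exists>S\<subseteq>carrier A. V = {P \<in> prime_spectrum A. \<not> S \<subseteq> P}"
  then obtain S T where S: "S \<subseteq> carrier A" "U = {P \<in> prime_spectrum A. \<not> S \<subseteq> P}"
    and T: "T \<subseteq> carrier A" "V = {P \<in> prime_spectrum A. \<not> T \<subseteq> P}"
    by auto
  define W where "W = {s \<otimes>\<^bsub>A\<^esub> t | s t. s \<in> S \<and> t \<in> T} \<inter> carrier A"
  have "(\<not> S \<subseteq> P \<and> \<not> T \<subseteq> P) \<longleftrightarrow> \<not> W \<subseteq> P" if "P \<in> prime_spectrum A" for P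
  proof -
    interpret primeideal P A using that by (simp add: prime_spectrum_def)
    show ?thesis
    proof
      assume "\<not> S \<subseteq> P \<and> \<not> T \<subseteq> P"
      then obtain s t where st: "s \<in> S" "s \<notin> P" "t \<in> T" "t \<notin> P" by auto
      then have "s \<in> carrier A" "t \<in> carrier A" using S T by auto
      then have "s \<otimes>\<^bsub>A\<^esub> t \<in> W" "s \<otimes>\<^bsub>A\<^esub> t \<notin> P"
        using st I_prime by (auto simp: W_def)
      then show "\<not> W \<subseteq> P" by auto
    next
      assume "\<not> W \<subseteq> P"
      then obtain s t where "s \<in> S" "t \<in> T" "s \<otimes>\<^bsub>A\<^esub> t \<notin> P" by (auto simp: W_def)
      then show "\<not> S \<subseteq> P \<and> \<not> T \<subseteq> P"
        using S(1) T(1) I_l_closed I_r_closed by blast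
    qed
  qed
  then have "U \<inter> V = {P \<in> prime_spectrum A. \<not> W \<subseteq> P}"
    using S T by blast
  moreover have "W \<subseteq> carrier A" by (auto simp: W_def)
  ultimately show "\<exists>W\<subseteq>carrier A. U \<inter> V = {P \<in> prime_spectrum A. \<not> W \<subseteq> P}" by blast
next
  fix \<K>
  assume K: "\<forall>U\<in>\<K>. \<exists>S\<subseteq>carrier A. U = {P \<in> prime_spectrum A. \<not> S \<subseteq> P}"
  then obtain F where F: "\<And>U. U \<in> \<K> \<Longrightarrow> F U \<subseteq> carrier A"
    "\<And>U. U \<in> \<K> \<Longrightarrow> U = {P \<in> prime_spectrum A. \<not> F U \<subseteq> P}"
    by metis
  have "\<Union>\<K> = {P \<in> prime_spectrum A. \<not> \<Union> (F ` \<K>) \<subseteq> P}"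
    using F(2) by blast
  moreover have "\<Union> (F ` \<K>) \<subseteq> carrier A" using F(1) by blast
  ultimately show "\<exists>S\<subseteq>carrier A. \<Union>\<K> = {P \<in> prime_spectrum A. \<not> S \<subseteq> P}" by blast
qed

lemma openin_zariski:
  "openin (zariski A) U \<longleftrightarrow>
     (\<exists>S \<subseteq> carrier A. U = {P \<in> prime_spectrum A. \<not> S \<subseteq> P})"
  by (simp add: zariski_def topology_inverse'[OF istopology_zariski])

section \<open>Polynomials in the entries of the ADHM matrices\<close>

text \<open>The variable \<open>(j, l, a, b)\<close> is the \<open>(a, b)\<close> entry of the matrix \<open>B\<^sub>j\<^sub>l\<close>, where
  \<open>V = k\<^sup>2\<close>. All indices have the two-element type \<open>2\<close>, in which the numeral \<open>2\<close> equals \<open>0\<close>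
  and is distinct from \<open>1\<close>.\<close>

type_synonym adhm_var = "2 \<times> 2 \<times> 2 \<times> 2"

type_synonym 'k adhm_poly = "(adhm_var \<Rightarrow>\<^sub>0 nat) \<Rightarrow>\<^sub>0 'k"

definition adhm_const :: "'k::comm_ring_1 \<Rightarrow> 'k adhm_poly" where
  "adhm_const c = Poly_Mapping.single 0 c"

definition adhm_variable :: "adhm_var \<Rightarrow> 'k::comm_ring_1 adhm_poly" where
  "adhm_variable v = Poly_Mapping.single (Poly_Mapping.single v 1) 1"

definition substitute ::
    "(adhm_var \<Rightarrow> 'k::comm_ring_1 adhm_poly) \<Rightarrow> 'k adhm_poly \<Rightarrow> 'k adhm_poly" where
  "substitute \<sigma> f =
     (\<Sum>m \<in> Poly_Mapping.keys f.
        adhm_const (Poly_Mapping.lookup f m) * (\<Prod>v \<in> UNIV. \<sigma> v ^ Poly_Mapping.lookup m v))"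

definition generic_matrix :: "2 \<Rightarrow> 2 \<Rightarrow> 'k::comm_ring_1 adhm_poly ^ 2 ^ 2" where
  "generic_matrix j l = (\<chi> a b. adhm_variable (j, l, a, b))"

section \<open>The scheme of ADHM data and its quotient\<close>

definition commutator :: "'r::comm_ring_1 ^ 2 ^ 2 \<Rightarrow> 'r ^ 2 ^ 2 \<Rightarrow> 'r ^ 2 ^ 2" where
  "commutator A B = A ** B - B ** A"

text \<open>The coefficients of \<open>x\<^sub>0\<^sup>2\<close>, \<open>x\<^sub>1\<^sup>2\<close> and \<open>x\<^sub>0 x\<^sub>1\<close> in the commutator of
  \<open>B\<^sub>1\<^sub>1 x\<^sub>0 + B\<^sub>2\<^sub>1 x\<^sub>1\<close> and \<open>B\<^sub>1\<^sub>2 x\<^sub>0 + B\<^sub>2\<^sub>2 x\<^sub>1\<close>.\<close>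

definition adhm_equations :: "('k::comm_ring_1 adhm_poly ^ 2 ^ 2) set" where
  "adhm_equations =
     (let B = generic_matrix in
       {commutator (B 1 1) (B 1 2),
        commutator (B 2 1) (B 2 2),
        commutator (B 1 1) (B 2 2) + commutator (B 2 1) (B 1 2)})"

definition adhm_ideal :: "'k::comm_ring_1 adhm_poly set" where
  "adhm_ideal =
     genideal ring_of_type_algebra {M $ a $ b | M a b. M \<in> adhm_equations}"

definition adhm_coordinate_ring :: "'k::comm_ring_1 adhm_poly set ring" where
  "adhm_coordinate_ring = ring_of_type_algebra Quot adhm_ideal"

text \<open>The polynomial \<open>B \<mapsto> f (g\<^sup>-\<^sup>1 B g)\<close>.\<close>

definition GL_act :: "'k::comm_ring_1 ^ 2 ^ 2 \<Rightarrow> 'k adhm_poly \<Rightarrow> 'k adhm_poly" where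
  "GL_act g f =
     (let c = (\<lambda>M. \<chi> a b. adhm_const (M $ a $ b)) in
       substitute
         (\<lambda>(j, l, a, b). (c (matrix_inv g) ** generic_matrix j l ** c g) $ a $ b) f)"

text \<open>Since \<open>k\<close> will be infinite, being invariant under the algebraic group \<open>GL\<^sub>2\<close> is the
  same as being invariant under its \<open>k\<close>-points.\<close>

definition adhm_invariant_ring :: "'k::comm_ring_1 adhm_poly set ring" where
  "adhm_invariant_ring =
     adhm_coordinate_ring
       \<lparr>carrier :=
          {adhm_ideal +>\<^bsub>ring_of_type_algebra\<^esub> f | f.
             \<forall>g. invertible g \<longrightarrow>
               adhm_ideal +>\<^bsub>ring_of_type_algebra\<^esub> GL_act g f =
               adhm_ideal +>\<^bsub>ring_of_type_algebra\<^esub> f}\<rparr>"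

text \<open>The type argument is the ground field.\<close>

definition perverse_instanton_moduli ::
    "'k::comm_ring_1 itself \<Rightarrow> 'k adhm_poly set set topology" where
  "perverse_instanton_moduli _ = zariski adhm_invariant_ring"

end

theory Submission
  imports Defs
begin

text \<open>Splitting off the traces turns ADHM data into four traceless matrices. On traceless matrices
  the commutator is, up to scaling, the cross product of \<open>k\<^sup>3\<close>, so the ADHM equations say that two
  vectors of linear forms in \<open>x\<^sub>0, x\<^sub>1\<close> are parallel over \<open>k(x\<^sub>0, x\<^sub>1)\<close>. Clearing denominators, either
  both are multiples of one constant vector, and the \<open>3 \<times> 4\<close> matrix of all coordinates has rank at most
  one, or both are constant multiples of one vector of linear forms, and a \<open>2 \<times> 6\<close> matrix has rank at
  most one. A general member of the first family is simultaneously diagonalizable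
  (\<open>split_data\<close>, eight parameters); in a general member of the second family the two coefficients of the
  common vector of linear forms, again seen as traceless matrices, have no common eigenvector, and an
  eigenvector of each gives a basis in which the data take the normal form \<open>pencil_data\<close>, again with eight
  parameters. Restricting invariants to the two normal forms gives two ring
  maps into polynomial rings; their kernels are the minimal primes of the invariant ring.

  Every prime contains one of the two kernels because their product is zero modulo the ADHM
  equations (\<open>kernel_product_in_ideal\<close>): an invariant that vanishes on a normal form vanishes, by
  conjugation and density, on the whole family of matrices of rank one; by \<open>segre_congruence\<close> it then lies in
  the ideal of the \<open>2 \<times> 2\<close> minors; and a minor of the first kind times a minor of the second kind lies in
  the ADHM ideal (\<open>minor_product\<close>).

  The two components meet along the image of the data that belong to both families, with restriction
  map \<open>cross_restrict\<close>. Its kernel is the sum of the other two kernels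
  (\<open>cross_kernel_decomposition\<close>): the restriction of such an invariant to diagonal data is even in the
  eigenvalue differences and divisible by a \<open>2 \<times> 2\<close> determinant in them; the quotient is even again, hence
  the restriction of an invariant, and the determinant is the restriction of an invariant that
  vanishes on the other component.

  For the dimensions, elements that witness the strictness of a chain of primes are algebraically
  independent (\<open>chain_independent\<close>), and counting monomials shows that a polynomial ring in
  \<open>d\<close> variables has at most \<open>d\<close> algebraically independent elements
  (\<open>algebraically_dependent\<close>). Conversely, setting the parameters of a normal form to zero one after
  another gives a strict chain of primes of the right length (\<open>krull_dim_restriction\<close>).\<close>

section \<open>Ring maps and evaluation of polynomials\<close>

locale ring_map =
  fixes F :: "'a::comm_ring_1 \<Rightarrow> 'b::comm_ring_1"
  assumes one: "F 1 = 1"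
    and add: "F (x + y) = F x + F y"
    and mult: "F (x * y) = F x * F y"
begin

lemma zero: "F 0 = 0"
  using add[of 0 0] by simp

lemma uminus: "F (- x) = - F x"
  using add[of x "- x"] zero by (simp add: eq_neg_iff_add_eq_0 add.commute)

lemma diff: "F (x - y) = F x - F y"
  using add[of x "- y"] uminus by simp

lemma sum: "F (\<Sum>i\<in>A. f i) = (\<Sum>i\<in>A. F (f i))"
  by (induction A rule: infinite_finite_induct) (simp_all add: zero add)

lemma prod: "F (\<Prod>i\<in>A. f i) = (\<Prod>i\<in>A. F (f i))"
  by (induction A rule: infinite_finite_induct) (simp_all add: one mult)

lemma power: "F (x ^ n) = F x ^ n"
  by (induction n) (simp_all add: one mult)

lemma numeral: "F (numeral n) = numeral n"
proof -
  have "F (of_nat m) = of_nat m" for m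
    by (induction m) (simp_all add: zero add one)
  from this[of "numeral n"] show ?thesis by simp
qed

lemmas hom = zero one add mult uminus diff sum prod power numeral

end

lemma ring_map_id: "ring_map (\<lambda>x. x)"
  by unfold_locales simp_all

definition Const :: "'k::comm_ring_1 \<Rightarrow> ('v \<Rightarrow>\<^sub>0 nat) \<Rightarrow>\<^sub>0 'k" where
  "Const c = Poly_Mapping.single 0 c"

definition Var :: "'v \<Rightarrow> ('v \<Rightarrow>\<^sub>0 nat) \<Rightarrow>\<^sub>0 'k::comm_ring_1" where
  "Var v = Poly_Mapping.single (Poly_Mapping.single v 1) 1"

lemma ring_map_Const: "ring_map Const"
  by unfold_locales (simp_all add: Const_def single_add mult_single)

lemmas Const_hom = ring_map.hom[OF ring_map_Const]

definition monom_eval :: "('v \<Rightarrow> 'r::comm_ring_1) \<Rightarrow> ('v \<Rightarrow>\<^sub>0 nat) \<Rightarrow> 'r" where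
  "monom_eval \<sigma> m = (\<Prod>v\<in>Poly_Mapping.keys m. \<sigma> v ^ Poly_Mapping.lookup m v)"

lemma monom_eval_superset:
  assumes "finite A" "Poly_Mapping.keys m \<subseteq> A"
  shows "monom_eval \<sigma> m = (\<Prod>v\<in>A. \<sigma> v ^ Poly_Mapping.lookup m v)"
  unfolding monom_eval_def
  by (rule prod.mono_neutral_left) (use assms in \<open>auto simp: in_keys_iff\<close>)

lemma monom_eval_add: "monom_eval \<sigma> (m + n) = monom_eval \<sigma> m * monom_eval \<sigma> n"
proof -
  let ?A = "Poly_Mapping.keys m \<union> Poly_Mapping.keys n"
  have "Poly_Mapping.keys (m + n) \<subseteq> ?A" by (rule keys_add)
  then show ?thesis
    by (simp add: monom_eval_superset[of ?A] lookup_add power_add prod.distrib)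
qed

lemma monom_eval_0 [simp]: "monom_eval \<sigma> 0 = 1"
  by (simp add: monom_eval_def)

lemma monom_eval_single [simp]: "monom_eval \<sigma> (Poly_Mapping.single v n) = \<sigma> v ^ n"
  by (cases "n = 0") (simp_all add: monom_eval_def)

lemma (in ring_map) monom_eval: "F (monom_eval \<sigma> m) = monom_eval (\<lambda>v. F (\<sigma> v)) m"
  by (simp add: monom_eval_def hom)

lemma monom_eval_mult:
  "monom_eval (\<lambda>v. \<sigma> v * \<tau> v) m = monom_eval \<sigma> m * monom_eval \<tau> m"
  by (simp add: monom_eval_def power_mult_distrib prod.distrib)

lemma monom_eval_Var: "monom_eval Var m = Poly_Mapping.single m (1::'k::comm_ring_1)"
proof (induction m rule: update_induct)
  case const
  then show ?case by simp
next
  case (update m a b)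
  have "Poly_Mapping.update a b m = m + Poly_Mapping.single a b"
    using update.hyps
    by (intro poly_mapping_eqI)
      (auto simp: lookup_update lookup_add lookup_single when_def in_keys_iff)
  moreover have "Var a ^ n = Poly_Mapping.single (Poly_Mapping.single a n) (1::'k)" for n
    by (induction n)
      (simp_all add: Var_def mult_single flip: single_add)
  ultimately show ?case
    using update by (simp add: monom_eval_add mult_single)
qed

text \<open>The map on coefficients is a parameter: it is the identity for evaluation at a point and
  \<open>Const\<close> for substitution of polynomials.\<close>

definition eval_poly ::
    "('k::comm_ring_1 \<Rightarrow> 'r::comm_ring_1) \<Rightarrow> ('v \<Rightarrow> 'r) \<Rightarrow> (('v \<Rightarrow>\<^sub>0 nat) \<Rightarrow>\<^sub>0 'k) \<Rightarrow> 'r" where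
  "eval_poly h \<sigma> f =
     (\<Sum>m\<in>Poly_Mapping.keys f. h (Poly_Mapping.lookup f m) * monom_eval \<sigma> m)"

lemma eval_poly_superset:
  assumes "h 0 = 0" "finite A" "Poly_Mapping.keys f \<subseteq> A"
  shows "eval_poly h \<sigma> f = (\<Sum>m\<in>A. h (Poly_Mapping.lookup f m) * monom_eval \<sigma> m)"
  unfolding eval_poly_def
  by (rule sum.mono_neutral_left) (use assms in \<open>auto simp: in_keys_iff\<close>)

lemma poly_mapping_sum_singles:
  "f = (\<Sum>m\<in>Poly_Mapping.keys f. Poly_Mapping.single m (Poly_Mapping.lookup f m))"
  by (rule poly_mapping_eqI)
    (auto simp: lookup_sum lookup_single when_def sum.delta in_keys_iff)

lemma poly_sum_monoms:
  fixes f :: "('v \<Rightarrow>\<^sub>0 nat) \<Rightarrow>\<^sub>0 'k::comm_ring_1"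
  shows "f = eval_poly Const Var f"
  by (subst poly_mapping_sum_singles)
    (simp add: eval_poly_def Const_def monom_eval_Var mult_single)

context
  fixes h :: "'k::comm_ring_1 \<Rightarrow> 'r::comm_ring_1"
  assumes h: "ring_map h"
begin

interpretation h: ring_map h by (rule h)

lemma eval_poly_add: "eval_poly h \<sigma> (f + g) = eval_poly h \<sigma> f + eval_poly h \<sigma> g"
proof -
  let ?A = "Poly_Mapping.keys f \<union> Poly_Mapping.keys g"
  have "Poly_Mapping.keys (f + g) \<subseteq> ?A" by (rule keys_add)
  then show ?thesis
    by (simp add: eval_poly_superset[of h ?A] h.hom lookup_add sum.distrib distrib_right)
qed

lemma eval_poly_zero: "eval_poly h \<sigma> 0 = 0"
  by (simp add: eval_poly_def)

lemma eval_poly_sum: "eval_poly h \<sigma> (\<Sum>i\<in>A. f i) = (\<Sum>i\<in>A. eval_poly h \<sigma> (f i))"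
  by (induction A rule: infinite_finite_induct) (simp_all add: eval_poly_zero eval_poly_add)

lemma eval_poly_single: "eval_poly h \<sigma> (Poly_Mapping.single m c) = h c * monom_eval \<sigma> m"
  by (cases "c = 0") (simp_all add: eval_poly_def h.hom)

lemma eval_poly_Const: "eval_poly h \<sigma> (Const c) = h c"
  by (simp add: Const_def eval_poly_single)

lemma eval_poly_Var: "eval_poly h \<sigma> (Var v) = \<sigma> v"
  by (simp add: Var_def eval_poly_single h.hom)

lemma eval_poly_mult: "eval_poly h \<sigma> (f * g) = eval_poly h \<sigma> f * eval_poly h \<sigma> g"
proof -
  let ?s = "\<lambda>f m. Poly_Mapping.single m (Poly_Mapping.lookup f m)"
  have "eval_poly h \<sigma> (f * g) = eval_poly h \<sigma>
     ((\<Sum>m\<in>Poly_Mapping.keys f. ?s f m) * (\<Sum>n\<in>Poly_Mapping.keys g. ?s g n))"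
    by (simp flip: poly_mapping_sum_singles)
  also have "\<dots> = (\<Sum>m\<in>Poly_Mapping.keys f. \<Sum>n\<in>Poly_Mapping.keys g.
      eval_poly h \<sigma> (?s f m) * eval_poly h \<sigma> (?s g n))"
    by (simp add: sum_product eval_poly_sum mult_single eval_poly_single monom_eval_add h.mult
        mult.assoc mult.left_commute)
  also have "\<dots> = eval_poly h \<sigma> f * eval_poly h \<sigma> g"
    by (simp only: eval_poly_single flip: sum_product) (simp only: eval_poly_def)
  finally show ?thesis .
qed

lemma ring_map_eval_poly: "ring_map (eval_poly h \<sigma>)"
  by unfold_locales
    (simp_all add: eval_poly_add eval_poly_mult eval_poly_single h.hom flip: single_one)

end

lemmas eval_poly_hom = ring_map.hom[OF ring_map_eval_poly]

lemma (in ring_map) eval_poly: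
  "F (eval_poly h \<sigma> f) = eval_poly (\<lambda>c. F (h c)) (\<lambda>v. F (\<sigma> v)) f"
  by (simp add: eval_poly_def hom monom_eval)

abbreviation at_point :: "('v \<Rightarrow> 'k) \<Rightarrow> (('v \<Rightarrow>\<^sub>0 nat) \<Rightarrow>\<^sub>0 'k::comm_ring_1) \<Rightarrow> 'k" where
  "at_point \<equiv> eval_poly (\<lambda>c. c)"

abbreviation subst_poly ::
    "('v \<Rightarrow> ('w \<Rightarrow>\<^sub>0 nat) \<Rightarrow>\<^sub>0 'k) \<Rightarrow> (('v \<Rightarrow>\<^sub>0 nat) \<Rightarrow>\<^sub>0 'k::comm_ring_1) \<Rightarrow> ('w \<Rightarrow>\<^sub>0 nat) \<Rightarrow>\<^sub>0 'k"
  where "subst_poly \<equiv> eval_poly Const"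

lemmas at_point_simps =
  eval_poly_hom[OF ring_map_id] eval_poly_Const[OF ring_map_id] eval_poly_Var[OF ring_map_id]

lemmas subst_poly_simps =
  eval_poly_hom[OF ring_map_Const] eval_poly_Const[OF ring_map_Const]
  eval_poly_Var[OF ring_map_Const]

lemma at_point_subst: "at_point \<tau> (subst_poly \<sigma> f) = at_point (\<lambda>v. at_point \<tau> (\<sigma> v)) f"
  by (subst ring_map.eval_poly[OF ring_map_eval_poly[OF ring_map_id]])
    (simp add: eval_poly_Const[OF ring_map_id])

lemma subst_subst: "subst_poly \<tau> (subst_poly \<sigma> f) = subst_poly (\<lambda>v. subst_poly \<tau> (\<sigma> v)) f"
  by (subst ring_map.eval_poly[OF ring_map_eval_poly[OF ring_map_Const]])
    (simp add: eval_poly_Const[OF ring_map_Const])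

lemma subst_Var: "subst_poly Var f = f"
  by (rule poly_sum_monoms[symmetric])

text \<open>Distinct monomials are distinct characters of the multiplicative monoid of all points, and
  distinct characters are linearly independent.\<close>

lemma monom_eval_independent:
  fixes c :: "('v \<Rightarrow>\<^sub>0 nat) \<Rightarrow> 'k::field_char_0"
  assumes "finite A" "\<And>\<sigma>. (\<Sum>m\<in>A. c m * monom_eval \<sigma> m) = 0" "m \<in> A"
  shows "c m = 0"
proof -
  have "c m = 0" if "finite A" "\<forall>\<sigma>. (\<Sum>m\<in>A. c m * monom_eval \<sigma> m) = 0" "m \<in> A"
    for A m and c :: "('v \<Rightarrow>\<^sub>0 nat) \<Rightarrow> 'k"
    using that
  proof (induction A arbitrary: c m rule: finite_psubset_induct)
    case (psubset A)
    have vanish: "(\<Sum>m\<in>A. c m * monom_eval \<sigma> m) = 0" for \<sigma> using psubset.prems(1) by blast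
    show ?case
    proof (cases "\<exists>n\<in>A. n \<noteq> m")
      case False
      then have "A = {m}" using psubset.prems(2) by blast
      then show ?thesis using vanish[of "\<lambda>_. 1"] by (simp add: monom_eval_def)
    next
      case True
      then obtain n where n: "n \<in> A" "n \<noteq> m" by auto
      then obtain v where v: "Poly_Mapping.lookup n v \<noteq> Poly_Mapping.lookup m v"
        by (metis poly_mapping_eqI)
      define \<tau> :: "'v \<Rightarrow> 'k" where "\<tau> w = (if w = v then 2 else 1)" for w
      have \<tau>: "monom_eval \<tau> k = 2 ^ Poly_Mapping.lookup k v" for k
      proof -
        have "monom_eval \<tau> k = (\<Prod>w\<in>insert v (Poly_Mapping.keys k). \<tau> w ^ Poly_Mapping.lookup k w)"
          by (rule monom_eval_superset) auto
        also have "\<dots> = (\<Prod>w\<in>{v}. \<tau> w ^ Poly_Mapping.lookup k w)"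
          by (rule prod.mono_neutral_right) (auto simp: \<tau>_def)
        finally show ?thesis by (simp add: \<tau>_def)
      qed
      define c' where "c' k = c k * (monom_eval \<tau> k - monom_eval \<tau> n)" for k
      have "(\<Sum>k\<in>A - {n}. c' k * monom_eval \<sigma> k) = 0" for \<sigma>
      proof -
        have "(\<Sum>k\<in>A - {n}. c' k * monom_eval \<sigma> k) = (\<Sum>k\<in>A. c' k * monom_eval \<sigma> k)"
          by (rule sum.mono_neutral_left) (use psubset.hyps in \<open>auto simp: c'_def\<close>)
        also have "\<dots> = (\<Sum>k\<in>A. c k * monom_eval (\<lambda>v. \<tau> v * \<sigma> v) k)
            - monom_eval \<tau> n * (\<Sum>k\<in>A. c k * monom_eval \<sigma> k)"
          unfolding sum_distrib_left sum_subtractf[symmetric]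
          by (rule sum.cong) (simp_all add: c'_def monom_eval_mult algebra_simps)
        finally show ?thesis by (simp only: vanish) simp
      qed
      then have "c' m = 0"
        using psubset.IH[of "A - {n}" c' m] n psubset.prems(2) by blast
      moreover have "(2::'k) ^ i = 2 ^ j \<Longrightarrow> i = j" for i j
      proof -
        assume "(2::'k) ^ i = 2 ^ j"
        then have "of_nat (2 ^ i) = (of_nat (2 ^ j) :: 'k)" by simp
        then show "i = j" by (simp only: of_nat_eq_iff) simp
      qed
      ultimately have "monom_eval \<tau> m - monom_eval \<tau> n \<noteq> 0" using v by (auto simp: \<tau>)
      with \<open>c' m = 0\<close> show ?thesis by (simp add: c'_def)
    qed
  qed
  with assms show ?thesis by blast
qed

lemma poly_eq_0_if_vanishes:
  fixes f :: "('v \<Rightarrow>\<^sub>0 nat) \<Rightarrow>\<^sub>0 'k::field_char_0"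
  assumes "\<And>\<sigma>. at_point \<sigma> f = 0"
  shows "f = 0"
proof (rule poly_mapping_eqI)
  fix m
  have "Poly_Mapping.lookup f m = 0" if "m \<in> Poly_Mapping.keys f"
    using monom_eval_independent[of "Poly_Mapping.keys f" "Poly_Mapping.lookup f" m] assms that
    by (simp add: eval_poly_def)
  then show "Poly_Mapping.lookup f m = Poly_Mapping.lookup 0 m"
    by (auto simp: in_keys_iff)
qed

section \<open>Binomial relations of Segre maps\<close>

definition monom_mset :: "('v \<Rightarrow>\<^sub>0 nat) \<Rightarrow> 'v multiset" where
  "monom_mset m = (\<Sum>v\<in>Poly_Mapping.keys m. replicate_mset (Poly_Mapping.lookup m v) v)"

lemma prod_monom_mset: "prod_mset (image_mset \<xi> (monom_mset m)) = monom_eval \<xi> m"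
proof -
  have "prod_mset (image_mset \<xi> ((\<Sum>v\<in>A. replicate_mset (Poly_Mapping.lookup m v) v))) =
      (\<Prod>v\<in>A. \<xi> v ^ Poly_Mapping.lookup m v)" if "finite A" for A
    using that by (induction A) simp_all
  then show ?thesis by (simp add: monom_mset_def monom_eval_def)
qed

definition monom_image :: "('v \<Rightarrow> 'w) \<Rightarrow> ('v \<Rightarrow>\<^sub>0 nat) \<Rightarrow> ('w \<Rightarrow>\<^sub>0 nat)" where
  "monom_image g m = (\<Sum>v\<in>Poly_Mapping.keys m. Poly_Mapping.single (g v) (Poly_Mapping.lookup m v))"

lemma monom_eval_monom_image: "monom_eval \<xi> (monom_image g m) = monom_eval (\<lambda>v. \<xi> (g v)) m"
proof -
  have "monom_eval \<xi> (\<Sum>v\<in>A. Poly_Mapping.single (g v) (Poly_Mapping.lookup m v)) =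
      (\<Prod>v\<in>A. \<xi> (g v) ^ Poly_Mapping.lookup m v)" if "finite A" for A
    using that by (induction A) (simp_all add: monom_eval_add)
  then show ?thesis by (simp add: monom_image_def monom_eval_def)
qed

lemma lookup_monom_image:
  "Poly_Mapping.lookup (monom_image g m) n = count (image_mset g (monom_mset m)) n"
proof -
  have "Poly_Mapping.lookup (\<Sum>v\<in>A. Poly_Mapping.single (g v) (Poly_Mapping.lookup m v)) n =
      count (image_mset g (\<Sum>v\<in>A. replicate_mset (Poly_Mapping.lookup m v) v)) n"
    if "finite A" for A
    using that by (induction A) (simp_all add: lookup_add lookup_single when_def)
  then show ?thesis by (simp add: monom_image_def monom_mset_def)
qed

text \<open>Two monomials with the same row and column content are congruent: if \<open>x\<close> occurs in the first, then
  the second contains some \<open>u\<close> in the row of \<open>x\<close> and some \<open>w\<close> in its column; exchanging columns between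
  them produces \<open>x\<close>, which can be cancelled.\<close>

lemma swap_congruence:
  fixes \<xi> :: "'v \<Rightarrow> 'r::comm_ring_1"
  assumes zero: "0 \<in> J" and add: "\<And>x y. x \<in> J \<Longrightarrow> y \<in> J \<Longrightarrow> x + y \<in> J"
    and mult: "\<And>x v. x \<in> J \<Longrightarrow> \<xi> v * x \<in> J"
    and inj: "\<And>x y. r x = r y \<Longrightarrow> c x = c y \<Longrightarrow> x = y"
    and swap: "\<And>x u w. r u = r x \<Longrightarrow> c w = c x \<Longrightarrow>
      \<exists>x'. r x' = r w \<and> c x' = c u \<and> \<xi> u * \<xi> w - \<xi> x * \<xi> x' \<in> J"
    and "image_mset r M' = image_mset r M" "image_mset c M' = image_mset c M"
  shows "prod_mset (image_mset \<xi> M') - prod_mset (image_mset \<xi> M) \<in> J"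
  using assms(6,7)
proof (induction M arbitrary: M')
  case empty
  then show ?case by (simp add: zero)
next
  case (add x M)
  have prod: "prod_mset (image_mset \<xi> N) * y \<in> J" if "y \<in> J" for N y
    using that by (induction N) (auto simp: mult.assoc intro: mult)
  have "r x \<in># image_mset r M'" "c x \<in># image_mset c M'" using add.prems by simp_all
  then obtain u w where u: "u \<in># M'" "r u = r x" and w: "w \<in># M'" "c w = c x" by auto
  show ?case
  proof (cases "u = w")
    case True
    then have "u = x" using u w inj by auto
    then obtain N where N: "M' = add_mset x N" using u by (metis mset_add)
    then have "prod_mset (image_mset \<xi> N) - prod_mset (image_mset \<xi> M) \<in> J"
      using add.prems by (intro add.IH) simp_all
    from mult[OF this, of x] show ?thesis by (simp add: N right_diff_distrib)
  next
    case False
    obtain N\<^sub>0 where "M' = add_mset u N\<^sub>0" using u(1) by (rule mset_add)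
    moreover from this have "w \<in># N\<^sub>0" using w(1) False by simp
    ultimately obtain N where N: "M' = add_mset u (add_mset w N)" using mset_add by metis
    obtain x' where x': "r x' = r w" "c x' = c u" "\<xi> u * \<xi> w - \<xi> x * \<xi> x' \<in> J"
      using swap[OF u(2) w(2)] by blast
    have "prod_mset (image_mset \<xi> (add_mset x' N)) - prod_mset (image_mset \<xi> M) \<in> J"
      using add.prems u w x' N by (intro add.IH) (auto simp: add_mset_commute)
    from assms(2)[OF mult[OF this, of x] prod[OF x'(3), of N]] show ?thesis
      by (simp add: N algebra_simps)
  qed
qed

text \<open>The kernel of \<open>x\<^sub>i\<^sub>j \<mapsto> y\<^sub>i z\<^sub>j\<close> is generated by exchange binomials. Here the variables
  may fill only a part of the grid, as long as it is closed under the exchanges, and \<open>J\<close> only has to be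
  closed under multiplication by constants and variables.\<close>

lemma segre_congruence:
  fixes \<xi> :: "'v \<Rightarrow> 'r::comm_ring_1" and f :: "('v \<Rightarrow>\<^sub>0 nat) \<Rightarrow>\<^sub>0 'k::comm_ring_1"
    and r c :: "'v \<Rightarrow> 'w"
  assumes h: "ring_map h"
    and zero: "0 \<in> J" and add: "\<And>x y. x \<in> J \<Longrightarrow> y \<in> J \<Longrightarrow> x + y \<in> J"
    and mult: "\<And>x v. x \<in> J \<Longrightarrow> \<xi> v * x \<in> J" and scale: "\<And>x a. x \<in> J \<Longrightarrow> h a * x \<in> J"
    and inj: "\<And>x y. r x = r y \<Longrightarrow> c x = c y \<Longrightarrow> x = y"
    and disj: "\<And>x y. r x \<noteq> c y"
    and swap: "\<And>x u w. r u = r x \<Longrightarrow> c w = c x \<Longrightarrow>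
      \<exists>x'. r x' = r w \<and> c x' = c u \<and> \<xi> u * \<xi> w - \<xi> x * \<xi> x' \<in> J"
    and f: "subst_poly (\<lambda>v. Var (r v) * Var (c v)) f = 0"
  shows "eval_poly h \<xi> f \<in> J"
proof -
  interpret h: ring_map h by (rule h)
  define e where "e m = monom_image r m + monom_image c m" for m
  define K where "K = Poly_Mapping.keys f"
  have fin [simp]: "finite K" by (simp add: K_def)
  define rep where "rep m = (SOME n. n \<in> K \<and> e n = e m)" for m
  have rep: "rep m \<in> K \<and> e (rep m) = e m" if "m \<in> K" for m
    unfolding rep_def by (rule someI) (use that in blast)
  have rep_cong: "rep m = rep n" if "e m = e n" for m n
    by (simp add: rep_def that)
  have cong: "monom_eval \<xi> m - monom_eval \<xi> n \<in> J" if "e m = e n" for m n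
  proof -
    have eq: "count (image_mset r (monom_mset m)) k + count (image_mset c (monom_mset m)) k =
        count (image_mset r (monom_mset n)) k + count (image_mset c (monom_mset n)) k" for k
      using arg_cong[OF that, of "\<lambda>p. Poly_Mapping.lookup p k"]
      by (simp add: e_def lookup_add lookup_monom_image)
    have r: "count (image_mset r M) k = 0" if "k \<in> range c" for k M
      using that disj by (metis count_eq_zero_iff imageE set_image_mset)
    have c: "count (image_mset c M) k = 0" if "k \<in> range r" for k M
      using that disj by (metis count_eq_zero_iff imageE set_image_mset)
    have r': "count (image_mset r M) k = 0" if "k \<notin> range r" for k M
      using that by (auto simp: count_eq_zero_iff)
    have c': "count (image_mset c M) k = 0" if "k \<notin> range c" for k M
      using that by (auto simp: count_eq_zero_iff)
    have "image_mset r (monom_mset m) = image_mset r (monom_mset n)"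
    proof (rule multiset_eqI)
      show "count (image_mset r (monom_mset m)) k = count (image_mset r (monom_mset n)) k" for k
        using eq[of k] c[of k] r'[of k] by (cases "k \<in> range r") simp_all
    qed
    moreover have "image_mset c (monom_mset m) = image_mset c (monom_mset n)"
    proof (rule multiset_eqI)
      show "count (image_mset c (monom_mset m)) k = count (image_mset c (monom_mset n)) k" for k
        using eq[of k] r[of k] c'[of k] by (cases "k \<in> range c") simp_all
    qed
    ultimately show ?thesis
      unfolding prod_monom_mset[symmetric]
      by - (rule swap_congruence[of J \<xi> r c, OF zero],
        erule (1) add, erule mult, erule (1) inj, erule (1) swap)
  qed
  have monom: "monom_eval (\<lambda>v. Var (r v) * Var (c v)) m = Poly_Mapping.single (e m) (1::'k)" for m
  proof -
    have "monom_eval (\<lambda>v. Var (r v) * Var (c v)) m =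
        monom_eval Var (monom_image r m) * monom_eval Var (monom_image c m)"
      by (simp only: monom_eval_mult monom_eval_monom_image)
    also have "\<dots> = (monom_eval Var (e m) :: ('w \<Rightarrow>\<^sub>0 nat) \<Rightarrow>\<^sub>0 'k)"
      by (simp only: e_def monom_eval_add)
    finally show ?thesis by (simp only: monom_eval_Var)
  qed
  have class_sum: "(\<Sum>m\<in>{m\<in>K. e m = p}. Poly_Mapping.lookup f m) = 0" for p
  proof -
    have "subst_poly (\<lambda>v. Var (r v) * Var (c v)) f =
        (\<Sum>m\<in>K. Poly_Mapping.single (e m) (Poly_Mapping.lookup f m))"
      unfolding eval_poly_def K_def by (simp add: monom Const_def mult_single)
    then have "(\<Sum>m\<in>K. Poly_Mapping.lookup (Poly_Mapping.single (e m) (Poly_Mapping.lookup f m)) p) = 0"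
      using f by (simp flip: lookup_sum)
    then have "(\<Sum>m\<in>K. if e m = p then Poly_Mapping.lookup f m else 0) = 0"
      by (simp add: lookup_single when_def)
    then show ?thesis by (simp add: sum.inter_filter)
  qed
  have J_sum: "(\<Sum>m\<in>A. g m) \<in> J" if "\<And>m. m \<in> A \<Longrightarrow> g m \<in> J" for g and A :: "('v \<Rightarrow>\<^sub>0 nat) set"
    using that by (induction A rule: infinite_finite_induct) (auto simp: zero intro: add)
  have "eval_poly h \<xi> f = (\<Sum>m\<in>K. h (Poly_Mapping.lookup f m) * (monom_eval \<xi> m - monom_eval \<xi> (rep m)))
      + (\<Sum>m\<in>K. h (Poly_Mapping.lookup f m) * monom_eval \<xi> (rep m))"
    by (simp add: eval_poly_def K_def algebra_simps sum_subtractf flip: sum.distrib)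
  also have "(\<Sum>m\<in>K. h (Poly_Mapping.lookup f m) * monom_eval \<xi> (rep m)) =
      (\<Sum>p\<in>e ` K. \<Sum>m\<in>{m\<in>K. e m = p}. h (Poly_Mapping.lookup f m) * monom_eval \<xi> (rep m))"
    by (rule sum.image_gen) simp
  also have "\<dots> = 0"
  proof (rule sum.neutral, rule ballI)
    fix p assume "p \<in> e ` K"
    then obtain n where "n \<in> K" "p = e n" by auto
    then have "(\<Sum>m\<in>{m\<in>K. e m = p}. h (Poly_Mapping.lookup f m) * monom_eval \<xi> (rep m)) =
        (\<Sum>m\<in>{m\<in>K. e m = p}. h (Poly_Mapping.lookup f m)) * monom_eval \<xi> (rep n)"
      unfolding sum_distrib_right by (intro sum.cong) (auto dest: rep_cong)
    then show "(\<Sum>m\<in>{m\<in>K. e m = p}. h (Poly_Mapping.lookup f m) * monom_eval \<xi> (rep m)) = 0"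
      by (simp add: class_sum h.zero flip: h.sum)
  qed
  finally have "eval_poly h \<xi> f =
      (\<Sum>m\<in>K. h (Poly_Mapping.lookup f m) * (monom_eval \<xi> m - monom_eval \<xi> (rep m)))" by simp
  then show ?thesis
    using rep cong by (auto intro!: J_sum scale)
qed

section \<open>The ADHM ideal and invariants\<close>

lemma adhm_const_eq: "adhm_const = Const"
  by (simp add: fun_eq_iff adhm_const_def Const_def)

lemma adhm_variable_eq: "adhm_variable = Var"
  by (simp add: fun_eq_iff adhm_variable_def Var_def)

lemma substitute_eq: "substitute = subst_poly"
  by (simp add: fun_eq_iff substitute_def eval_poly_def adhm_const_eq
      monom_eval_superset[of UNIV])

abbreviation ent :: "'r ^ 2 ^ 2 \<Rightarrow> 2 \<Rightarrow> 2 \<Rightarrow> 'r" where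
  "ent A i j \<equiv> vec_nth (vec_nth A i) j"

definition entry :: "(2 \<Rightarrow> 2 \<Rightarrow> 'r ^ 2 ^ 2) \<Rightarrow> adhm_var \<Rightarrow> 'r" where
  "entry B = (\<lambda>(j, l, a, b). ent (B j l) a b)"

lemma entry_apply [simp]: "entry B (j, l, a, b) = ent (B j l) a b"
  by (simp add: entry_def)

definition adhm_data :: "(2 \<Rightarrow> 2 \<Rightarrow> 'r::comm_ring_1 ^ 2 ^ 2) \<Rightarrow> bool" where
  "adhm_data B \<longleftrightarrow> commutator (B 1 1) (B 1 2) = 0 \<and> commutator (B 2 1) (B 2 2) = 0 \<and>
     commutator (B 1 1) (B 2 2) + commutator (B 2 1) (B 1 2) = 0"

lemma commutator_entry:
  "ent (commutator A B) a b = (\<Sum>c\<in>UNIV. ent A a c * ent B c b - ent B a c * ent A c b)"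
  by (simp add: commutator_def matrix_matrix_mult_def sum_subtractf)

lemma carrier_type_ring [simp]: "carrier ring_of_type_algebra = UNIV"
  by (simp add: ring_of_type_algebra_def)

lemma type_ring_ops [simp]:
  "x \<oplus>\<^bsub>ring_of_type_algebra\<^esub> y = x + y" "x \<otimes>\<^bsub>ring_of_type_algebra\<^esub> y = x * y"
  "\<zero>\<^bsub>ring_of_type_algebra\<^esub> = 0" "\<one>\<^bsub>ring_of_type_algebra\<^esub> = 1"
  by (simp_all add: ring_of_type_algebra_def)

lemma type_ring_a_inv [simp]: "\<ominus>\<^bsub>ring_of_type_algebra\<^esub> x = - (x::'a::comm_ring_1)"
proof -
  interpret cring "ring_of_type_algebra :: 'a ring" by (rule cring_from_type_algebra)
  show ?thesis using minus_equality[of "- x" x] by simp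
qed

lemma ideal_adhm_ideal: "ideal adhm_ideal ring_of_type_algebra"
proof -
  interpret cring "ring_of_type_algebra :: 'k::comm_ring_1 adhm_poly ring"
    by (rule cring_from_type_algebra)
  show "ideal (adhm_ideal :: 'k adhm_poly set) ring_of_type_algebra"
    unfolding adhm_ideal_def by (rule genideal_ideal) simp
qed

lemma adhm_ideal_add: "x \<in> adhm_ideal \<Longrightarrow> y \<in> adhm_ideal \<Longrightarrow> x + y \<in> adhm_ideal"
  using additive_subgroup.a_closed[OF ideal.axioms(1)[OF ideal_adhm_ideal]] by force

lemma adhm_ideal_mult: "x \<in> adhm_ideal \<Longrightarrow> y * x \<in> adhm_ideal"
  using ideal.I_l_closed[OF ideal_adhm_ideal] by force

lemma adhm_ideal_mult_right: "x \<in> adhm_ideal \<Longrightarrow> x * y \<in> adhm_ideal"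
  using adhm_ideal_mult[of x y] by (simp add: mult.commute)

lemma adhm_ideal_zero: "0 \<in> adhm_ideal"
  using additive_subgroup.zero_closed[OF ideal.axioms(1)[OF ideal_adhm_ideal]] by force

lemma adhm_ideal_uminus: "x \<in> adhm_ideal \<Longrightarrow> - x \<in> adhm_ideal"
  using adhm_ideal_mult[of x "-1"] by simp

lemma adhm_ideal_uminus_iff: "- x \<in> adhm_ideal \<longleftrightarrow> x \<in> adhm_ideal"
  using adhm_ideal_uminus[of x] adhm_ideal_uminus[of "- x"] by auto

lemma adhm_ideal_diff: "x \<in> adhm_ideal \<Longrightarrow> y \<in> adhm_ideal \<Longrightarrow> x - y \<in> adhm_ideal"
  using adhm_ideal_add[OF _ adhm_ideal_uminus] by fastforce

lemma adhm_equation_in_ideal: "M \<in> adhm_equations \<Longrightarrow> ent M a b \<in> adhm_ideal"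
proof -
  interpret cring "ring_of_type_algebra :: 'k::comm_ring_1 adhm_poly ring"
    by (rule cring_from_type_algebra)
  show "ent M a b \<in> adhm_ideal" if "M \<in> adhm_equations" for M :: "'k adhm_poly ^ 2 ^ 2"
    unfolding adhm_ideal_def by (rule set_mp[OF genideal_self]) (use that in auto)
qed

text \<open>The elements that satisfy the conclusion form an ideal.\<close>

lemma adhm_ideal_induct [consumes 1, case_names generator zero add mult]:
  fixes f :: "'k::comm_ring_1 adhm_poly"
  assumes f: "f \<in> adhm_ideal"
    and generator: "\<And>M a b. M \<in> adhm_equations \<Longrightarrow> P (ent M a b)"
    and zero: "P 0" and add: "\<And>x y. P x \<Longrightarrow> P y \<Longrightarrow> P (x + y)"
    and mult: "\<And>x y. P x \<Longrightarrow> P (y * x)"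
  shows "P f"
proof -
  interpret cring "ring_of_type_algebra :: 'k adhm_poly ring"
    by (rule cring_from_type_algebra)
  let ?K = "{f. P f}"
  have "ideal ?K ring_of_type_algebra"
  proof (rule idealI)
    show "subgroup ?K (add_monoid ring_of_type_algebra)"
    proof (rule add.subgroupI)
      show "?K \<noteq> {}" using assms(3) by blast
      show "\<ominus>\<^bsub>ring_of_type_algebra\<^esub> x \<in> ?K" if "x \<in> ?K" for x
        using that assms(5)[of x "- 1"] by simp
    qed (use assms(4) in simp_all)
    show "x \<otimes>\<^bsub>ring_of_type_algebra\<^esub> a \<in> ?K" "a \<otimes>\<^bsub>ring_of_type_algebra\<^esub> x \<in> ?K"
      if "a \<in> ?K" for a x
      using that assms(5)[of a x] by (simp_all add: mult.commute[of a x])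
  qed (rule ring_axioms)
  then have "adhm_ideal \<subseteq> ?K"
    unfolding adhm_ideal_def by (rule genideal_minimal) (use assms(2) in blast)
  with assms(1) show ?thesis by blast
qed

text \<open>Families over a polynomial ring are covered as well as points.\<close>

lemma adhm_ideal_vanishes:
  assumes h: "ring_map (h :: 'k::comm_ring_1 \<Rightarrow> 'r::comm_ring_1)" and B: "adhm_data B"
    and f: "f \<in> adhm_ideal"
  shows "eval_poly h (entry B) f = 0"
proof -
  interpret E: ring_map "eval_poly h (entry B)" by (rule ring_map_eval_poly[OF h])
  have var: "eval_poly h (entry B) (ent (generic_matrix j l) a b) = ent (B j l) a b" for j l a b
    by (simp add: generic_matrix_def adhm_variable_eq eval_poly_Var[OF h])
  have comm: "eval_poly h (entry B) (ent (commutator (generic_matrix j l) (generic_matrix j' l')) a b) =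
      ent (commutator (B j l) (B j' l')) a b" for j l j' l' a b
    by (simp add: commutator_entry E.hom var)
  have mixed: "ent (commutator (B 1 1) (B 2 2)) a b + ent (commutator (B 2 1) (B 1 2)) a b = 0" for a b
    using B unfolding adhm_data_def by (metis vector_add_component zero_index)
  from f show ?thesis
  proof (induction rule: adhm_ideal_induct)
    case (generator M a b)
    then show ?case
      using B mixed by (auto simp: adhm_equations_def Let_def adhm_data_def E.hom comm)
  qed (simp_all add: E.hom)
qed

text \<open>The invariant ring is the image of this subring of the polynomial ring.\<close>

definition invariants :: "'k::comm_ring_1 adhm_poly set" where
  "invariants = {f. \<forall>g. invertible g \<longrightarrow> GL_act g f - f \<in> adhm_ideal}"

abbreviation map_matrix2 :: "('a \<Rightarrow> 'b) \<Rightarrow> 'a ^ 2 ^ 2 \<Rightarrow> 'b ^ 2 ^ 2" where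
  "map_matrix2 F M \<equiv> (\<chi> a b. F (ent M a b))"

lemma GL_act_eq:
  "GL_act g = subst_poly (entry (\<lambda>j l.
     map_matrix2 Const (matrix_inv g) ** generic_matrix j l ** map_matrix2 Const g))"
  by (simp add: fun_eq_iff GL_act_def Let_def substitute_eq adhm_const_eq entry_def)

lemma ring_map_GL_act: "ring_map (GL_act g)"
  unfolding GL_act_eq by (rule ring_map_eval_poly[OF ring_map_Const])

lemma at_point_GL_act:
  "at_point (entry B) (GL_act g f) = at_point (entry (\<lambda>j l. matrix_inv g ** B j l ** g)) f"
proof -
  have "at_point (entry B)
      (ent (map_matrix2 Const (matrix_inv g) ** generic_matrix j l ** map_matrix2 Const g) a b) =
      ent (matrix_inv g ** B j l ** g) a b" for j l a b
    by (simp add: matrix_matrix_mult_def at_point_simps generic_matrix_def adhm_variable_eq)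
  then show ?thesis
    unfolding GL_act_eq at_point_subst by (intro arg_cong2[of _ _ _ _ at_point]) (auto simp: entry_def)
qed

lemma invariant_at_conjugate:
  assumes "f \<in> invariants" "adhm_data B" "invertible g"
  shows "at_point (entry (\<lambda>j l. matrix_inv g ** B j l ** g)) f = at_point (entry B) f"
proof -
  have "GL_act g f - f \<in> adhm_ideal" using assms by (simp add: invariants_def)
  from adhm_ideal_vanishes[OF ring_map_id assms(2) this] show ?thesis
    by (simp add: at_point_simps at_point_GL_act)
qed

lemma (in ring_map) map_matrix2_mult:
  "map_matrix2 F (A ** B) = map_matrix2 F A ** map_matrix2 F B"
  by (simp add: vec_eq_iff matrix_matrix_mult_def hom)

lemma (in ring_map) map_matrix2_commutator:
  "map_matrix2 F (commutator A B) = commutator (map_matrix2 F A) (map_matrix2 F B)"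
  by (simp add: vec_eq_iff commutator_entry hom)

lemma (in ring_map) trace: "F (trace A) = trace (map_matrix2 F A)"
  by (simp add: trace_def hom)

lemma (in ring_map) map_matrix2_mat_1: "map_matrix2 F (mat 1) = mat 1"
  by (simp add: vec_eq_iff mat_def hom)

lemma matrix_inv_mult:
  assumes "invertible (g :: 'k::comm_ring_1 ^ 2 ^ 2)"
  shows "g ** matrix_inv g = mat 1" "matrix_inv g ** g = mat 1"
  using someI_ex[OF assms[unfolded invertible_def]] by (simp_all add: matrix_inv_def)

definition conj_by :: "'k::comm_ring_1 ^ 2 ^ 2 \<Rightarrow> 'k adhm_poly ^ 2 ^ 2 \<Rightarrow> 'k adhm_poly ^ 2 ^ 2" where
  "conj_by g M = map_matrix2 Const (matrix_inv g) ** M ** map_matrix2 Const g"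

lemma conj_by_mult:
  assumes "invertible g"
  shows "conj_by g (A ** B) = conj_by g A ** conj_by g B"
proof -
  interpret C: ring_map Const by (rule ring_map_Const)
  have inv: "map_matrix2 Const g ** map_matrix2 Const (matrix_inv g) = mat 1"
    by (simp add: matrix_inv_mult[OF assms] C.map_matrix2_mat_1 flip: C.map_matrix2_mult)
  have "conj_by g A ** conj_by g B = map_matrix2 Const (matrix_inv g) ** A **
      (map_matrix2 Const g ** map_matrix2 Const (matrix_inv g)) ** B ** map_matrix2 Const g"
    by (simp only: conj_by_def matrix_mul_assoc)
  then show ?thesis
    unfolding inv by (simp only: conj_by_def matrix_mul_rid matrix_mul_assoc)
qed

lemma trace_conj_by:
  assumes "invertible g"
  shows "trace (conj_by g A) = trace A"
proof -
  interpret C: ring_map Const by (rule ring_map_Const)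
  have inv: "map_matrix2 Const g ** map_matrix2 Const (matrix_inv g) = mat 1"
    by (simp add: matrix_inv_mult[OF assms] C.map_matrix2_mat_1 flip: C.map_matrix2_mult)
  have "trace (conj_by g A) =
      trace ((map_matrix2 Const g ** map_matrix2 Const (matrix_inv g)) ** A)"
    unfolding conj_by_def by (subst trace_mul_sym) (simp only: matrix_mul_assoc)
  then show ?thesis unfolding inv by simp
qed

lemma conj_by_add: "conj_by g (A + B) = conj_by g A + conj_by g B"
  by (simp add: vec_eq_iff conj_by_def matrix_matrix_mult_def sum.distrib distrib_left distrib_right)

lemma conj_by_diff: "conj_by g (A - B) = conj_by g A - conj_by g B"
  using conj_by_add[of g "A - B" B] by (simp add: algebra_simps)

lemma conj_by_commutator:
  "invertible g \<Longrightarrow> conj_by g (commutator A B) = commutator (conj_by g A) (conj_by g B)"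
  by (simp add: commutator_def conj_by_diff conj_by_mult)

lemma GL_act_generic: "map_matrix2 (GL_act g) (generic_matrix j l) = conj_by g (generic_matrix j l)"
  by (simp add: vec_eq_iff GL_act_eq conj_by_def subst_poly_simps generic_matrix_def adhm_variable_eq)

text \<open>Conjugation replaces each entry of an ADHM equation by a linear combination of the entries of the
  same equation.\<close>

lemma GL_act_adhm_ideal:
  assumes g: "invertible g" and f: "f \<in> adhm_ideal"
  shows "GL_act g f \<in> adhm_ideal"
proof -
  interpret G: ring_map "GL_act g" by (rule ring_map_GL_act)
  have conj_in: "ent (conj_by g M) a b \<in> adhm_ideal" if "M \<in> adhm_equations" for M a b
  proof -
    have "(\<Sum>c\<in>A. (\<Sum>d\<in>A'. p d * ent M d c) * q c) \<in> adhm_ideal" for A A' p q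
    proof -
      have sum_in: "(\<Sum>c\<in>A. t c) \<in> adhm_ideal" if "\<And>c. t c \<in> adhm_ideal"
        for A :: "2 set" and t :: "2 \<Rightarrow> 'a adhm_poly"
        using that
        by (induction A rule: infinite_finite_induct) (auto intro: adhm_ideal_zero adhm_ideal_add)
      have "p d * ent M d c \<in> adhm_ideal" for c d
        by (rule adhm_ideal_mult[OF adhm_equation_in_ideal[OF that]])
      then have "(\<Sum>d\<in>A'. p d * ent M d c) \<in> adhm_ideal" for c
        by (rule sum_in)
      then have "q c * (\<Sum>d\<in>A'. p d * ent M d c) \<in> adhm_ideal" for c
        by (rule adhm_ideal_mult)
      then have "(\<Sum>c\<in>A. q c * (\<Sum>d\<in>A'. p d * ent M d c)) \<in> adhm_ideal"
        by (rule sum_in)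
      then show ?thesis by (simp only: mult.commute[of "q _"])
    qed
    then show ?thesis by (simp add: conj_by_def matrix_matrix_mult_def)
  qed
  have "map_matrix2 (GL_act g) M = conj_by g M" if "M \<in> adhm_equations" for M
  proof -
    have "map_matrix2 (GL_act g) (A + B) = map_matrix2 (GL_act g) A + map_matrix2 (GL_act g) B"
      for A B by (simp add: vec_eq_iff G.hom)
    then show ?thesis
      using that g by (auto simp: adhm_equations_def Let_def G.map_matrix2_commutator
          GL_act_generic conj_by_add conj_by_commutator)
  qed
  then have act: "GL_act g (ent M a b) = ent (conj_by g M) a b" if "M \<in> adhm_equations" for M a b
    using that by (auto simp: vec_eq_iff)
  from f show ?thesis
  proof (induction rule: adhm_ideal_induct)
    case (generator M a b)
    then show ?case by (simp only: act conj_in)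
  qed (simp_all add: G.hom adhm_ideal_zero adhm_ideal_add adhm_ideal_mult)
qed

lemma GL_act_Const: "GL_act g (Const c) = Const c"
  by (simp add: GL_act_eq subst_poly_simps)

lemma invariants_Const: "Const c \<in> invariants"
  by (simp add: invariants_def GL_act_Const adhm_ideal_zero)

lemma adhm_ideal_subset_invariants: "adhm_ideal \<subseteq> invariants"
  by (auto simp: invariants_def intro: adhm_ideal_diff GL_act_adhm_ideal)

lemma invariants_add: "f \<in> invariants \<Longrightarrow> f' \<in> invariants \<Longrightarrow> f + f' \<in> invariants"
  using adhm_ideal_add
  by (fastforce simp: invariants_def ring_map.hom[OF ring_map_GL_act] add_diff_add)

lemma invariants_mult:
  assumes "f \<in> invariants" "f' \<in> invariants"
  shows "f * f' \<in> invariants"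
proof -
  have "GL_act g (f * f') - f * f' \<in> adhm_ideal" if "invertible g" for g
  proof -
    have "GL_act g (f * f') - f * f' =
        GL_act g f * (GL_act g f' - f') + f' * (GL_act g f - f)"
      by (simp add: ring_map.hom[OF ring_map_GL_act] algebra_simps)
    with assms that show ?thesis
      by (simp add: invariants_def adhm_ideal_add adhm_ideal_mult)
  qed
  then show ?thesis by (simp add: invariants_def)
qed

lemma invariants_0: "0 \<in> invariants" and invariants_1: "1 \<in> invariants"
  using invariants_Const[of 0] invariants_Const[of 1] by (simp_all add: Const_hom)

lemma invariants_uminus: "f \<in> invariants \<Longrightarrow> - f \<in> invariants"
  using invariants_mult[OF invariants_Const[of "-1"]] by (fastforce simp: Const_hom)

lemma invariants_diff: "f \<in> invariants \<Longrightarrow> f' \<in> invariants \<Longrightarrow> f - f' \<in> invariants"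
  using invariants_add[OF _ invariants_uminus] by fastforce

definition trace_poly :: "2 \<Rightarrow> 2 \<Rightarrow> 'k::comm_ring_1 adhm_poly" where
  "trace_poly j l = trace (generic_matrix j l)"

text \<open>Twice the trace form of the traceless parts of two of the matrices.\<close>

definition gram_poly :: "2 \<Rightarrow> 2 \<Rightarrow> 2 \<Rightarrow> 2 \<Rightarrow> 'k::comm_ring_1 adhm_poly" where
  "gram_poly j l j' l' =
     2 * trace (generic_matrix j l ** generic_matrix j' l') - trace_poly j l * trace_poly j' l'"

lemma GL_act_trace_poly: "invertible g \<Longrightarrow> GL_act g (trace_poly j l) = trace_poly j l"
  by (simp add: trace_poly_def ring_map.trace[OF ring_map_GL_act] GL_act_generic trace_conj_by)

lemma GL_act_gram_poly: "invertible g \<Longrightarrow> GL_act g (gram_poly j l j' l') = gram_poly j l j' l'"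
  by (simp add: gram_poly_def ring_map.hom[OF ring_map_GL_act] GL_act_trace_poly
      ring_map.trace[OF ring_map_GL_act] ring_map.map_matrix2_mult[OF ring_map_GL_act]
      GL_act_generic trace_conj_by flip: conj_by_mult)

lemma trace_poly_invariant: "trace_poly j l \<in> invariants"
  by (simp add: invariants_def GL_act_trace_poly adhm_ideal_zero)

lemma gram_poly_invariant: "gram_poly j l j' l' \<in> invariants"
  by (simp add: invariants_def GL_act_gram_poly adhm_ideal_zero)

lemma eval_trace_poly:
  "ring_map h \<Longrightarrow> eval_poly h (entry B) (trace_poly j l) = trace (B j l)"
  by (simp add: trace_poly_def trace_def eval_poly_hom generic_matrix_def adhm_variable_eq
      eval_poly_Var)

lemma eval_gram_poly:
  "ring_map h \<Longrightarrow> eval_poly h (entry B) (gram_poly j l j' l') =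
     2 * trace (B j l ** B j' l') - trace (B j l) * trace (B j' l')"
  by (simp add: gram_poly_def eval_trace_poly)
    (simp add: trace_def eval_poly_hom generic_matrix_def adhm_variable_eq eval_poly_Var
      matrix_matrix_mult_def eval_trace_poly)

section \<open>Products of minors\<close>

text \<open>The assignment \<open>z\<close> lists, for each of the four matrices, its \<open>(2, 2)\<close> entry, its two off-diagonal
  entries and the difference of its diagonal entries. These coordinates separate a scalar matrix from
  the part that enters commutators, and they need no division by two.\<close>

definition shear :: "(adhm_var \<Rightarrow> 'r::comm_ring_1) \<Rightarrow> 2 \<Rightarrow> 2 \<Rightarrow> 'r ^ 2 ^ 2" where
  "shear z j l = (\<chi> a b. z (j, l, a, b) + (if a = 1 \<and> b = 1 then z (j, l, 2, 2) else 0))"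

definition coord :: "'r::comm_ring_1 ^ 2 ^ 2 \<Rightarrow> 2 \<times> 2 \<Rightarrow> 'r" where
  "coord M q = ent M (fst q) (snd q) - (if q = (1, 1) then ent M 2 2 else 0)"

definition coord_poly :: "2 \<Rightarrow> 2 \<Rightarrow> 2 \<times> 2 \<Rightarrow> 'k::comm_ring_1 adhm_poly" where
  "coord_poly j l q = coord (generic_matrix j l) q"

definition unshear :: "adhm_var \<Rightarrow> 'k::comm_ring_1 adhm_poly" where
  "unshear = (\<lambda>(j, l, q). coord_poly j l q)"

lemma two_neq_one [simp]: "(2::2) \<noteq> 1" "(1::2) \<noteq> 2"
  by simp_all

lemma subst_unshear:
  fixes f :: "'k::comm_ring_1 adhm_poly"
  shows "subst_poly unshear (subst_poly (entry (shear Var)) f) = f"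
proof -
  have "subst_poly unshear (entry (shear Var) v) = (Var v :: 'k adhm_poly)" for v
  proof -
    obtain j l a b where v: "v = (j, l, a, b)" by (cases v)
    show ?thesis
      using exhaust_2[of a] exhaust_2[of b]
      by (auto simp: v shear_def subst_poly_simps unshear_def coord_poly_def coord_def
          generic_matrix_def adhm_variable_eq)
  qed
  then show ?thesis by (simp add: subst_subst subst_Var)
qed

text \<open>The entries of a commutator are the components of the cross product in the coordinates other than
  \<open>(2, 2)\<close>.\<close>

lemma coord_minor_commutator:
  assumes "q \<noteq> (2, 2)" "q' \<noteq> (2, 2)"
  obtains s :: "'r::comm_ring_1" and a b where
    "\<And>A B. coord A q * coord B q' - coord A q' * coord B q = s * ent (commutator A B) a b"
proof -
  have "\<exists>s a b. \<forall>A B :: 'r ^ 2 ^ 2.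
      coord A q * coord B q' - coord A q' * coord B q = s * ent (commutator A B) a b"
  proof -
    have "q = q' \<or> (q = (1, 1) \<and> q' = (1, 2)) \<or> (q = (1, 1) \<and> q' = (2, 1))
        \<or> (q = (1, 2) \<and> q' = (2, 1)) \<or> (q = (1, 2) \<and> q' = (1, 1)) \<or> (q = (2, 1) \<and> q' = (1, 1))
        \<or> (q = (2, 1) \<and> q' = (1, 2))"
      using assms exhaust_2[of "fst q"] exhaust_2[of "snd q"] exhaust_2[of "fst q'"]
        exhaust_2[of "snd q'"] by (auto simp: prod_eq_iff)
    then show ?thesis
      by (intro exI[of _ "if q = q' then 0 else
            if (q, q') \<in> {((1, 1), (1, 2)), ((1, 2), (2, 1)), ((2, 1), (1, 1))} then 1 else - 1"]
          exI[of _ "if (1, 2) \<in> {q, q'} then 1 else 2"] exI[of _ "if (2, 1) \<in> {q, q'} then 1 else 2"])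
        (elim disjE conjE; simp add: coord_def commutator_entry sum_2 algebra_simps)
  qed
  then show thesis using that by blast
qed

lemma coord_poly_minor:
  assumes "q \<noteq> (2, 2)" "q' \<noteq> (2, 2)"
  shows "coord_poly j l q * coord_poly j m q' - coord_poly j l q' * coord_poly j m q \<in> adhm_ideal"
proof -
  obtain s :: "'a adhm_poly" and a b where s:
    "\<And>A B. coord A q * coord B q' - coord A q' * coord B q = s * ent (commutator A B) a b"
    using coord_minor_commutator[OF assms] by blast
  have "ent (commutator (generic_matrix j 1) (generic_matrix j 2)) a b \<in> (adhm_ideal :: 'a adhm_poly set)"
    by (rule adhm_equation_in_ideal) (use exhaust_2[of j] in \<open>auto simp: adhm_equations_def Let_def\<close>)
  then have *: "coord_poly j 1 q * coord_poly j 2 q' - coord_poly j 1 q' * coord_poly j 2 q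
      \<in> (adhm_ideal :: 'a adhm_poly set)"
    unfolding coord_poly_def s by (rule adhm_ideal_mult)
  show ?thesis
    using * adhm_ideal_uminus[OF *] adhm_ideal_zero exhaust_2[of l] exhaust_2[of m]
    by (auto simp: algebra_simps)
qed

lemma coord_poly_mixed:
  assumes "q \<noteq> (2, 2)" "q' \<noteq> (2, 2)"
  shows "coord_poly 1 1 q * coord_poly 2 2 q' - coord_poly 1 1 q' * coord_poly 2 2 q
    + (coord_poly 2 1 q * coord_poly 1 2 q' - coord_poly 2 1 q' * coord_poly 1 2 q) \<in> adhm_ideal"
proof -
  obtain s :: "'a adhm_poly" and a b where s:
    "\<And>A B. coord A q * coord B q' - coord A q' * coord B q = s * ent (commutator A B) a b"
    using coord_minor_commutator[OF assms] by blast
  have "ent (commutator (generic_matrix 1 1) (generic_matrix 2 2) +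
      commutator (generic_matrix 2 1) (generic_matrix 1 2)) a b \<in> (adhm_ideal :: 'a adhm_poly set)"
    by (rule adhm_equation_in_ideal) (auto simp: adhm_equations_def Let_def)
  then show ?thesis
    unfolding coord_poly_def s distrib_left[symmetric] vector_add_component
    by (rule adhm_ideal_mult)
qed

lemma adhm_ideal_cong_mult:
  assumes "x - x' \<in> adhm_ideal" "y - y' \<in> adhm_ideal"
  shows "x * y - x' * y' \<in> adhm_ideal"
proof -
  have "x * y - x' * y' = x * (y - y') + y' * (x - x')" by (simp add: algebra_simps)
  then show ?thesis using assms by (simp add: adhm_ideal_add adhm_ideal_mult)
qed

text \<open>Modulo the relations between two of the matrices with the same first index, each of the
  four products in the expansion can be rewritten so that a common factor splits off; the other
  factor is the third ADHM equation.\<close>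

lemma minor_product_main:
  assumes q: "q \<noteq> (2, 2)" "q' \<noteq> (2, 2)" "s \<noteq> (2, 2)" "s' \<noteq> (2, 2)"
  shows "(coord_poly 1 l q * coord_poly 2 m q' - coord_poly 1 l q' * coord_poly 2 m q) *
    (coord_poly 1 1 s * coord_poly 2 2 s' - coord_poly 1 2 s * coord_poly 2 1 s') \<in> adhm_ideal"
proof -
  let ?a = "coord_poly 1 :: 2 \<Rightarrow> 2 \<times> 2 \<Rightarrow> 'a adhm_poly" and ?b = "coord_poly 2 :: 2 \<Rightarrow> 2 \<times> 2 \<Rightarrow> 'a adhm_poly"
  have a: "?a l p * ?a i s - ?a i p * ?a l s \<in> adhm_ideal" if "p \<noteq> (2, 2)" for p i
    using coord_poly_minor[OF that q(3), of 1 l i] by (simp add: mult.commute)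
  have b: "?b m p * ?b i s' - ?b i p * ?b m s' \<in> adhm_ideal" if "p \<noteq> (2, 2)" for p i
    using coord_poly_minor[OF that q(4), of 2 m i] by (simp add: mult.commute)
  have ab: "(?a l p * ?a i s) * (?b m p' * ?b i' s') - (?a i p * ?a l s) * (?b i' p' * ?b m s')
      \<in> adhm_ideal" if "p \<noteq> (2, 2)" "p' \<noteq> (2, 2)" for p p' i i'
    by (rule adhm_ideal_cong_mult) (use a b that in blast)+
  have mixed: "?a l s * ?b m s' * (?a 1 q * ?b 2 q' - ?a 1 q' * ?b 2 q
    + (?b 1 q * ?a 2 q' - ?b 1 q' * ?a 2 q)) \<in> adhm_ideal"
    by (rule adhm_ideal_mult[OF coord_poly_mixed[OF q(1,2)]])
  have "(?a l q * ?b m q' - ?a l q' * ?b m q) * (?a 1 s * ?b 2 s' - ?a 2 s * ?b 1 s') =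
      (((?a l q * ?a 1 s) * (?b m q' * ?b 2 s') - (?a 1 q * ?a l s) * (?b 2 q' * ?b m s'))
      - ((?a l q * ?a 2 s) * (?b m q' * ?b 1 s') - (?a 2 q * ?a l s) * (?b 1 q' * ?b m s')))
      - (((?a l q' * ?a 1 s) * (?b m q * ?b 2 s') - (?a 1 q' * ?a l s) * (?b 2 q * ?b m s'))
      - ((?a l q' * ?a 2 s) * (?b m q * ?b 1 s') - (?a 2 q' * ?a l s) * (?b 1 q * ?b m s')))
      + ?a l s * ?b m s' * (?a 1 q * ?b 2 q' - ?a 1 q' * ?b 2 q
        + (?b 1 q * ?a 2 q' - ?b 1 q' * ?a 2 q))"
    by (simp add: algebra_simps)
  also have "\<dots> \<in> adhm_ideal"
    by (intro adhm_ideal_add[OF _ mixed] adhm_ideal_diff ab q)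
  finally show ?thesis .
qed

text \<open>By antisymmetry every product is zero, or has a factor in the ADHM ideal, or reduces to
  \<open>minor_product_main\<close>.\<close>

lemma minor_product:
  assumes q: "q \<noteq> (2, 2)" "q' \<noteq> (2, 2)" "s \<noteq> (2, 2)" "s' \<noteq> (2, 2)"
  shows "(coord_poly j l q * coord_poly j' l' q' - coord_poly j l q' * coord_poly j' l' q) *
    (coord_poly i m s * coord_poly i' m' s' - coord_poly i m' s * coord_poly i' m s') \<in> adhm_ideal"
    (is "?M j l j' l' * ?N i i' m m' s s' \<in> _")
proof -
  have N_swap: "?N i i' m' m s s' = - ?N i i' m m' s s'" for i i' m m' s s'
    by (simp only: minus_diff_eq mult.commute)
  have N_swap': "?N i' i m m' s' s = - ?N i i' m m' s s'" for i i' m m' s s'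
    by (simp only: minus_diff_eq mult.commute)
  have M_swap: "?M j' l' j l = - ?M j l j' l'" for j l j' l'
    by (simp only: minus_diff_eq mult.commute)
  show ?thesis
  proof (cases "j = j'")
    case True
    then show ?thesis
      using adhm_ideal_mult_right[OF coord_poly_minor[OF q(1,2), of j l l']] by simp
  next
    case j: False
    show ?thesis
    proof (cases "i = i' \<or> m = m'")
      case True
      then have "?N i i' m m' s s' \<in> adhm_ideal"
      proof
        assume "i = i'"
        then show ?thesis using coord_poly_minor[OF q(3,4), of i m m'] by (simp add: mult.commute)
      next
        assume "m = m'"
        then show ?thesis by (simp add: adhm_ideal_zero)
      qed
      then show ?thesis by (rule adhm_ideal_mult)
    next
      case False
      have N: "?M 1 l 2 l' * ?N i i' m m' s s' \<in> adhm_ideal" for l l'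
      proof -
        have *: "?M 1 l 2 l' * ?N 1 2 1 2 s s' \<in> adhm_ideal" "?M 1 l 2 l' * ?N 1 2 1 2 s' s \<in> adhm_ideal"
          by (rule minor_product_main[OF q]) (rule minor_product_main[OF q(1,2,4,3)])
        have "(i = 1 \<and> i' = 2 \<or> i = 2 \<and> i' = 1) \<and> (m = 1 \<and> m' = 2 \<or> m = 2 \<and> m' = 1)"
          using False exhaust_2[of i] exhaust_2[of i'] exhaust_2[of m] exhaust_2[of m'] by auto
        then show ?thesis
        proof (elim conjE disjE)
          assume "i = 1" "i' = 2" "m = 1" "m' = 2"
          then show ?thesis using *(1) by simp
        next
          assume "i = 1" "i' = 2" "m = 2" "m' = 1"
          then show ?thesis
            using adhm_ideal_uminus[OF *(1)] N_swap[where i = 1 and i' = 2 and m = 1 and m' = 2 and s = s and s' = s'] by (simp only: mult_minus_right)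
        next
          assume i: "i = 2" "i' = 1" "m = 1" "m' = 2"
          have "?M 1 l 2 l' * ?N i i' m m' s s' = - (?M 1 l 2 l' * ?N 1 2 1 2 s' s)"
            unfolding i N_swap'[where i' = 2 and i = 1 and m = 1 and m' = 2 and s = s' and s' = s]
            by (simp only: mult_minus_right)
          with adhm_ideal_uminus[OF *(2)] show ?thesis by simp
        next
          assume i: "i = 2" "i' = 1" "m = 2" "m' = 1"
          have "?M 1 l 2 l' * ?N i i' m m' s s' = ?M 1 l 2 l' * ?N 1 2 1 2 s' s"
            unfolding i N_swap'[where i' = 2 and i = 1 and m = 2 and m' = 1 and s = s' and s' = s] N_swap[where i = 1 and i' = 2 and m = 1 and m' = 2 and s = s' and s' = s]
            by (simp only: mult_minus_right minus_minus)
          with *(2) show ?thesis by simp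
        qed
      qed
      have "j = 1 \<and> j' = 2 \<or> j = 2 \<and> j' = 1" using j exhaust_2[of j] exhaust_2[of j'] by auto
      then show ?thesis
      proof (elim conjE disjE)
        assume "j = 1" "j' = 2"
        then show ?thesis using N by simp
      next
        assume "j = 2" "j' = 1"
        then show ?thesis
          using adhm_ideal_uminus[OF N[of l' l]] M_swap[where j' = 2 and l' = l and j = 1 and l = l'] by (simp only: mult_minus_left)
      qed
    qed
  qed
qed

section \<open>Two families of ADHM data\<close>

abbreviation mat2 :: "'r \<Rightarrow> 'r \<Rightarrow> 'r \<Rightarrow> 'r \<Rightarrow> 'r ^ 2 ^ 2" where
  "mat2 a b c d \<equiv> (\<chi> i j. if i = 1 then (if j = 1 then a else b) else (if j = 1 then c else d))"

lemma mat2_eq_iff: "(A :: 'r ^ 2 ^ 2) = B \<longleftrightarrow>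
    ent A 1 1 = ent B 1 1 \<and> ent A 1 2 = ent B 1 2 \<and> ent A 2 1 = ent B 2 1 \<and> ent A 2 2 = ent B 2 2"
  by (auto simp: vec_eq_iff forall_2)

definition split_data ::
    "(2 \<Rightarrow> 2 \<Rightarrow> 'r::comm_ring_1) \<Rightarrow> (2 \<Rightarrow> 2 \<Rightarrow> 'r) \<Rightarrow> 2 \<Rightarrow> 2 \<Rightarrow> 'r ^ 2 ^ 2" where
  "split_data t s j l = mat2 (t j l + s j l) 0 0 (t j l - s j l)"

text \<open>Each \<open>B\<^sub>j\<^sub>l\<close> is a scalar matrix plus \<open>r\<^sub>l W\<^sub>j\<close> with \<open>r = (1, p)\<close>, where \<open>W\<^sub>1\<close> is upper triangular and \<open>W\<^sub>2\<close>
  is lower triangular. The upper right entry of \<open>W\<^sub>1\<close> is normalized by the choice of the basis, and the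
  lower right entries of both vanish by the choice of the scalar matrices.\<close>

definition pencil_data ::
    "(2 \<Rightarrow> 2 \<Rightarrow> 'r::comm_ring_1) \<Rightarrow> 'r \<Rightarrow> 'r \<Rightarrow> 'r \<Rightarrow> 'r \<Rightarrow> 2 \<Rightarrow> 2 \<Rightarrow> 'r ^ 2 ^ 2" where
  "pencil_data t p a b c j l =
     (let r = (if l = 1 then 1 else p) in
      if j = 1 then mat2 (t j l + r * a) r 0 (t j l) else mat2 (t j l + r * b) 0 (r * c) (t j l))"

lemma adhm_data_split: "adhm_data (split_data t s)"
  by (simp add: adhm_data_def mat2_eq_iff commutator_entry sum_2 split_data_def)

lemma adhm_data_pencil: "adhm_data (pencil_data t p a b c)"
  by (simp add: adhm_data_def mat2_eq_iff commutator_entry sum_2 pencil_data_def Let_def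
      algebra_simps)

lemma map_split_data:
  assumes "ring_map F"
  shows "map_matrix2 F (split_data t s j l) = split_data (\<lambda>j l. F (t j l)) (\<lambda>j l. F (s j l)) j l"
  by (simp add: mat2_eq_iff split_data_def ring_map.hom[OF assms])

lemma map_pencil_data:
  assumes "ring_map F"
  shows "map_matrix2 F (pencil_data t p a b c j l) =
    pencil_data (\<lambda>j l. F (t j l)) (F p) (F a) (F b) (F c) j l"
  by (simp add: mat2_eq_iff pencil_data_def Let_def ring_map.hom[OF assms])

lemma invariant_at_similar:
  assumes f: "f \<in> invariants" and B: "adhm_data B" and g: "invertible g"
    and BD: "\<And>j l. B j l ** g = g ** D j l"
  shows "at_point (entry B) f = at_point (entry D) f"
proof -
  have "matrix_inv g ** B j l ** g = D j l" for j l
  proof -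
    have "matrix_inv g ** B j l ** g = matrix_inv g ** (B j l ** g)"
      by (simp only: matrix_mul_assoc)
    also have "\<dots> = (matrix_inv g ** g) ** D j l" by (simp only: BD matrix_mul_assoc)
    finally show ?thesis by (simp only: matrix_inv_mult[OF g] matrix_mul_lid)
  qed
  then show ?thesis using invariant_at_conjugate[OF f B g] by simp
qed

lemma commutator_shear:
  "commutator (shear z j l) (shear z j' l') =
    mat2 (z (j, l, 1, 2) * z (j', l', 2, 1) - z (j, l, 2, 1) * z (j', l', 1, 2))
      (z (j, l, 1, 1) * z (j', l', 1, 2) - z (j, l, 1, 2) * z (j', l', 1, 1))
      (z (j, l, 2, 1) * z (j', l', 1, 1) - z (j, l, 1, 1) * z (j', l', 2, 1))
      (z (j, l, 2, 1) * z (j', l', 1, 2) - z (j, l, 1, 2) * z (j', l', 2, 1))"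
  by (simp add: mat2_eq_iff commutator_entry sum_2 shear_def algebra_simps)

text \<open>In the first family all cross products vanish. In the second those with equal \<open>j\<close> vanish and the two
  mixed ones cancel.\<close>

lemma adhm_data_rank_one_1:
  "adhm_data (shear (\<lambda>(j, l, q). if q = (2, 2) then y j l else w q * v j l))"
  by (simp add: adhm_data_def mat2_eq_iff commutator_shear mult.commute mult.left_commute)

lemma adhm_data_rank_one_2:
  "adhm_data (shear (\<lambda>(j, l, q). if q = (2, 2) then y j l else p l * w j q))"
  by (simp add: adhm_data_def mat2_eq_iff commutator_shear mult.commute mult.left_commute)

text \<open>The characteristic equation of a matrix whose \<open>(2, 2)\<close> entry is zero.\<close>

lemma quadratic_root:
  fixes a b :: "'k::alg_closed_field"
  obtains x where "x * x = a * x + b"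
proof -
  obtain x where "poly [:- b, - a, 1:] x = 0"
    using alg_closed_imp_poly_has_root[of "[:- b, - a, 1:]"] by auto
  then have "x * x = a * x + b" by (simp add: algebra_simps)
  then show thesis by (rule that)
qed

lemma invertible_mat2:
  fixes a :: "'k::field"
  assumes "a * d - b * c \<noteq> 0"
  shows "invertible (mat2 a b c d)"
  using assms by (simp add: invertible_det_nz det_2)

text \<open>The assumption on \<open>w\<close> says that the common matrix has distinct eigenvalues (the second factor is its
  discriminant) and that its eigenvectors may be normalized to have the lower left entry as second
  component.\<close>

lemma vanishes_on_rank_one_1:
  fixes f :: "'k::{alg_closed_field, field_char_0} adhm_poly"
  assumes f: "f \<in> invariants" and split: "\<And>t s. at_point (entry (split_data t s)) f = 0"
    and nz: "w (2, 1) * (w (1, 1) * w (1, 1) + 4 * w (1, 2) * w (2, 1)) \<noteq> 0"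
  shows "at_point (entry (shear (\<lambda>(j, l, q). if q = (2, 2) then y j l else w q * v j l))) f = 0"
proof -
  define a b c where "a = w (1, 1)" and "b = w (1, 2)" and "c = w (2, 1)"
  obtain x where x: "x * x = a * x + b * c" by (rule quadratic_root)
  define x' where "x' = a - x"
  have x': "x' * x' = a * x' + b * c" using x by (simp add: x'_def algebra_simps)
  have "(x - x') * (x - x') = a * a + 4 * (x * x - a * x)"
    by (simp add: x'_def algebra_simps)
  also have "\<dots> = a * a + 4 * b * c" by (simp add: x)
  finally have "(x - x') * (x - x') = a * a + 4 * b * c" .
  with nz have ne: "x - x' \<noteq> 0" "c \<noteq> 0" by (auto simp: a_def b_def c_def)
  let ?B = "shear (\<lambda>(j, l, q). if q = (2, 2) then y j l else w q * v j l)"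
  let ?g = "mat2 x x' c c"
  have g: "invertible ?g" using ne by (intro invertible_mat2) (simp add: left_diff_distrib[symmetric])
  let ?D = "split_data (\<lambda>j l. y j l + v j l * a / 2) (\<lambda>j l. v j l * (x - x') / 2)"
  have half: "v j l * a / 2 + v j l * (x - x') / 2 = v j l * x"
    "v j l * a / 2 - v j l * (x - x') / 2 = v j l * x'" for j l
    by (simp_all add: x'_def field_simps)
  have D: "?D j l = mat2 (y j l + v j l * x) 0 0 (y j l + v j l * x')" for j l
    by (simp add: mat2_eq_iff split_data_def half[symmetric])
  have E: "a * (x * u) + b * (c * u) = x * (x * u)" "a * (x' * u) + b * (c * u) = x' * (x' * u)" for u
    using arg_cong[OF x, of "\<lambda>z. z * u"] arg_cong[OF x', of "\<lambda>z. z * u"]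
    by (simp_all add: distrib_right mult.assoc)
  have "?B j l ** ?g = ?g ** ?D j l" for j l
    unfolding D using E[of "v j l"]
    by (simp add: mat2_eq_iff matrix_matrix_mult_def sum_2 shear_def flip: a_def b_def c_def)
      (simp add: algebra_simps)
  from invariant_at_similar[OF f adhm_data_rank_one_1 g this] split show ?thesis by simp
qed

text \<open>The resultant of the two quadratic equations for the slope of an eigenvector.\<close>

definition pencil_resultant :: "(2 \<Rightarrow> 2 \<times> 2 \<Rightarrow> 'r::comm_ring_1) \<Rightarrow> 'r" where
  "pencil_resultant w =
     (w 2 (2, 1) * w 1 (1, 2) - w 1 (2, 1) * w 2 (1, 2)) ^ 2 +
     (w 1 (2, 1) * w 2 (1, 1) - w 2 (2, 1) * w 1 (1, 1)) *
     (w 1 (1, 1) * w 2 (1, 2) - w 2 (1, 1) * w 1 (1, 2))"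

lemma common_root_resultant:
  fixes w :: "2 \<Rightarrow> 2 \<times> 2 \<Rightarrow> 'r::comm_ring_1"
  assumes "\<And>j. w j (2, 1) * u * u = w j (1, 1) * u + w j (1, 2)"
  shows "pencil_resultant w = 0"
proof -
  have "w j (1, 2) = w j (2, 1) * u * u - w j (1, 1) * u" for j
    by (simp add: assms)
  then show ?thesis
    unfolding pencil_resultant_def power2_eq_square by (simp only:) (simp add: algebra_simps)
qed

text \<open>Without a common eigenvector, an eigenvector of \<open>w\<^sub>1\<close> and one of \<open>w\<^sub>2\<close> form a basis in which \<open>w\<^sub>1\<close> is
  upper and \<open>w\<^sub>2\<close> lower triangular. Rescaling the second basis vector makes the upper right entry of
  \<open>w\<^sub>1\<close> equal to one.\<close>

lemma vanishes_on_rank_one_2_normalized: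
  fixes f :: "'k::{alg_closed_field, field_char_0} adhm_poly"
  assumes f: "f \<in> invariants"
    and pencil: "\<And>t p a b c. at_point (entry (pencil_data t p a b c)) f = 0"
    and nz: "w 1 (2, 1) \<noteq> 0" "w 2 (2, 1) \<noteq> 0" "pencil_resultant w \<noteq> 0" and p1: "p 1 = 1"
  shows "at_point (entry (shear (\<lambda>(j, l, q). if q = (2, 2) then y j l else p l * w j q))) f = 0"
proof -
  define a b c where "a j = w j (1, 1)" and "b j = w j (1, 2)" and "c j = w j (2, 1)" for j
  have c: "c 1 \<noteq> 0" "c 2 \<noteq> 0" using nz by (simp_all add: c_def)
  have no_common_root: False if "c 1 * u * u = a 1 * u + b 1" "c 2 * u * u = a 2 * u + b 2" for u
  proof -
    have "pencil_resultant w = 0"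
    proof (rule common_root_resultant[of w u])
      show "w j (2, 1) * u * u = w j (1, 1) * u + w j (1, 2)" for j
        using exhaust_2[of j] that by (auto simp: a_def b_def c_def)
    qed
    with nz(3) show False by simp
  qed
  obtain x where x: "x * x = a 1 * x + b 1 * c 1" by (rule quadratic_root)
  obtain x' where x': "x' * x' = a 2 * x' + b 2 * c 2" by (rule quadratic_root)
  define z where "z = a 1 - x"
  have z: "z * z = a 1 * z + b 1 * c 1" using x by (simp add: z_def algebra_simps)
  have root: "c j * (v / c j) * (v / c j) = a j * (v / c j) + b j"
    if "v * v = a j * v + b j * c j" "c j \<noteq> 0" for v j
    using that by (simp add: field_simps)
  have ne: "x * c 2 - x' * c 1 \<noteq> 0"
  proof
    assume "x * c 2 - x' * c 1 = 0"
    then have "x / c 1 = x' / c 2" using c by (simp add: field_simps)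
    then show False using no_common_root[of "x / c 1"] root[OF x c(1)] root[OF x' c(2)] by simp
  qed
  \<comment> \<open>\<open>\<mu>\<close> and \<open>\<nu>\<close> are the off-diagonal entries before rescaling. If \<open>\<mu>\<close> were zero, the second basis vector
    would be an eigenvector of \<open>w\<^sub>1\<close> for its other eigenvalue \<open>z\<close>.\<close>
  define \<mu> where "\<mu> = x' - z * c 2 / c 1"
  define \<nu> where "\<nu> = x - (a 2 - x') * c 1 / c 2"
  have \<mu>: "\<mu> \<noteq> 0"
  proof
    assume "\<mu> = 0"
    then have "z / c 1 = x' / c 2" using c by (simp add: \<mu>_def field_simps)
    then show False using no_common_root[of "z / c 1"] root[OF z c(1)] root[OF x' c(2)] by simp
  qed
  let ?B = "shear (\<lambda>(j, l, q). if q = (2, 2) then y j l else p l * w j q)"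
  let ?g = "mat2 x (x' / \<mu>) (c 1) (c 2 / \<mu>)"
  have g: "invertible ?g"
    using ne \<mu> by (intro invertible_mat2) (simp add: field_simps)
  let ?D = "pencil_data (\<lambda>j l. y j l + p l * (if j = 1 then z else x')) (p 2)
    (x - z) (a 2 - x' - x') (\<nu> * \<mu>)"
  have D1: "?D 1 l = mat2 (y 1 l + p l * x) (p l) 0 (y 1 l + p l * z)" for l
    using exhaust_2[of l] p1 by (auto simp: mat2_eq_iff pencil_data_def Let_def algebra_simps)
  have D2: "?D 2 l = mat2 (y 2 l + p l * (a 2 - x')) 0 (p l * \<nu> * \<mu>) (y 2 l + p l * x')" for l
    using exhaust_2[of l] p1 by (auto simp: mat2_eq_iff pencil_data_def Let_def algebra_simps)
  have e1: "a 1 * x + b 1 * c 1 = x * x" "a 1 * (x' / \<mu>) + b 1 * (c 2 / \<mu>) = x + x' / \<mu> * z"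
    "c 1 * (x' / \<mu>) = c 1 + c 2 / \<mu> * z"
  proof -
    show "a 1 * x + b 1 * c 1 = x * x" by (simp add: x)
    have m: "c 1 * \<mu> = c 1 * x' - z * c 2" using c by (simp add: \<mu>_def right_diff_distrib)
    then show "c 1 * (x' / \<mu>) = c 1 + c 2 / \<mu> * z"
      using \<mu> by (simp add: field_simps)
    have a1: "a 1 = x + z" by (simp add: z_def)
    have b: "b 1 * c 1 = - (x * z)" using x by (simp add: z_def algebra_simps)
    have "c 1 * (a 1 * x' + b 1 * c 2) = (x + z) * (c 1 * x') + (b 1 * c 1) * c 2"
      by (simp add: a1 algebra_simps)
    also have "\<dots> = x * (c 1 * x' - z * c 2) + c 1 * (x' * z)"
      by (simp only: b) (simp add: algebra_simps)
    also have "\<dots> = c 1 * (x * \<mu> + x' * z)"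
      by (simp only: m[symmetric]) (simp add: algebra_simps)
    finally have "a 1 * x' + b 1 * c 2 = x * \<mu> + x' * z" using c(1) by simp
    then show "a 1 * (x' / \<mu>) + b 1 * (c 2 / \<mu>) = x + x' / \<mu> * z"
      using \<mu> c(1) by (simp add: field_simps)
  qed
  have e2: "a 2 * (x' / \<mu>) + b 2 * (c 2 / \<mu>) = x' / \<mu> * x'"
    "a 2 * x + b 2 * c 1 = x * (a 2 - x') + x' / \<mu> * (\<nu> * \<mu>)"
    "c 2 * x = c 1 * (a 2 - x') + c 2 / \<mu> * (\<nu> * \<mu>)"
  proof -
    show "a 2 * (x' / \<mu>) + b 2 * (c 2 / \<mu>) = x' / \<mu> * x'"
      using \<mu> x' by (simp add: field_simps)
    have m: "c 2 * \<nu> = c 2 * x - (a 2 - x') * c 1" using c by (simp add: \<nu>_def right_diff_distrib)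
    then show "c 2 * x = c 1 * (a 2 - x') + c 2 / \<mu> * (\<nu> * \<mu>)"
      using \<mu> by (simp add: algebra_simps)
    have b: "b 2 * c 2 = x' * x' - a 2 * x'" by (simp add: x')
    have "c 2 * (a 2 * x + b 2 * c 1) = a 2 * (c 2 * x) + (b 2 * c 2) * c 1"
      by (simp add: algebra_simps)
    also have "\<dots> = c 2 * x * (a 2 - x') + x' * (c 2 * x - (a 2 - x') * c 1)"
      by (simp only: b) (simp add: algebra_simps)
    also have "\<dots> = c 2 * (x * (a 2 - x') + x' * \<nu>)"
      by (simp only: m[symmetric]) (simp add: algebra_simps)
    finally show "a 2 * x + b 2 * c 1 = x * (a 2 - x') + x' / \<mu> * (\<nu> * \<mu>)"
      using \<mu> c(2) by simp
  qed
  have lin: "(v + r * d) * h + r * e * h' = v * h + r * R" if "d * h + e * h' = R" for v r d h e h' R :: 'k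
    using that by (auto simp: algebra_simps)
  have "?B 1 l ** ?g = ?g ** ?D 1 l" for l
    unfolding D1 using lin[OF e1(1), of "y 1 l" "p l"] lin[OF e1(2), of "y 1 l" "p l"]
      arg_cong[OF e1(3), of "\<lambda>v. p l * v"]
    by (simp add: mat2_eq_iff matrix_matrix_mult_def sum_2 shear_def flip: a_def b_def c_def)
      (simp add: algebra_simps add_divide_distrib)
  moreover have e3: "c 2 * x * v = c 1 * (a 2 - x') * v + c 2 * \<nu> * v" for v
    using arg_cong[OF e2(3), of "\<lambda>u. u * v"] \<mu> by (simp add: distrib_right mult.assoc)
  have "?B 2 l ** ?g = ?g ** ?D 2 l" for l
    unfolding D2 using lin[OF e2(1), of "y 2 l" "p l"] lin[OF e2(2), of "y 2 l" "p l"]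
      e3[of "p l"] \<mu>
    by (simp add: mat2_eq_iff matrix_matrix_mult_def sum_2 shear_def flip: a_def b_def c_def)
      (simp add: algebra_simps add_divide_distrib)
  ultimately have "?B j l ** ?g = ?g ** ?D j l" for j l
    using exhaust_2[of j] by auto
  from invariant_at_similar[OF f adhm_data_rank_one_2 g this] pencil show ?thesis by simp
qed

lemma vanishes_on_rank_one_2:
  fixes f :: "'k::{alg_closed_field, field_char_0} adhm_poly"
  assumes f: "f \<in> invariants"
    and pencil: "\<And>t p a b c. at_point (entry (pencil_data t p a b c)) f = 0"
    and nz: "p 1 \<noteq> 0" "w 1 (2, 1) \<noteq> 0" "w 2 (2, 1) \<noteq> 0" "pencil_resultant w \<noteq> 0"
  shows "at_point (entry (shear (\<lambda>(j, l, q). if q = (2, 2) then y j l else p l * w j q))) f = 0"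
proof -
  define w' where "w' j q = p 1 * w j q" for j q
  have "pencil_resultant w' = p 1 ^ 4 * pencil_resultant w"
    by (simp add: pencil_resultant_def w'_def power2_eq_square algebra_simps power_numeral_reduce)
  then have "at_point (entry (shear (\<lambda>(j, l, q). if q = (2, 2) then y j l
      else (p l / p 1) * w' j q))) f = 0"
    using nz by (intro vanishes_on_rank_one_2_normalized f pencil)
      (simp_all only: \<open>pencil_resultant w' = _\<close>, simp_all add: w'_def)
  then show ?thesis using nz(1) by (simp add: w'_def cong: if_cong)
qed

section \<open>Invariants vanishing on a family\<close>

type_synonym 'k npoly = "(nat \<Rightarrow>\<^sub>0 nat) \<Rightarrow>\<^sub>0 'k"

lemma poly_eq_0_if_vanishes_generically:
  fixes F D :: "'k::field_char_0 npoly"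
  assumes F: "\<And>\<tau>. at_point \<tau> D \<noteq> 0 \<Longrightarrow> at_point \<tau> F = 0" and D: "at_point \<tau>\<^sub>0 D \<noteq> 0"
  shows "F = 0"
proof -
  have "at_point \<tau> (F * D) = 0" for \<tau>
    using F[of \<tau>] by (auto simp: at_point_simps)
  then have "F * D = 0" by (rule poly_eq_0_if_vanishes)
  moreover have "D \<noteq> 0" using D by (auto simp: at_point_simps)
  ultimately show ?thesis by simp
qed

lemma poly_eqI_at_points:
  fixes F G :: "('v \<Rightarrow>\<^sub>0 nat) \<Rightarrow>\<^sub>0 'k::field_char_0"
  assumes "\<And>\<tau>. at_point \<tau> F = at_point \<tau> G"
  shows "F = G"
  using poly_eq_0_if_vanishes[of "F - G"] assms by (simp add: at_point_simps)

lemma at_point_subst_entry: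
  "at_point \<tau> (subst_poly (entry D) f) =
    at_point (entry (\<lambda>j l. map_matrix2 (at_point \<tau>) (D j l))) f"
  unfolding at_point_subst by (intro arg_cong2[of _ _ _ _ at_point]) (auto simp: entry_def)

definition code2 :: "2 \<Rightarrow> nat" where
  "code2 j = (if j = 1 then 0 else 1)"

definition decode2 :: "nat \<Rightarrow> 2" where
  "decode2 n = (if n = 0 then 1 else 2)"

lemma code2_simps [simp]: "code2 1 = 0" "code2 2 = 1"
  by (simp_all add: code2_def)

lemma decode2_code2 [simp]: "decode2 (code2 j) = j"
  using exhaust_2[of j] by (auto simp: decode2_def)

lemma code2_less: "code2 j < 2"
  by (simp add: code2_def)

lemma code2_eq_iff [simp]: "code2 j = code2 j' \<longleftrightarrow> j = j'"
  using exhaust_2[of j] exhaust_2[of j'] by auto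

abbreviation code4 :: "2 \<Rightarrow> 2 \<Rightarrow> nat" where
  "code4 j l \<equiv> 2 * code2 j + code2 l"

lemma code4_less: "code4 j l < 4"
  using code2_less[of j] code2_less[of l] by simp

lemma code4_div_mod [simp]: "code4 j l div 2 = code2 j" "code4 j l mod 2 = code2 l"
  using code2_less[of l] by simp_all

lemma code4_eq_iff [simp]: "code4 j l = code4 j' l' \<longleftrightarrow> j = j' \<and> l = l'"
  using exhaust_2[of j] exhaust_2[of j'] exhaust_2[of l] exhaust_2[of l'] by auto

definition decode4 :: "(2 \<Rightarrow> 2 \<Rightarrow> 'r) \<Rightarrow> nat \<Rightarrow> 'r" where
  "decode4 t n = t (decode2 (n div 2)) (decode2 (n mod 2))"

lemma decode4_code4 [simp]: "decode4 t (code4 j l) = t j l"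
  using exhaust_2[of j] exhaust_2[of l] by (auto simp: decode4_def decode2_def)

text \<open>The variables \<open>0, \<dots>, 3\<close> are the half traces and \<open>4, \<dots>, 7\<close> half the eigenvalue differences.\<close>

definition split_restrict :: "'k::comm_ring_1 adhm_poly \<Rightarrow> 'k npoly" where
  "split_restrict =
     subst_poly (entry (split_data (\<lambda>j l. Var (code4 j l)) (\<lambda>j l. Var (4 + code4 j l))))"

text \<open>The variables \<open>0, \<dots>, 3\<close> are the \<open>(2, 2)\<close> entries, which do not depend on the other parameters.\<close>

definition pencil_restrict :: "'k::comm_ring_1 adhm_poly \<Rightarrow> 'k npoly" where
  "pencil_restrict =
     subst_poly (entry (pencil_data (\<lambda>j l. Var (code4 j l)) (Var 4) (Var 5) (Var 6) (Var 7)))"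

lemma at_point_split_restrict:
  "at_point \<tau> (split_restrict f) =
     at_point (entry (split_data (\<lambda>j l. \<tau> (code4 j l)) (\<lambda>j l. \<tau> (4 + code4 j l)))) f"
  by (simp add: split_restrict_def at_point_subst_entry map_split_data
      ring_map_eval_poly[OF ring_map_id] at_point_simps)

lemma at_point_pencil_restrict:
  "at_point \<tau> (pencil_restrict f) =
     at_point (entry (pencil_data (\<lambda>j l. \<tau> (code4 j l)) (\<tau> 4) (\<tau> 5) (\<tau> 6) (\<tau> 7))) f"
  by (simp add: pencil_restrict_def at_point_subst_entry map_pencil_data
      ring_map_eval_poly[OF ring_map_id] at_point_simps)

lemma split_restrict_eq_0D:
  assumes "split_restrict f = 0"
  shows "at_point (entry (split_data t s)) f = 0"
proof -
  define \<tau> where "\<tau> n = (if n < 4 then decode4 t n else decode4 s (n - 4))" for n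
  have "\<tau> (code4 j l) = t j l" "\<tau> (4 + code4 j l) = s j l" for j l
    using code4_less[of j l] by (simp_all add: \<tau>_def)
  then show ?thesis
    using at_point_split_restrict[of \<tau> f] assms by (simp add: at_point_simps)
qed

lemma pencil_restrict_eq_0D:
  assumes "pencil_restrict f = 0"
  shows "at_point (entry (pencil_data t p a b c)) f = 0"
proof -
  define \<tau> where "\<tau> n = (if n < 4 then decode4 t n else if n = 4 then p else if n = 5 then a
    else if n = 6 then b else c)" for n :: nat
  have "\<tau> (code4 j l) = t j l" for j l
    using code4_less[of j l] by (simp add: \<tau>_def)
  moreover have "\<tau> 4 = p" "\<tau> 5 = a" "\<tau> 6 = b" "\<tau> 7 = c" by (simp_all add: \<tau>_def)
  ultimately show ?thesis
    using at_point_pencil_restrict[of \<tau> f] assms by (simp add: at_point_simps)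
qed

lemma at_point_segre:
  "at_point \<tau> (subst_poly (\<lambda>v. Var (r v) * Var (c v)) (subst_poly (entry (shear Var)) f)) =
    at_point (entry (shear (\<lambda>v. \<tau> (r v) * \<tau> (c v)))) f"
proof -
  have "at_point (\<lambda>v. \<tau> (r v) * \<tau> (c v)) (entry (shear Var) v) =
      entry (shear (\<lambda>v. \<tau> (r v) * \<tau> (c v))) v" for v
    by (cases v) (simp add: shear_def at_point_simps)
  then show ?thesis
    by (simp add: at_point_subst at_point_simps)
qed

text \<open>Row and column of each coordinate in the matrix of rank one. The first family has one row for each
  matrix entry and one column for each of the four matrices. Each \<open>(2, 2)\<close> entry gets a row and a column of
  its own, so that it is not affected by exchanges. The offsets keep all codes apart.\<close>

definition row1 :: "adhm_var \<Rightarrow> nat" where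
  "row1 = (\<lambda>(j, l, a, b). if (a, b) = (2, 2) then 10 + code4 j l else code4 a b)"

definition col1 :: "adhm_var \<Rightarrow> nat" where
  "col1 = (\<lambda>(j, l, a, b). if (a, b) = (2, 2) then 30 + code4 j l else 20 + code4 j l)"

text \<open>In the second family the rows are indexed by \<open>l\<close> and the columns by \<open>j\<close> together with the matrix entry.\<close>

definition row2 :: "adhm_var \<Rightarrow> nat" where
  "row2 = (\<lambda>(j, l, a, b). if (a, b) = (2, 2) then 10 + code4 j l else code2 l)"

definition col2 :: "adhm_var \<Rightarrow> nat" where
  "col2 = (\<lambda>(j, l, a, b). if (a, b) = (2, 2) then 40 + code4 j l
     else 20 + (4 * code2 j + code4 a b))"

lemma code8_eq_iff [simp]:
  "4 * code2 j + code4 a b = 4 * code2 j' + code4 a' b' \<longleftrightarrow> j = j' \<and> a = a' \<and> b = b'"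
  using exhaust_2[of j] exhaust_2[of j'] code4_less[of a b] code4_less[of a' b']
  by (auto simp flip: code4_eq_iff)

lemma row1_col1_inj: "row1 x = row1 y \<Longrightarrow> col1 x = col1 y \<Longrightarrow> x = y"
proof -
  obtain j l a b where x: "x = (j, l, a, b)" by (rule prod_cases4)
  obtain j' l' a' b' where y: "y = (j', l', a', b')" by (rule prod_cases4)
  show "row1 x = row1 y \<Longrightarrow> col1 x = col1 y \<Longrightarrow> x = y"
    using code4_less[of j l] code4_less[of j' l'] code4_less[of a b] code4_less[of a' b']
    by (auto simp: x y row1_def col1_def split: if_splits)
qed

lemma row2_col2_inj: "row2 x = row2 y \<Longrightarrow> col2 x = col2 y \<Longrightarrow> x = y"
proof -
  obtain j l a b where x: "x = (j, l, a, b)" by (rule prod_cases4)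
  obtain j' l' a' b' where y: "y = (j', l', a', b')" by (rule prod_cases4)
  show "row2 x = row2 y \<Longrightarrow> col2 x = col2 y \<Longrightarrow> x = y"
    using code4_less[of j l] code4_less[of j' l'] code4_less[of a b] code4_less[of a' b']
      code2_less[of j] code2_less[of j'] code2_less[of l] code2_less[of l']
    by (auto simp: x y row2_def col2_def split: if_splits)
qed

lemma row1_neq_col1: "row1 x \<noteq> col1 y"
proof -
  obtain j l a b where x: "x = (j, l, a, b)" by (rule prod_cases4)
  obtain j' l' a' b' where y: "y = (j', l', a', b')" by (rule prod_cases4)
  show ?thesis
    using code4_less[of j l] code4_less[of j' l'] code4_less[of a b] code4_less[of a' b']
    by (auto simp: x y row1_def col1_def)
qed

lemma row2_neq_col2: "row2 x \<noteq> col2 y"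
proof -
  obtain j l a b where x: "x = (j, l, a, b)" by (rule prod_cases4)
  obtain j' l' a' b' where y: "y = (j', l', a', b')" by (rule prod_cases4)
  show ?thesis
    using code4_less[of j l] code4_less[of j' l'] code2_less[of l]
    by (auto simp: x y row2_def col2_def)
qed

text \<open>The colon ideal of the ADHM ideal by the \<open>2 \<times> 2\<close> minors that define the second family.\<close>

definition minors2_annihilator :: "'k::comm_ring_1 adhm_poly set" where
  "minors2_annihilator = {h. \<forall>i m s i' m' s'. s \<noteq> (2, 2) \<longrightarrow> s' \<noteq> (2, 2) \<longrightarrow>
     h * (coord_poly i m s * coord_poly i' m' s' - coord_poly i m' s * coord_poly i' m s')
       \<in> adhm_ideal}"

text \<open>The invariant vanishes on the whole first family, so it is a combination of minors of the first
  kind, and these are in the colon ideal by \<open>minor_product\<close>.\<close>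

lemma split_kernel:
  fixes f :: "'k::{alg_closed_field, field_char_0} adhm_poly"
  assumes f: "f \<in> invariants" and "split_restrict f = 0"
  shows "f \<in> minors2_annihilator"
proof -
  define f' where "f' = subst_poly (entry (shear Var)) f"
  define F where "F = subst_poly (\<lambda>v. Var (row1 v) * Var (col1 v)) f'"
  \<comment> \<open>The genericity condition of \<open>vanishes_on_rank_one_1\<close>.\<close>
  define D :: "'k npoly" where
    "D = Var 2 * (Var 0 * Var 0 + 4 * Var 1 * Var 2)"
  have "F = 0"
  proof (rule poly_eq_0_if_vanishes_generically)
    fix \<tau> :: "nat \<Rightarrow> 'k"
    assume D: "at_point \<tau> D \<noteq> 0"
    have "(\<lambda>v. \<tau> (row1 v) * \<tau> (col1 v)) = (\<lambda>(j, l, q). if q = (2, 2)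
        then \<tau> (10 + code4 j l) * \<tau> (30 + code4 j l)
        else (\<lambda>(a, b). \<tau> (code4 a b)) q * \<tau> (20 + code4 j l))"
      by (auto simp: fun_eq_iff row1_def col1_def)
    then show "at_point \<tau> F = 0"
      unfolding F_def f'_def at_point_segre
      using vanishes_on_rank_one_1[OF f split_restrict_eq_0D[OF assms(2)],
          of "\<lambda>(a, b). \<tau> (code4 a b)"] D
      by (simp add: D_def at_point_simps numeral_2_eq_2)
  next
    show "at_point (\<lambda>n. 1) D \<noteq> 0" by (simp add: D_def at_point_simps)
  qed
  have "eval_poly Const unshear f' \<in> (minors2_annihilator :: 'k adhm_poly set)"
  proof (rule segre_congruence[where r = row1 and c = col1])
    show "subst_poly (\<lambda>v. Var (row1 v) * Var (col1 v)) f' = 0" using \<open>F = 0\<close> by (simp add: F_def)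
  next
    fix x u w :: adhm_var
    assume r: "row1 u = row1 x" and c: "col1 w = col1 x"
    obtain j l a b where x: "x = (j, l, a, b)" by (rule prod_cases4)
    obtain j' l' a' b' where u: "u = (j', l', a', b')" by (rule prod_cases4)
    obtain j'' l'' a'' b'' where w: "w = (j'', l'', a'', b'')" by (rule prod_cases4)
    show "\<exists>x'. row1 x' = row1 w \<and> col1 x' = col1 u \<and>
      unshear u * unshear w - unshear x * unshear x' \<in> (minors2_annihilator :: 'k adhm_poly set)"
    proof (cases "(a, b) = (2, 2)")
      case True
      then have "u = x"
        using r code4_less[of a' b'] by (auto simp: x u row1_def split: if_splits)
      then show ?thesis
        using c by (intro exI[of _ w]) (simp add: minors2_annihilator_def adhm_ideal_zero)
    next
      case False
      then have eq: "a' = a" "b' = b" "j'' = j" "l'' = l" "(a'', b'') \<noteq> (2, 2)"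
        using r c code4_less[of a b] code4_less[of j l] code4_less[of j'' l'']
        by (auto simp: x u w row1_def col1_def split: if_splits)
      have "unshear u * unshear w - unshear x * unshear (j', l', a'', b'') =
          (coord_poly j' l' (a, b) * coord_poly j l (a'', b'') -
          coord_poly j' l' (a'', b'') * coord_poly j l (a, b) :: 'k adhm_poly)"
        by (simp add: unshear_def x u w eq mult.commute)
      then have "unshear u * unshear w - unshear x * unshear (j', l', a'', b'') \<in>
          (minors2_annihilator :: 'k adhm_poly set)"
        by (simp only: minors2_annihilator_def mem_Collect_eq)
          (intro allI impI minor_product[OF False eq(5)])
      then show ?thesis
        using False eq by (intro exI[of _ "(j', l', a'', b'')"]) (auto simp: row1_def col1_def u w)
    qed
  next
    show "x = y" if "row1 x = row1 y" "col1 x = col1 y" for x y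
      using that by (rule row1_col1_inj)
    show "row1 x \<noteq> col1 y" for x y by (rule row1_neq_col1)
  qed (auto simp: minors2_annihilator_def adhm_ideal_zero adhm_ideal_add distrib_right mult.assoc
      intro: ring_map_Const adhm_ideal_mult)
  then show ?thesis by (simp add: f'_def subst_unshear)
qed

lemma pencil_kernel_segre:
  fixes f :: "'k::{alg_closed_field, field_char_0} adhm_poly"
  assumes f: "f \<in> invariants" and "pencil_restrict f = 0"
  shows "subst_poly (\<lambda>v. Var (row2 v) * Var (col2 v)) (subst_poly (entry (shear Var)) f) = 0"
    (is "?F = 0")
proof -
  let ?w = "\<lambda>\<tau> j (a, b). \<tau> (20 + (4 * code2 j + code4 a b))"
  define D :: "'k npoly" where
    "D = Var 0 * Var 22 * Var 26 * pencil_resultant (?w Var)"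
  have D: "at_point \<tau> D = \<tau> 0 * \<tau> 22 * \<tau> 26 * pencil_resultant (?w \<tau>)" for \<tau>
    by (simp add: D_def pencil_resultant_def at_point_simps)
  show ?thesis
  proof (rule poly_eq_0_if_vanishes_generically)
    fix \<tau> :: "nat \<Rightarrow> 'k"
    assume nz: "at_point \<tau> D \<noteq> 0"
    have "(\<lambda>v. \<tau> (row2 v) * \<tau> (col2 v)) = (\<lambda>(j, l, q). if q = (2, 2)
        then \<tau> (10 + code4 j l) * \<tau> (40 + code4 j l) else \<tau> (code2 l) * ?w \<tau> j q)"
      by (auto simp: fun_eq_iff row2_def col2_def)
    then show "at_point \<tau> ?F = 0"
      unfolding at_point_segre
      using vanishes_on_rank_one_2[OF f pencil_restrict_eq_0D[OF assms(2)],
          of "\<lambda>l. \<tau> (code2 l)" "?w \<tau>"] nz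
      by (simp add: D)
  next
    \<comment> \<open>The lower left entries of both matrices and the upper right entry of the first one are one, and
      all other entries are zero.\<close>
    show "at_point (\<lambda>n. if n = 0 \<or> n = 21 \<or> n = 22 \<or> n = 26 then 1 else 0) D \<noteq> 0"
      by (simp add: D pencil_resultant_def)
  qed
qed

text \<open>As for \<open>split_kernel\<close>, now with the colon ideal of a single \<open>h\<close>, which contains the minors of the
  second kind by the choice of \<open>h\<close>.\<close>

lemma pencil_kernel:
  fixes f :: "'k::{alg_closed_field, field_char_0} adhm_poly"
  assumes f: "f \<in> invariants" "pencil_restrict f = 0" and h: "h \<in> minors2_annihilator"
  shows "f * h \<in> adhm_ideal"
proof -
  define f' where "f' = subst_poly (entry (shear Var)) f"
  let ?J = "{g. g * h \<in> adhm_ideal}"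
  have "eval_poly Const unshear f' \<in> ?J"
  proof (rule segre_congruence[where r = row2 and c = col2])
    show "subst_poly (\<lambda>v. Var (row2 v) * Var (col2 v)) f' = 0"
      using pencil_kernel_segre[OF f] by (simp add: f'_def)
  next
    fix x u w :: adhm_var
    assume r: "row2 u = row2 x" and c: "col2 w = col2 x"
    obtain j l a b where x: "x = (j, l, a, b)" by (rule prod_cases4)
    obtain j' l' a' b' where u: "u = (j', l', a', b')" by (rule prod_cases4)
    obtain j'' l'' a'' b'' where w: "w = (j'', l'', a'', b'')" by (rule prod_cases4)
    show "\<exists>x'. row2 x' = row2 w \<and> col2 x' = col2 u \<and>
      unshear u * unshear w - unshear x * unshear x' \<in> ?J"
    proof (cases "(a, b) = (2, 2)")
      case True
      then have "u = x"
        using r code2_less[of l'] by (auto simp: x u row2_def split: if_splits)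
      then show ?thesis
        using c by (intro exI[of _ w]) (simp add: adhm_ideal_zero)
    next
      case False
      then have eq: "l' = l" "j'' = j" "a'' = a" "b'' = b" "(a', b') \<noteq> (2, 2)"
        using r c code4_less[of a b] code2_less[of j] code2_less[of l]
        by (auto simp: x u w row2_def col2_def split: if_splits)
      have "unshear u * unshear w - unshear x * unshear (j', l'', a', b') =
          (coord_poly j' l (a', b') * coord_poly j l'' (a, b) -
          coord_poly j' l'' (a', b') * coord_poly j l (a, b) :: 'k adhm_poly)"
        by (simp add: unshear_def x u w eq mult.commute)
      then have "unshear u * unshear w - unshear x * unshear (j', l'', a', b') \<in> ?J"
        using h False eq(5) by (simp add: minors2_annihilator_def mult.commute[of _ h])
      then show ?thesis
        using False eq by (intro exI[of _ "(j', l'', a', b')"]) (auto simp: row2_def col2_def u w)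
    qed
  next
    show "x = y" if "row2 x = row2 y" "col2 x = col2 y" for x y
      using that by (rule row2_col2_inj)
    show "row2 x \<noteq> col2 y" for x y by (rule row2_neq_col2)
  qed (auto simp: adhm_ideal_zero adhm_ideal_add distrib_right mult.assoc
      intro: ring_map_Const adhm_ideal_mult)
  then show ?thesis by (simp add: f'_def subst_unshear)
qed

theorem kernel_product_in_ideal:
  fixes f g :: "'k::{alg_closed_field, field_char_0} adhm_poly"
  assumes "f \<in> invariants" "split_restrict f = 0" "g \<in> invariants" "pencil_restrict g = 0"
  shows "f * g \<in> adhm_ideal"
  using pencil_kernel[OF assms(3,4) split_kernel[OF assms(1,2)]] by (simp add: mult.commute)

text \<open>Vanishing at every point of the second family, including the special ones that are not conjugate
  to the normal form.\<close>

lemma pencil_kernel_rank_one: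
  fixes f :: "'k::{alg_closed_field, field_char_0} adhm_poly"
  assumes f: "f \<in> invariants" "pencil_restrict f = 0"
  shows "at_point (entry (shear (\<lambda>(j, l, q). if q = (2, 2) then y j l else p l * w j q))) f = 0"
proof -
  define \<tau> where "\<tau> n = (if n < 2 then p (decode2 n)
    else if n < 20 then decode4 y (n - 10)
    else if n < 40 then w (decode2 ((n - 20) div 4))
      (decode4 Pair ((n - 20) mod 4)) else 1)" for n
  have *: "(4 * code2 j + code4 a b) div 4 = code2 j" "(4 * code2 j + code4 a b) mod 4 = code4 a b"
    for j a b using code4_less[of a b] by simp_all
  have "(\<lambda>v. \<tau> (row2 v) * \<tau> (col2 v)) =
      (\<lambda>(j, l, q). if q = (2, 2) then y j l else p l * w j q)"
  proof
    fix v :: adhm_var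
    obtain j l a b where v: "v = (j, l, a, b)" by (rule prod_cases4)
    show "\<tau> (row2 v) * \<tau> (col2 v) =
        (case v of (j, l, q) \<Rightarrow> if q = (2, 2) then y j l else p l * w j q)"
      using code4_less[of a b] code4_less[of j l] code2_less[of j] code2_less[of l]
      by (auto simp: v row2_def col2_def \<tau>_def * simp del: mult_2)
  qed
  then show ?thesis
    using at_point_segre[of \<tau> row2 col2 f] pencil_kernel_segre[OF f] by (simp add: at_point_simps)
qed

section \<open>The intersection of the two families\<close>

lemma eval_trace_split:
  "ring_map h \<Longrightarrow> eval_poly h (entry (split_data t s)) (trace_poly j l) = 2 * t j l"
  by (simp add: eval_trace_poly trace_def sum_2 split_data_def)

lemma eval_gram_split:
  "ring_map h \<Longrightarrow> eval_poly h (entry (split_data t s)) (gram_poly j l j' l') = 4 * (s j l * s j' l')"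
  by (simp add: eval_gram_poly trace_def sum_2 matrix_matrix_mult_def split_data_def algebra_simps)

definition pencil_scale :: "2 \<Rightarrow> 'r \<Rightarrow> 'r::comm_ring_1" where
  "pencil_scale l p = (if l = 1 then 1 else p)"

lemma eval_trace_pencil:
  "ring_map h \<Longrightarrow> eval_poly h (entry (pencil_data t p a b c)) (trace_poly j l) =
     2 * t j l + pencil_scale l p * (if j = 1 then a else b)"
  by (simp add: eval_trace_poly trace_def sum_2 pencil_data_def Let_def pencil_scale_def)

lemma eval_gram_pencil:
  assumes "ring_map h"
  shows
    "eval_poly h (entry (pencil_data t p a b c)) (gram_poly 1 l 1 l') =
      pencil_scale l p * pencil_scale l' p * (a * a)"
    "eval_poly h (entry (pencil_data t p a b c)) (gram_poly 2 l 2 l') =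
      pencil_scale l p * pencil_scale l' p * (b * b)"
    "eval_poly h (entry (pencil_data t p a b c)) (gram_poly 1 l 2 l') =
      pencil_scale l p * pencil_scale l' p * (a * b + 2 * c)"
    "eval_poly h (entry (pencil_data t p a b c)) (gram_poly 2 l 1 l') =
      pencil_scale l p * pencil_scale l' p * (a * b + 2 * c)"
  by (simp_all add: eval_gram_poly[OF assms] trace_def sum_2 matrix_matrix_mult_def
      pencil_data_def Let_def algebra_simps flip: pencil_scale_def)

text \<open>Diagonal data whose eigenvalue differences form a \<open>2 \<times> 2\<close> matrix of rank one with first column
  \<open>(Var 5, Var 6)\<close>.\<close>

definition cross_restrict :: "'k::comm_ring_1 adhm_poly \<Rightarrow> 'k npoly" where
  "cross_restrict =
     subst_poly (entry (split_data (\<lambda>j l. Var (code4 j l))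
       (\<lambda>j l. pencil_scale l (Var 4) * Var (5 + code2 j))))"

lemma at_point_cross_restrict:
  "at_point \<tau> (cross_restrict f) =
     at_point (entry (split_data (\<lambda>j l. \<tau> (code4 j l))
       (\<lambda>j l. pencil_scale l (\<tau> 4) * \<tau> (5 + code2 j)))) f"
proof -
  have "at_point \<tau> (pencil_scale l p) = pencil_scale l (at_point \<tau> p)" for l p
    by (simp add: pencil_scale_def at_point_simps)
  then show ?thesis
    by (simp add: cross_restrict_def at_point_subst_entry map_split_data
      ring_map_eval_poly[OF ring_map_id] at_point_simps)
qed

lemma split_kernel_subset_cross_kernel:
  fixes f :: "'k::field_char_0 adhm_poly"
  assumes "split_restrict f = 0"
  shows "cross_restrict f = 0"
  by (rule poly_eq_0_if_vanishes) (simp add: at_point_cross_restrict split_restrict_eq_0D[OF assms])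

lemma pencil_kernel_subset_cross_kernel:
  fixes f :: "'k::{alg_closed_field, field_char_0} adhm_poly"
  assumes "f \<in> invariants" "pencil_restrict f = 0"
  shows "cross_restrict f = 0"
proof (rule poly_eq_0_if_vanishes)
  fix \<tau> :: "nat \<Rightarrow> 'k"
  define s where "s l = pencil_scale l (\<tau> 4)" for l
  define w where "w j q = (if q = (1, 1) then 2 * \<tau> (5 + code2 j) else 0)" for j :: 2 and q :: "2 \<times> 2"
  have "entry (split_data (\<lambda>j l. \<tau> (code4 j l)) (\<lambda>j l. s l * \<tau> (5 + code2 j))) =
      entry (shear (\<lambda>(j, l, q). if q = (2, 2) then \<tau> (code4 j l) - s l * \<tau> (5 + code2 j)
        else s l * w j q))"
  proof
    fix v :: adhm_var
    obtain j l a b where v: "v = (j, l, a, b)" by (rule prod_cases4)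
    show "entry (split_data (\<lambda>j l. \<tau> (code4 j l)) (\<lambda>j l. s l * \<tau> (5 + code2 j))) v =
        entry (shear (\<lambda>(j, l, q). if q = (2, 2) then \<tau> (code4 j l) - s l * \<tau> (5 + code2 j)
          else s l * w j q)) v"
      using exhaust_2[of a] exhaust_2[of b]
      by (auto simp: v split_data_def shear_def w_def algebra_simps)
  qed
  then show "at_point \<tau> (cross_restrict f) = 0"
    using pencil_kernel_rank_one[OF assms, of "\<lambda>j l. \<tau> (code4 j l) - s l * \<tau> (5 + code2 j)" s w]
    by (simp add: at_point_cross_restrict flip: s_def)
qed

text \<open>The determinant of the eigenvalue differences, up to a constant factor.\<close>

definition cross_det :: "'k::comm_ring_1 npoly" where
  "cross_det = Var 4 * Var 7 - Var 5 * Var 6"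

definition cross_invariant :: "'k::comm_ring_1 adhm_poly" where
  "cross_invariant = gram_poly 1 1 2 2 - gram_poly 1 2 2 1"

lemma cross_invariant_invariant: "cross_invariant \<in> invariants"
  by (simp add: cross_invariant_def invariants_diff gram_poly_invariant)

lemma split_restrict_cross_invariant: "split_restrict cross_invariant = 4 * cross_det"
  by (simp add: cross_invariant_def split_restrict_def subst_poly_simps
      eval_gram_split[OF ring_map_Const] cross_det_def right_diff_distrib)

lemma pencil_restrict_cross_invariant: "pencil_restrict cross_invariant = 0"
  by (simp add: cross_invariant_def pencil_restrict_def subst_poly_simps
      eval_gram_pencil[OF ring_map_Const] pencil_scale_def)

text \<open>The variables \<open>4, \<dots>, 7\<close> fill a \<open>2 \<times> 2\<close> grid and every other variable has a row and a column of its
  own. Rows are even and columns are odd.\<close>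

definition cross_row :: "nat \<Rightarrow> nat" where
  "cross_row n = 2 * (if n \<in> {4, 5} then 0 else if n \<in> {6, 7} then 1 else n + 2)"

definition cross_col :: "nat \<Rightarrow> nat" where
  "cross_col n = 1 + 2 * (if n \<in> {4, 6} then 0 else if n \<in> {5, 7} then 1 else n + 2)"

text \<open>A general matrix of rank one is rescaled so that its first column has coefficient one; this needs
  the first column coefficient, which is \<open>Var 1\<close>, to be nonzero.\<close>

lemma cross_kernel_segre:
  fixes f :: "'k::field_char_0 adhm_poly"
  assumes "cross_restrict f = 0"
  shows "subst_poly (\<lambda>n. Var (cross_row n) * Var (cross_col n)) (split_restrict f) = 0"
proof (rule poly_eq_0_if_vanishes_generically[where D = "Var 1"])
  fix \<tau> :: "nat \<Rightarrow> 'k"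
  assume nz: "at_point \<tau> (Var 1) \<noteq> 0"
  let ?s = "\<lambda>n. \<tau> (cross_row n) * \<tau> (cross_col n)"
  define \<tau>' where "\<tau>' n = (if n < 4 then ?s n else if n = 4 then \<tau> 3 / \<tau> 1
    else if n = 5 then \<tau> 0 * \<tau> 1 else \<tau> 2 * \<tau> 1)" for n
  have "?s (code4 j l) = \<tau>' (code4 j l)" for j l
    using code4_less[of j l] by (simp add: \<tau>'_def)
  moreover have "?s (4 + code4 j l) = pencil_scale l (\<tau>' 4) * \<tau>' (5 + code2 j)" for j l
    using nz exhaust_2[of j] exhaust_2[of l]
    by (auto simp: \<tau>'_def cross_row_def cross_col_def pencil_scale_def at_point_simps)
  ultimately show "at_point \<tau> (subst_poly (\<lambda>n. Var (cross_row n) * Var (cross_col n))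
      (split_restrict f)) = 0"
    using at_point_cross_restrict[of \<tau>' f] assms
    by (simp add: at_point_subst at_point_simps at_point_split_restrict)
next
  show "at_point (\<lambda>n. 1 :: 'k) (Var 1) \<noteq> 0" by (simp add: at_point_simps)
qed

lemma cross_row_grid: "n \<in> {4, 5, 6, 7} \<Longrightarrow> cross_row n < 4"
  by (auto simp: cross_row_def)

lemma cross_row_off_grid: "n \<notin> {4, 5, 6, 7} \<Longrightarrow> cross_row n = 2 * n + 4"
  by (simp add: cross_row_def)

lemma cross_col_grid: "n \<in> {4, 5, 6, 7} \<Longrightarrow> cross_col n < 4"
  by (auto simp: cross_col_def)

lemma cross_col_off_grid: "n \<notin> {4, 5, 6, 7} \<Longrightarrow> cross_col n = 2 * n + 5"
  by (simp add: cross_col_def)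

lemma cross_row_eq_cases:
  assumes "cross_row x = cross_row y"
  shows "x = y \<or> x \<in> {4, 5} \<and> y \<in> {4, 5} \<or> x \<in> {6, 7} \<and> y \<in> {6, 7}"
proof -
  consider "x \<in> {4, 5, 6, 7}" "y \<in> {4, 5, 6, 7}" | "x \<notin> {4, 5, 6, 7}" "y \<notin> {4, 5, 6, 7}"
    using assms cross_row_grid[of x] cross_row_grid[of y] cross_row_off_grid[of x]
      cross_row_off_grid[of y] by linarith
  then show ?thesis
  proof cases
    case 1
    then show ?thesis using assms by (elim insertE emptyE) (simp_all add: cross_row_def)
  next
    case 2
    then show ?thesis
      using assms cross_row_off_grid[of x] cross_row_off_grid[of y] by linarith
  qed
qed

lemma cross_col_eq_cases:
  assumes "cross_col x = cross_col y"
  shows "x = y \<or> x \<in> {4, 6} \<and> y \<in> {4, 6} \<or> x \<in> {5, 7} \<and> y \<in> {5, 7}"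
proof -
  consider "x \<in> {4, 5, 6, 7}" "y \<in> {4, 5, 6, 7}" | "x \<notin> {4, 5, 6, 7}" "y \<notin> {4, 5, 6, 7}"
    using assms cross_col_grid[of x] cross_col_grid[of y] cross_col_off_grid[of x]
      cross_col_off_grid[of y] by linarith
  then show ?thesis
  proof cases
    case 1
    then show ?thesis using assms by (elim insertE emptyE) (simp_all add: cross_col_def)
  next
    case 2
    then show ?thesis
      using assms cross_col_off_grid[of x] cross_col_off_grid[of y] by linarith
  qed
qed

lemma cross_kernel_divisible:
  fixes f :: "'k::field_char_0 adhm_poly"
  assumes "cross_restrict f = 0"
  obtains G where "split_restrict f = cross_det * G"
proof -
  let ?J = "{F. cross_det dvd F} :: ('k npoly) set"
  have "eval_poly Const Var (split_restrict f) \<in> ?J"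
  proof (rule segre_congruence[where r = cross_row and c = cross_col])
    show "subst_poly (\<lambda>n. Var (cross_row n) * Var (cross_col n)) (split_restrict f) = 0"
      by (rule cross_kernel_segre[OF assms])
  next
    fix x u w :: nat
    assume r: "cross_row u = cross_row x" and c: "cross_col w = cross_col x"
    show "\<exists>x'. cross_row x' = cross_row w \<and> cross_col x' = cross_col u \<and>
      Var u * Var w - Var x * Var x' \<in> ?J"
    proof (cases "u = x \<or> w = x")
      case True
      then show ?thesis
        using r c by (intro exI[of _ "if u = x then w else u"]) (auto simp: mult.commute)
    next
      case False
      then have u: "u \<in> {4, 5} \<and> x \<in> {4, 5} \<or> u \<in> {6, 7} \<and> x \<in> {6, 7}"
        and w: "w \<in> {4, 6} \<and> x \<in> {4, 6} \<or> w \<in> {5, 7} \<and> x \<in> {5, 7}"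
        using cross_row_eq_cases[OF r] cross_col_eq_cases[OF c] by blast+
      have minus: "cross_det dvd (Var 5 * Var 6 - Var 4 * Var 7 :: 'k npoly)"
        using dvd_minus_iff[of cross_det "cross_det :: 'k npoly"]
        by (simp add: cross_det_def)
      have plus: "cross_det dvd (Var 4 * Var 7 - Var 5 * Var 6 :: 'k npoly)"
        by (simp add: cross_det_def)
      have D: "Var u * Var w - Var x * Var x' \<in> ?J" if "{Var u * Var w, Var x * Var x'} =
        {Var 4 * Var 7, Var 5 * Var 6 :: 'k npoly}" for x'
        using that plus minus unfolding doubleton_eq_iff mem_Collect_eq by (elim disjE conjE) (simp_all only:)
      consider "x = 4" "u = 5" "w = 6" | "x = 5" "u = 4" "w = 7" | "x = 6" "u = 7" "w = 4"
        | "x = 7" "u = 6" "w = 5"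
        using u w False by (elim disjE conjE insertE emptyE) simp_all
      then show ?thesis
      proof cases
        case 1
        show ?thesis
          by (intro exI[of _ 7] conjI D) (simp_all add: 1 cross_row_def cross_col_def insert_commute)
      next
        case 2
        show ?thesis
          by (intro exI[of _ 6] conjI D)
            (simp_all add: 2 cross_row_def cross_col_def insert_commute)
      next
        case 3
        show ?thesis
          by (intro exI[of _ 5] conjI D)
            (simp_all add: 3 cross_row_def cross_col_def mult.commute[of "Var 7"] mult.commute[of "Var 6"])
      next
        case 4
        show ?thesis
          by (intro exI[of _ 4] conjI D)
            (simp_all add: 4 cross_row_def cross_col_def insert_commute mult.commute[of "Var 7"]
              mult.commute[of "Var 6"])
      qed
    qed
  next
    show "x = y" if "cross_row x = cross_row y" "cross_col x = cross_col y" for x y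
      using cross_row_eq_cases[OF that(1)] cross_col_eq_cases[OF that(2)] by auto
    show "cross_row x \<noteq> cross_col y" for x y
    proof -
      have "even (cross_row x)" "odd (cross_col y)" by (simp_all add: cross_row_def cross_col_def)
      then show ?thesis by metis
    qed
  qed (simp_all add: ring_map_Const)
  then have "cross_det dvd split_restrict f" by (simp add: subst_Var)
  then show thesis using that by (auto elim: dvdE)
qed

definition negate_gap :: "nat \<Rightarrow> 'k::comm_ring_1 npoly" where
  "negate_gap n = (if 4 \<le> n \<and> n < 8 then - Var n else Var n)"

text \<open>Interchanging the two basis vectors.\<close>

lemma split_restrict_even:
  fixes f :: "'k::field_char_0 adhm_poly"
  assumes f: "f \<in> invariants"
  shows "subst_poly negate_gap (split_restrict f) = split_restrict f"
proof (rule poly_eqI_at_points)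
  fix \<tau> :: "nat \<Rightarrow> 'k"
  have sym: "at_point (entry (split_data t s)) f = at_point (entry (split_data t (\<lambda>j l. - s j l))) f" for t s
    by (rule invariant_at_similar[OF f adhm_data_split, of "mat2 0 1 1 0"])
      (simp_all add: invertible_mat2 mat2_eq_iff matrix_matrix_mult_def sum_2 split_data_def)
  have "at_point \<tau> (negate_gap (code4 j l)) = \<tau> (code4 j l)"
    "at_point \<tau> (negate_gap (4 + code4 j l)) = - \<tau> (4 + code4 j l)" for j l
    using code4_less[of j l] by (simp_all add: negate_gap_def at_point_simps)
  then show "at_point \<tau> (subst_poly negate_gap (split_restrict f)) = at_point \<tau> (split_restrict f)"
    by (simp only: at_point_subst at_point_split_restrict sym[of _ "\<lambda>j l. \<tau> (4 + code4 j l)"])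
qed

text \<open>The quotient by \<open>cross_det\<close> is obtained as a polynomial in all variables; truncation brings it back
  to the first eight.\<close>

definition truncate8 :: "nat \<Rightarrow> 'k::comm_ring_1 npoly" where
  "truncate8 n = (if n < 8 then Var n else 0)"

lemma truncate_split_restrict:
  fixes f :: "'k::comm_ring_1 adhm_poly"
  shows "subst_poly truncate8 (split_restrict f) = split_restrict f"
proof -
  have "subst_poly truncate8 (entry (split_data (\<lambda>j l. Var (code4 j l)) (\<lambda>j l. Var (4 + code4 j l))) v) =
      (entry (split_data (\<lambda>j l. Var (code4 j l)) (\<lambda>j l. Var (4 + code4 j l))) v ::
        'k npoly)" for v
  proof -
    obtain j l a b where v: "v = (j, l, a, b)" by (rule prod_cases4)
    show ?thesis
      using code4_less[of j l]
      by (simp add: v split_data_def subst_poly_simps truncate8_def)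
  qed
  then show ?thesis by (simp only: split_restrict_def subst_subst)
qed

abbreviation split_image :: "('k::comm_ring_1 npoly) set" where
  "split_image \<equiv> split_restrict ` invariants"

lemma ring_map_split_restrict: "ring_map split_restrict"
  unfolding split_restrict_def by (rule ring_map_eval_poly[OF ring_map_Const])

lemma split_restrict_Const: "split_restrict (Const c) = Const c"
  by (simp add: split_restrict_def subst_poly_simps)

lemma split_image_mult: "x \<in> split_image \<Longrightarrow> y \<in> split_image \<Longrightarrow> x * y \<in> split_image"
  by (auto simp: image_iff simp flip: ring_map.mult[OF ring_map_split_restrict] intro: invariants_mult)

lemma split_image_add: "x \<in> split_image \<Longrightarrow> y \<in> split_image \<Longrightarrow> x + y \<in> split_image"
  by (auto simp: image_iff simp flip: ring_map.add[OF ring_map_split_restrict] intro: invariants_add)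

lemma split_image_Const: "Const c \<in> split_image"
  using invariants_Const[of c] split_restrict_Const[of c] by (metis imageI)

lemma split_image_0: "0 \<in> split_image" and split_image_1: "1 \<in> split_image"
  using split_image_Const[of 0] split_image_Const[of 1] by (simp_all add: Const_hom)

text \<open>A product of two eigenvalue differences is a multiple of the restriction of a \<open>gram_poly\<close>. The
  induction also needs odd monomials, which become even with one more difference. Variables beyond the
  eighth are sent to zero.\<close>

lemma even_monom_lifts:
  fixes M :: "nat multiset"
  defines "odd_part \<equiv> size (filter_mset (\<lambda>n. 4 \<le> n \<and> n < 8) M)"
  shows "(even odd_part \<longrightarrow> prod_mset (image_mset truncate8 M) \<in>
      (split_image :: ('k::field_char_0 npoly) set)) \<and>
    (odd odd_part \<longrightarrow> (\<forall>n. 4 \<le> n \<and> n < 8 \<longrightarrow> Var n * prod_mset (image_mset truncate8 M) \<in>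
      (split_image :: ('k npoly) set)))"
  unfolding odd_part_def
proof (induction M)
  let ?E = "split_image :: ('k npoly) set"
  note mult = split_image_mult
  have const: "Const c * x \<in> ?E" if "x \<in> ?E" for c x
    by (rule mult[OF split_image_Const that])
  have half: "Const (inverse 2) * (2 * x) = x" "Const (inverse 4) * (4 * x) = x"
    for x :: "'k npoly"
  proof -
    have "Const (inverse (2::'k)) * 2 = (1 :: 'k npoly)"
      "Const (inverse (4::'k)) * 4 = (1 :: 'k npoly)"
      by (simp_all add: Const_hom(10)[symmetric] Const_hom(4)[symmetric] Const_hom(2) del: Const_hom(10))
    then show "Const (inverse 2) * (2 * x) = x" "Const (inverse 4) * (4 * x) = x"
      by (simp_all flip: mult.assoc)
  qed
  have code: "code4 (decode2 (n div 2)) (decode2 (n mod 2)) = n" if "n < 4" for n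
  proof -
    from that consider "n = 0" | "n = 1" | "n = 2" | "n = 3" by linarith
    then show ?thesis by cases (simp_all add: decode2_def)
  qed
  have t: "Var n \<in> ?E" if "n < 4" for n
  proof -
    have "n = code4 (decode2 (n div 2)) (decode2 (n mod 2))"
      using code[OF that] by simp
    then have "split_restrict (trace_poly (decode2 (n div 2)) (decode2 (n mod 2))) = 2 * Var n"
      by (metis split_restrict_def eval_trace_split[OF ring_map_Const])
    then show ?thesis
      using const[of "2 * Var n" "inverse 2"] trace_poly_invariant half(1)[of "Var n"]
      by (metis imageI)
  qed
  have s: "Var n * Var m \<in> ?E" if "4 \<le> n" "n < 8" "4 \<le> m" "m < 8" for n m
  proof -
    have n: "n = 4 + code4 (decode2 ((n - 4) div 2)) (decode2 ((n - 4) mod 2))"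
      and m: "m = 4 + code4 (decode2 ((m - 4) div 2)) (decode2 ((m - 4) mod 2))"
      using that code[of "n - 4"] code[of "m - 4"] by simp_all
    have "split_restrict (gram_poly (decode2 ((n - 4) div 2)) (decode2 ((n - 4) mod 2))
        (decode2 ((m - 4) div 2)) (decode2 ((m - 4) mod 2))) = 4 * (Var n * Var m)"
      by (subst n, subst m) (simp only: split_restrict_def eval_gram_split[OF ring_map_Const])
    then show ?thesis
      using const[of "4 * (Var n * Var m)" "inverse 4"] gram_poly_invariant half(2)[of "Var n * Var m"]
      by (metis imageI)
  qed
  {
    case empty
    show ?case using split_image_1 by simp
  next
    case (add n M)
    let ?P = "prod_mset (image_mset truncate8 M) :: 'k npoly"
    consider "n < 4" | "4 \<le> n" "n < 8" | "8 \<le> n" by linarith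
    then show ?case
    proof cases
      case 1
      have eq: "Var m * (Var n * ?P) = Var n * (Var m * ?P)" for m
        by (simp only: mult.left_commute)
      have gap: "filter_mset (\<lambda>n. 4 \<le> n \<and> n < 8) (add_mset n M) = filter_mset (\<lambda>n. 4 \<le> n \<and> n < 8) M"
        and prod: "prod_mset (image_mset truncate8 (add_mset n M)) = Var n * ?P"
        using 1 by (simp_all add: truncate8_def)
      show ?thesis
        unfolding gap prod eq using add.IH mult[OF t[OF 1]] by blast
    next
      case 2
      have eq: "Var m * (Var n * ?P) = (Var m * Var n) * ?P" for m
        by (simp only: mult.assoc)
      have gap: "size (filter_mset (\<lambda>n. 4 \<le> n \<and> n < 8) (add_mset n M)) =
          Suc (size (filter_mset (\<lambda>n. 4 \<le> n \<and> n < 8) M))"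
        and prod: "prod_mset (image_mset truncate8 (add_mset n M)) = Var n * ?P"
        using 2 by (simp_all add: truncate8_def)
      have "Var n * ?P \<in> ?E" if "odd (size (filter_mset (\<lambda>n. 4 \<le> n \<and> n < 8) M))"
        using that add.IH 2 by blast
      moreover have "(Var m * Var n) * ?P \<in> ?E"
        if "even (size (filter_mset (\<lambda>n. 4 \<le> n \<and> n < 8) M))" "4 \<le> m" "m < 8" for m
        by (rule mult[OF s]) (use that 2 add.IH in blast)+
      ultimately show ?thesis
        unfolding gap prod eq even_Suc by blast
    next
      case 3
      then show ?thesis by (simp add: truncate8_def split_image_0)
    qed
  }
qed

text \<open>Adding to a monomial its image under the sign change doubles it if it is even and cancels it if it
  is odd.\<close>

lemma even_poly_lifts:
  fixes G :: "'k::field_char_0 npoly"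
  assumes "subst_poly negate_gap G = G"
  shows "\<exists>g\<in>invariants. split_restrict g = 2 * subst_poly truncate8 G"
proof -
  let ?E = "split_image :: ('k npoly) set"
  have sum: "(\<Sum>m\<in>A. p m) \<in> ?E" if "\<And>m. p m \<in> ?E" for p and A :: "(nat \<Rightarrow>\<^sub>0 nat) set"
    using that by (induction A rule: infinite_finite_induct) (auto intro: split_image_0 split_image_add)
  have monom: "monom_eval truncate8 m + subst_poly truncate8 (monom_eval negate_gap m) \<in> ?E"
    for m :: "nat \<Rightarrow>\<^sub>0 nat"
  proof -
    define M where "M = monom_mset m"
    define k where "k = size (filter_mset (\<lambda>n. 4 \<le> n \<and> n < 8) M)"
    let ?P = "prod_mset (image_mset truncate8 M) :: 'k npoly"
    have "subst_poly truncate8 (negate_gap n) =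
        (if 4 \<le> n \<and> n < 8 then - truncate8 n else (truncate8 n :: 'k npoly))" for n
      by (simp add: negate_gap_def subst_poly_simps)
    then have "subst_poly truncate8 (prod_mset (image_mset negate_gap N)) =
        (- 1) ^ size (filter_mset (\<lambda>n. 4 \<le> n \<and> n < 8) N) *
        (prod_mset (image_mset truncate8 N) :: 'k npoly)" for N
      by (induction N) (simp_all add: subst_poly_simps)
    then have "subst_poly truncate8 (monom_eval negate_gap m) = (- 1) ^ k * ?P"
      by (simp only: prod_monom_mset[symmetric] M_def k_def)
    moreover have "monom_eval truncate8 m = ?P" by (simp only: prod_monom_mset M_def)
    ultimately show ?thesis
      using even_monom_lifts[of M, folded k_def] split_image_0 split_image_add[of ?P ?P] by (cases "even k") simp_all
  qed
  have "subst_poly truncate8 G + subst_poly truncate8 (subst_poly negate_gap G) =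
      (\<Sum>m\<in>Poly_Mapping.keys G. Const (Poly_Mapping.lookup G m) *
        (monom_eval truncate8 m + subst_poly truncate8 (monom_eval negate_gap m)))"
    unfolding eval_poly_def[of _ _ G]
    by (simp add: subst_poly_simps sum.distrib distrib_left)
  also have "\<dots> \<in> ?E" by (intro sum split_image_mult split_image_Const monom)
  finally have "2 * subst_poly truncate8 G \<in> ?E" unfolding assms mult_2 .
  then obtain g where "g \<in> invariants" "split_restrict g = 2 * subst_poly truncate8 G"
    by (metis imageE)
  then show ?thesis by blast
qed

text \<open>The kernel of the restriction to the intersection is the sum of the kernels of the restrictions to
  the two components: \<open>cross_invariant * g\<close> vanishes on the pencils.\<close>

theorem cross_kernel_decomposition:
  fixes f :: "'k::field_char_0 adhm_poly"
  assumes f: "f \<in> invariants" "cross_restrict f = 0"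
  shows "\<exists>g\<in>invariants. split_restrict (f - cross_invariant * g) = 0"
proof -
  interpret S: ring_map "split_restrict :: 'k adhm_poly \<Rightarrow> _"
    by (rule ring_map_split_restrict)
  obtain G where G: "split_restrict f = cross_det * G" by (rule cross_kernel_divisible[OF f(2)])
  have det: "subst_poly negate_gap cross_det = (cross_det :: 'k npoly)"
    "subst_poly truncate8 cross_det = (cross_det :: 'k npoly)"
    by (simp_all add: cross_det_def subst_poly_simps negate_gap_def truncate8_def)
  have "at_point (\<lambda>n. if n = 4 \<or> n = 7 then 1 else 0 :: 'k) cross_det \<noteq> 0"
    by (simp add: cross_det_def at_point_simps)
  then have nz: "cross_det \<noteq> (0 :: 'k npoly)" by (auto simp: at_point_simps)
  have "cross_det * subst_poly negate_gap G = cross_det * G"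
    using split_restrict_even[OF f(1)] by (simp add: G subst_poly_simps det)
  then have "subst_poly negate_gap G = G" using nz by simp
  then obtain g where g: "g \<in> invariants" "split_restrict g = 2 * subst_poly truncate8 G"
    using even_poly_lifts by blast
  have trunc: "split_restrict f = cross_det * subst_poly truncate8 G"
    using truncate_split_restrict[of f] unfolding G subst_poly_simps det by (rule sym)
  \<comment> \<open>The restriction of \<open>cross_invariant\<close> contributes a factor four, the lift of \<open>G\<close> a factor two.\<close>
  have "Const (inverse (8::'k)) * 8 = (1 :: 'k npoly)"
    by (simp add: ring_map.one[OF ring_map_Const] flip: ring_map.numeral[OF ring_map_Const]
      ring_map.mult[OF ring_map_Const])
  then have eight: "Const (inverse 8) * (8 * x) = x" for x :: "'k npoly"
    by (simp flip: mult.assoc)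
  have "split_restrict (Const (inverse 8) * g) = Const (inverse 8) * split_restrict g"
    by (simp only: S.mult split_restrict_Const)
  then have "split_restrict (cross_invariant * (Const (inverse 8) * g)) =
      Const (inverse 8) * (8 * (cross_det * subst_poly truncate8 G))"
    by (simp only: S.mult split_restrict_cross_invariant g(2)) (simp add: algebra_simps)
  then have "split_restrict (f - cross_invariant * (Const (inverse 8) * g)) = 0"
    by (simp only: S.diff trunc eight diff_self)
  then show ?thesis using invariants_mult[OF invariants_Const g(1)] by blast
qed

section \<open>Chains of primes and algebraic independence\<close>

definition prime_of :: "'a::comm_ring_1 set \<Rightarrow> 'a set \<Rightarrow> bool" where
  "prime_of R Q \<longleftrightarrow> Q \<subseteq> R \<and> 1 \<notin> Q \<and> (\<forall>x\<in>Q. \<forall>y\<in>Q. x + y \<in> Q) \<and> (\<forall>r\<in>R. \<forall>x\<in>Q. r * x \<in> Q) \<and>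
     (\<forall>x\<in>R. \<forall>y\<in>R. x * y \<in> Q \<longrightarrow> x \<in> Q \<or> y \<in> Q)"

lemma prime_ofD:
  assumes "prime_of R Q"
  shows "x \<in> Q \<Longrightarrow> y \<in> Q \<Longrightarrow> x + y \<in> Q" "r \<in> R \<Longrightarrow> x \<in> Q \<Longrightarrow> r * x \<in> Q"
    "a \<in> R \<Longrightarrow> b \<in> R \<Longrightarrow> a * b \<in> Q \<Longrightarrow> a \<in> Q \<or> b \<in> Q" "1 \<notin> Q" "Q \<subseteq> R"
  using assms by (auto simp: prime_of_def)

fun power_product :: "'a::comm_monoid_mult list \<Rightarrow> nat list \<Rightarrow> 'a" where
  "power_product (y # ys) (e # es) = y ^ e * power_product ys es"
| "power_product _ _ = 1"

lemma (in ring_map) power_product: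
  "F (power_product ys es) = power_product (map F ys) es"
  by (induction ys es rule: power_product.induct) (simp_all add: hom)

locale const_subring =
  fixes R :: "(('v \<Rightarrow>\<^sub>0 nat) \<Rightarrow>\<^sub>0 'k::field) set"
  assumes add_closed: "x \<in> R \<Longrightarrow> y \<in> R \<Longrightarrow> x + y \<in> R"
    and mult_closed: "x \<in> R \<Longrightarrow> y \<in> R \<Longrightarrow> x * y \<in> R"
    and Const_closed: "Const c \<in> R"
begin

lemma one_closed: "1 \<in> R"
  using Const_closed[of 1] by (simp add: Const_hom)

lemma zero_closed: "0 \<in> R"
  using Const_closed[of 0] by (simp add: Const_hom)

lemma power_closed: "x \<in> R \<Longrightarrow> x ^ n \<in> R"
  by (induction n) (auto intro: one_closed mult_closed)

lemma sum_closed: "(\<And>i. i \<in> A \<Longrightarrow> f i \<in> R) \<Longrightarrow> sum f A \<in> R"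
  by (induction A rule: infinite_finite_induct) (auto intro: zero_closed add_closed)

lemma power_product_closed: "set ys \<subseteq> R \<Longrightarrow> power_product ys es \<in> R"
  by (induction ys es rule: power_product.induct)
    (auto intro: one_closed mult_closed power_closed)

lemma prime_power: "prime_of R Q \<Longrightarrow> y \<in> R \<Longrightarrow> y \<notin> Q \<Longrightarrow> y ^ m \<notin> Q"
proof (induction m)
  case 0
  then show ?case by (simp add: prime_of_def)
next
  case (Suc m)
  then have "y ^ m \<notin> Q" by blast
  with Suc.prems power_closed[of y m] show ?case
    unfolding prime_of_def power_Suc by blast
qed

lemma prime_diff:
  assumes Q: "prime_of R Q" and x: "x + y \<in> Q" and y: "y \<in> Q"
  shows "x \<in> Q"
proof -
  have "Const (- 1) * y \<in> Q" using Q y Const_closed by (auto simp: prime_of_def)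
  with Q x have "x + y + Const (- 1) * y \<in> Q" unfolding prime_of_def by blast
  then show ?thesis by (simp add: Const_hom)
qed

text \<open>Elements that witness the strictness of a chain of primes are algebraically independent
  modulo the smallest prime: divide a relation by the largest power of the first element that
  occurs in all its terms, and reduce modulo the next prime.\<close>

lemma chain_independent:
  assumes "\<And>i. i \<le> length ys \<Longrightarrow> prime_of R (Q i)"
    and "\<And>i. i < length ys \<Longrightarrow> Q i \<subseteq> Q (Suc i)"
    and "\<And>i. i < length ys \<Longrightarrow> ys ! i \<in> Q (Suc i) - Q i"
    and "finite E" "E \<noteq> {}" "\<And>es. es \<in> E \<Longrightarrow> length es = length ys" "\<And>es. es \<in> E \<Longrightarrow> c es \<noteq> 0"
  shows "(\<Sum>es\<in>E. Const (c es) * power_product ys es) \<notin> Q 0"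
  using assms
proof (induction ys arbitrary: Q E c)
  case Nil
  then have E: "E = {[]}" by auto
  then have c: "c [] \<noteq> 0" using Nil.prems(7) by blast
  have Q: "prime_of R (Q 0)" using Nil.prems(1) by simp
  show ?case
  proof
    assume "(\<Sum>es\<in>E. Const (c es) * power_product [] es) \<in> Q 0"
    then have "Const (inverse (c [])) * Const (c []) \<in> Q 0"
      using Q Const_closed unfolding E prime_of_def by simp
    with c Q show False by (simp add: prime_of_def Const_hom flip: Const_hom(4))
  qed
next
  case (Cons y ys)
  have Q: "prime_of R (Q i)" if "i \<le> Suc (length ys)" for i using Cons.prems(1) that by simp
  have "y \<in> Q 1" "y \<notin> Q 0" using Cons.prems(3)[of 0] by auto
  have ysR: "set ys \<subseteq> R"
  proof
    fix x assume "x \<in> set ys"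
    then obtain i where "i < length ys" "x = ys ! i" by (auto simp: in_set_conv_nth)
    then have "x \<in> Q (Suc (Suc i))" using Cons.prems(3)[of "Suc i"] by auto
    with Q[of "Suc (Suc i)"] \<open>i < length ys\<close> show "x \<in> R" by (auto simp: prime_of_def)
  qed
  have yR: "y \<in> R" using \<open>y \<in> Q 1\<close> Q[of 1] by (auto simp: prime_of_def)
  have form: "es = hd es # tl es" "length (tl es) = length ys" if "es \<in> E" for es
    using Cons.prems(6)[OF that] by (cases es; simp)+
  define m where "m = Min (hd ` E)"
  have m: "m \<le> hd es" if "es \<in> E" for es using that Cons.prems(4) by (simp add: m_def)
  have "m \<in> hd ` E" unfolding m_def using Cons.prems(4,5) by (intro Min_in) auto
  define E0 where "E0 = {es \<in> E. hd es = m}"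
  define E1 where "E1 = {es \<in> E. hd es \<noteq> m}"
  have fin: "finite E0" "finite E1" and E: "E = E0 \<union> E1" "E0 \<inter> E1 = {}"
    using Cons.prems(4) by (auto simp: E0_def E1_def)
  let ?t = "\<lambda>es. Const (c es) * power_product ys (tl es)"
  let ?S0 = "\<Sum>es\<in>E0. ?t es" and ?S1 = "\<Sum>es\<in>E1. y ^ (hd es - Suc m) * ?t es"
  have pp: "power_product (y # ys) es = y ^ hd es * power_product ys (tl es)" if "es \<in> E" for es
    using form(1)[OF that] power_product.simps(1)[of y ys "hd es" "tl es"] by simp
  have "(\<Sum>es\<in>E0. Const (c es) * power_product (y # ys) es) = y ^ m * ?S0"
    unfolding sum_distrib_left by (rule sum.cong) (simp_all add: E0_def pp mult.left_commute)
  moreover have "(\<Sum>es\<in>E1. Const (c es) * power_product (y # ys) es) = y ^ m * (y * ?S1)"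
    unfolding sum_distrib_left
  proof (rule sum.cong)
    fix es assume "es \<in> E1"
    then have es: "es \<in> E" "hd es = m + Suc (hd es - Suc m)"
      using m[of es] by (auto simp: E1_def)
    have "y ^ hd es = y ^ m * (y * y ^ (hd es - Suc m))"
      by (subst es(2)) (simp only: power_add power_Suc)
    then show "Const (c es) * power_product (y # ys) es = y ^ m * (y * (y ^ (hd es - Suc m) * ?t es))"
      by (simp only: pp[OF es(1)] mult.assoc mult.left_commute)
  qed simp
  ultimately have total: "(\<Sum>es\<in>E. Const (c es) * power_product (y # ys) es) = y ^ m * (?S0 + y * ?S1)"
    unfolding E(1) by (subst sum.union_disjoint[OF fin E(2)]) (simp only: distrib_left)
  have S1: "?S1 \<in> R" and S0: "?S0 \<in> R"
    by (auto intro!: sum_closed mult_closed Const_closed power_closed power_product_closed yR ysR)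
  have "?S0 \<notin> Q 1"
  proof -
    have inj: "inj_on tl E0"
      by (rule inj_onI) (metis (mono_tags, lifting) E0_def form(1) mem_Collect_eq)
    have "?S0 = (\<Sum>es\<in>E0. Const (c (m # tl es)) * power_product ys (tl es))"
    proof (rule sum.cong)
      fix es assume "es \<in> E0"
      then have "es = m # tl es" using form(1)[of es] by (simp add: E0_def)
      then show "?t es = Const (c (m # tl es)) * power_product ys (tl es)" by simp
    qed simp
    also have "\<dots> = (\<Sum>es\<in>tl ` E0. Const (c (m # es)) * power_product ys es)"
      by (simp add: sum.reindex[OF inj])
    also have "\<dots> \<notin> Q (Suc 0)"
    proof (rule Cons.IH[of "\<lambda>i. Q (Suc i)"])
      show "prime_of R (Q (Suc i))" if "i \<le> length ys" for i using Q that by simp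
      show "Q (Suc i) \<subseteq> Q (Suc (Suc i))" if "i < length ys" for i
        using Cons.prems(2)[of "Suc i"] that by simp
      show "ys ! i \<in> Q (Suc (Suc i)) - Q (Suc i)" if "i < length ys" for i
        using Cons.prems(3)[of "Suc i"] that by simp
      show "finite (tl ` E0)" using fin by simp
      show "tl ` E0 \<noteq> {}" using \<open>m \<in> hd ` E\<close> by (auto simp: E0_def)
      show "length es = length ys" if "es \<in> tl ` E0" for es
        using that form(2) by (auto simp: E0_def)
      show "c (m # es) \<noteq> 0" if es: "es \<in> tl ` E0" for es
      proof -
        obtain es' where es': "es' \<in> E" "hd es' = m" "es = tl es'"
          using es unfolding E0_def by blast
        then have "m # es = es'" using form(1)[of es'] by simp
        then show ?thesis using Cons.prems(7)[OF es'(1)] by simp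
      qed
    qed
    finally show ?thesis by simp
  qed
  moreover have "?S0 \<in> Q 1" if "y ^ m * (?S0 + y * ?S1) \<in> Q 0"
  proof -
    have "?S0 + y * ?S1 \<in> R" using S0 S1 yR add_closed mult_closed by blast
    then have "?S0 + y * ?S1 \<in> Q 0"
      using that Q[of 0] prime_power[OF Q[of 0] yR \<open>y \<notin> Q 0\<close>, of m] power_closed[OF yR, of m]
      unfolding prime_of_def by blast
    then have *: "?S0 + y * ?S1 \<in> Q 1" using Cons.prems(2)[of 0] by auto
    have "?S1 * y \<in> Q 1" using Q[of 1] S1 \<open>y \<in> Q 1\<close> by (simp add: prime_of_def)
    then have "y * ?S1 \<in> Q 1" by (simp only: mult.commute)
    then show ?thesis using prime_diff[OF Q[of 1] *] by simp
  qed
  ultimately show ?case unfolding total by blast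
qed

end

section \<open>Counting monomials\<close>

definition degrees_le :: "nat \<Rightarrow> nat \<Rightarrow> ('k::comm_ring_1 npoly) set" where
  "degrees_le d M = {F. \<forall>m\<in>Poly_Mapping.keys F. \<forall>v.
     Poly_Mapping.lookup m v \<le> (if v < d then M else 0)}"

lemma degrees_le_mult:
  assumes "F \<in> degrees_le d M" "G \<in> degrees_le d N"
  shows "F * G \<in> degrees_le d (M + N)"
proof -
  have "Poly_Mapping.lookup p v \<le> (if v < d then M + N else 0)"
    if p: "p \<in> Poly_Mapping.keys (F * G)" for p v
  proof -
    obtain a b where ab: "a \<in> Poly_Mapping.keys F" "b \<in> Poly_Mapping.keys G" "p = a + b"
      using p keys_mult[of F G] by blast
    have "Poly_Mapping.lookup a v \<le> (if v < d then M else 0)"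
      "Poly_Mapping.lookup b v \<le> (if v < d then N else 0)"
      using assms ab unfolding degrees_le_def by blast+
    then show ?thesis by (simp add: ab lookup_add split: if_splits)
  qed
  then show ?thesis by (simp add: degrees_le_def)
qed

lemma degrees_le_1: "1 \<in> degrees_le d 0"
  by (simp add: degrees_le_def flip: single_one)

lemma degrees_le_mono:
  assumes "M \<le> N"
  shows "degrees_le d M \<subseteq> degrees_le d N"
proof -
  have "(if v < d then M else 0) \<le> (if v < d then N else 0)" for v using assms by simp
  then show ?thesis unfolding degrees_le_def by (blast intro: le_trans)
qed

lemma degrees_le_power: "F \<in> degrees_le d M \<Longrightarrow> F ^ n \<in> degrees_le d (n * M)"
  by (induction n) (simp_all add: degrees_le_1 degrees_le_mult)

lemma degrees_le_power_product:
  assumes "set Ys \<subseteq> degrees_le d B" "length es = length Ys" "\<forall>e\<in>set es. e \<le> N"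
  shows "power_product Ys es \<in> degrees_le d (length Ys * (N * B))"
  using assms
proof (induction Ys es rule: power_product.induct)
  case (1 y ys e es)
  then have "y ^ e \<in> degrees_le d (N * B)"
    using degrees_le_power[of y d B e] degrees_le_mono[of "e * B" "N * B" d] by auto
  then show ?case using 1 by (auto intro: degrees_le_mult)
qed (simp_all add: degrees_le_1)

definition monoms_box :: "nat \<Rightarrow> nat \<Rightarrow> (nat \<Rightarrow>\<^sub>0 nat) set" where
  "monoms_box d M = {m. \<forall>v. Poly_Mapping.lookup m v \<le> (if v < d then M else 0)}"

lemma monoms_box: "finite (monoms_box d M)" "card (monoms_box d M) \<le> Suc M ^ d"
proof -
  let ?r = "\<lambda>m. restrict (Poly_Mapping.lookup m) {..<d}"
  have inj: "inj_on ?r (monoms_box d M)"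
  proof (rule inj_onI)
    fix m n assume mn: "m \<in> monoms_box d M" "n \<in> monoms_box d M" "?r m = ?r n"
    show "m = n"
    proof (rule poly_mapping_eqI)
      fix v
      show "Poly_Mapping.lookup m v = Poly_Mapping.lookup n v"
      proof (cases "v < d")
        case True
        then show ?thesis using fun_cong[OF mn(3), of v] by simp
      next
        case False
        then have "Poly_Mapping.lookup m v \<le> 0" "Poly_Mapping.lookup n v \<le> 0"
          using mn(1,2)[unfolded monoms_box_def mem_Collect_eq, THEN spec, of v] by simp_all
        then show ?thesis by simp
      qed
    qed
  qed
  have sub: "?r ` monoms_box d M \<subseteq> ({..<d} \<rightarrow>\<^sub>E {..M})"
  proof (rule image_subsetI, rule PiE_I)
    show "?r m v \<in> {..M}" if "m \<in> monoms_box d M" "v \<in> {..<d}" for m v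
      using that(1)[unfolded monoms_box_def mem_Collect_eq, THEN spec, of v] that(2) by simp
  qed simp
  have fin: "finite ({..<d} \<rightarrow>\<^sub>E {..M})" by (intro finite_PiE) auto
  show "finite (monoms_box d M)"
    using finite_subset[OF sub fin] inj by (rule finite_imageD)
  have "card (monoms_box d M) = card (?r ` monoms_box d M)" using inj by (simp add: card_image)
  also have "\<dots> \<le> card ({..<d} \<rightarrow>\<^sub>E {..M})" by (rule card_mono[OF fin sub])
  also have "\<dots> = Suc M ^ d" by (simp add: card_PiE)
  finally show "card (monoms_box d M) \<le> Suc M ^ d" .
qed

interpretation poly_vs: vector_space "\<lambda>(c::'k::field) (F::('v \<Rightarrow>\<^sub>0 nat) \<Rightarrow>\<^sub>0 'k). Const c * F"
  by unfold_locales (simp_all add: Const_hom algebra_simps)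

lemma degrees_le_span:
  fixes F :: "'k::field npoly"
  assumes "F \<in> degrees_le d M"
  shows "F \<in> poly_vs.span (monom_eval Var ` monoms_box d M)"
proof -
  have "F = (\<Sum>m\<in>Poly_Mapping.keys F. Const (Poly_Mapping.lookup F m) * monom_eval Var m)"
    using poly_sum_monoms[of F] by (simp only: eval_poly_def)
  also have "\<dots> \<in> poly_vs.span (monom_eval Var ` monoms_box d M)"
    using assms
    by (intro poly_vs.span_sum poly_vs.span_scale poly_vs.span_base)
      (auto simp: degrees_le_def monoms_box_def)
  finally show ?thesis .
qed

text \<open>There are \<open>N\<^sup>n\<close> products of \<open>n\<close> polynomials with exponents below \<open>N\<close>, and they lie in a space whose
  dimension is of order \<open>N\<^sup>d\<close>.\<close>

lemma algebraically_dependent: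
  fixes Ys :: "('k::field npoly) list"
  assumes Ys: "set Ys \<subseteq> degrees_le d B" and len: "d < length Ys"
  obtains E c where "finite E" "E \<noteq> {}" "\<And>es. es \<in> E \<Longrightarrow> length es = length Ys"
    "\<And>es. es \<in> E \<Longrightarrow> c es \<noteq> 0" "(\<Sum>es\<in>E. Const (c es) * power_product Ys es) = 0"
proof -
  \<comment> \<open>With these choices \<open>Suc M \<le> C * N\<close>, so \<open>Suc M ^ d \<le> C ^ d * N ^ d < N * N ^ d\<close>.\<close>
  define C where "C = Suc (length Ys * B)"
  define N where "N = Suc (C ^ d)"
  define M where "M = length Ys * (N * B)"
  define L where "L = {es. set es \<subseteq> {..<N} \<and> length es = length Ys}"
  have L: "finite L" "card L = N ^ length Ys"
    unfolding L_def by (simp_all add: finite_lists_length_eq card_lists_length_eq)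
  have "1 \<le> N" by (simp add: N_def)
  then have "Suc M \<le> C * N" unfolding M_def C_def by (simp add: algebra_simps)
  then have "Suc M ^ d \<le> C ^ d * N ^ d" by (metis power_mono power_mult_distrib zero_le)
  also have "\<dots> < N * N ^ d" by (simp add: N_def)
  also have "\<dots> \<le> N ^ length Ys"
    using power_increasing[of "Suc d" "length Ys" N] len by (simp add: N_def)
  finally have big: "Suc M ^ d < card L" by (simp add: L)
  have span: "power_product Ys es \<in> poly_vs.span (monom_eval Var ` monoms_box d M)" if "es \<in> L" for es
    unfolding M_def
    by (intro degrees_le_span degrees_le_power_product Ys) (use that in \<open>auto simp: L_def\<close>)
  show thesis
  proof (cases "inj_on (power_product Ys) L")
    case False
    then obtain a b where ab: "a \<in> L" "b \<in> L" "a \<noteq> b" "power_product Ys a = power_product Ys b"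
      by (auto simp: inj_on_def)
    show thesis
      by (rule that[of "{a, b}" "\<lambda>es. if es = a then 1 else - 1"])
        (use ab in \<open>auto simp: L_def Const_hom\<close>)
  next
    case True
    have "poly_vs.dependent (power_product Ys ` L)"
    proof (rule ccontr)
      assume ind: "poly_vs.independent (power_product Ys ` L)"
      have "card (power_product Ys ` L) \<le> card (monom_eval Var ` monoms_box d M :: ('k npoly) set)"
        using poly_vs.independent_span_bound[OF _ ind] span monoms_box(1) by blast
      also have "\<dots> \<le> Suc M ^ d"
        using card_image_le[OF monoms_box(1)] monoms_box(2) le_trans by blast
      finally show False using big True by (simp add: card_image)
    qed
    then obtain t u v where t: "finite t" "t \<subseteq> power_product Ys ` L"
      "(\<Sum>x\<in>t. Const (u x) * x) = 0" "v \<in> t" "u v \<noteq> 0"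
      unfolding poly_vs.dependent_explicit by blast
    define E where "E = {es \<in> L. power_product Ys es \<in> t \<and> u (power_product Ys es) \<noteq> 0}"
    have inj: "inj_on (power_product Ys) E"
      using True by (rule inj_on_subset) (auto simp: E_def)
    have img: "power_product Ys ` E = {x \<in> t. u x \<noteq> 0}" using t(2) by (auto simp: E_def)
    have "(\<Sum>es\<in>E. Const (u (power_product Ys es)) * power_product Ys es) =
        (\<Sum>x\<in>{x \<in> t. u x \<noteq> 0}. Const (u x) * x)"
      by (simp add: sum.reindex[OF inj] flip: img)
    also have "\<dots> = (\<Sum>x\<in>t. Const (u x) * x)"
      by (rule sum.mono_neutral_left) (use t(1) in \<open>auto simp: Const_hom\<close>)
    finally have "(\<Sum>es\<in>E. Const (u (power_product Ys es)) * power_product Ys es) = 0"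
      by (simp add: t(3))
    moreover have "E \<noteq> {}" using img t(4,5) by blast
    moreover have "finite E" using L(1) by (simp add: E_def)
    moreover have "length es = length Ys" "u (power_product Ys es) \<noteq> 0" if "es \<in> E" for es
      using that by (auto simp: E_def L_def)
    ultimately show thesis by (intro that[of E "\<lambda>es. u (power_product Ys es)"])
  qed
qed

definition vars_below :: "nat \<Rightarrow> ('k::comm_ring_1 npoly) set" where
  "vars_below d = (\<Union>M. degrees_le d M)"

lemma vars_below_uniform:
  assumes "finite A" "A \<subseteq> vars_below d"
  obtains B where "A \<subseteq> degrees_le d B"
proof -
  have "\<exists>B. A \<subseteq> degrees_le d B"
    using assms
  proof (induction A)
    case (insert F A)
    then obtain B M where "A \<subseteq> degrees_le d B" "F \<in> degrees_le d M" by (auto simp: vars_below_def)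
    then have "insert F A \<subseteq> degrees_le d (max B M)"
      using degrees_le_mono[of B "max B M" d] degrees_le_mono[of M "max B M" d] by auto
    then show ?case by blast
  qed simp
  then show thesis using that by blast
qed

text \<open>A relation between the images in the polynomial ring pulls back to a relation modulo the kernel,
  which the independence of the witnesses of the chain excludes.\<close>

lemma (in const_subring) prime_chain_length:
  assumes hom: "ring_map (\<phi> :: _ \<Rightarrow> 'k npoly)" and const: "\<And>c. \<phi> (Const c) = Const c"
    and vars: "\<And>f. f \<in> R \<Longrightarrow> \<phi> f \<in> vars_below d"
    and ker: "\<And>f. f \<in> R \<Longrightarrow> \<phi> f = 0 \<Longrightarrow> f \<in> Q 0"
    and prime: "\<And>i. i \<le> n \<Longrightarrow> prime_of R (Q i)"
    and strict: "\<And>i. i < n \<Longrightarrow> Q i \<subset> Q (Suc i)"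
  shows "n \<le> d"
proof (rule ccontr)
  assume n: "\<not> n \<le> d"
  interpret hom: ring_map \<phi> by (rule hom)
  define y where "y i = (SOME x. x \<in> Q (Suc i) - Q i)" for i
  have y: "y i \<in> Q (Suc i) - Q i" if "i < n" for i
  proof -
    have "\<exists>x. x \<in> Q (Suc i) - Q i" using strict[OF that] by blast
    then show ?thesis unfolding y_def by (rule someI_ex)
  qed
  define ys where "ys = map y [0..<n]"
  have ys: "length ys = n" "\<And>i. i < n \<Longrightarrow> ys ! i = y i" by (simp_all add: ys_def)
  have ysR: "set ys \<subseteq> R"
  proof
    fix x assume "x \<in> set ys"
    then obtain i where "i < n" "x = y i" by (auto simp: ys_def)
    then show "x \<in> R" using y[of i] prime[of "Suc i"] by (auto simp: prime_of_def)
  qed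
  then have "set (map \<phi> ys) \<subseteq> vars_below d" using vars by auto
  then obtain B where B: "set (map \<phi> ys) \<subseteq> degrees_le d B"
    using vars_below_uniform[of "set (map \<phi> ys)" d] by blast
  have len: "d < length (map \<phi> ys)" using n ys by simp
  have "\<exists>E c. finite E \<and> E \<noteq> {} \<and> (\<forall>es\<in>E. length es = length (map \<phi> ys) \<and> c es \<noteq> 0) \<and>
      (\<Sum>es\<in>E. Const (c es) * power_product (map \<phi> ys) es) = 0"
    by (rule algebraically_dependent[OF B len]) blast
  then obtain E c where E: "finite E" "E \<noteq> {}" "\<forall>es\<in>E. length es = length (map \<phi> ys) \<and> c es \<noteq> 0"
    "(\<Sum>es\<in>E. Const (c es) * power_product (map \<phi> ys) es) = 0" by blast
  have "\<phi> (\<Sum>es\<in>E. Const (c es) * power_product ys es) = 0"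
    using E(4) by (simp add: hom.hom const hom.power_product)
  then have "(\<Sum>es\<in>E. Const (c es) * power_product ys es) \<in> Q 0"
    by (intro ker sum_closed mult_closed Const_closed power_product_closed ysR)
  moreover have "(\<Sum>es\<in>E. Const (c es) * power_product ys es) \<notin> Q 0"
  proof (rule chain_independent)
    show "Q i \<subseteq> Q (Suc i)" if "i < length ys" for i using strict[of i] that ys by auto
    show "ys ! i \<in> Q (Suc i) - Q i" if "i < length ys" for i using y[of i] that ys by simp
  qed (use prime ys E in auto)
  ultimately show False by blast
qed

section \<open>Irreducible closed subsets of a prime spectrum\<close>

definition prime_locus :: "('a, 'b) ring_scheme \<Rightarrow> 'a set \<Rightarrow> 'a set set" where
  "prime_locus A S = {P \<in> prime_spectrum A. S \<subseteq> P}"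

lemma primeideal_subset_carrier: "primeideal P A \<Longrightarrow> P \<subseteq> carrier A"
  by (meson additive_subgroup.a_subset ideal.axioms(1) primeideal.axioms(1))

lemma topspace_zariski: "topspace (zariski A) = prime_spectrum A"
proof
  show "topspace (zariski A) \<subseteq> prime_spectrum A"
    by (auto simp: topspace_def openin_zariski)
  have "prime_spectrum A = {P \<in> prime_spectrum A. \<not> carrier A \<subseteq> P}"
    using primeideal_subset_carrier primeideal.I_notcarr by (fastforce simp: prime_spectrum_def)
  then have "openin (zariski A) (prime_spectrum A)"
    unfolding openin_zariski by blast
  then show "prime_spectrum A \<subseteq> topspace (zariski A)" by (rule openin_subset)
qed

lemma closedin_zariski: "closedin (zariski A) C \<longleftrightarrow> (\<exists>S\<subseteq>carrier A. C = prime_locus A S)"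
proof
  assume "closedin (zariski A) C"
  then have C: "C \<subseteq> prime_spectrum A" and "openin (zariski A) (prime_spectrum A - C)"
    by (simp_all add: closedin_def topspace_zariski)
  then obtain S where S: "S \<subseteq> carrier A" "prime_spectrum A - C = {P \<in> prime_spectrum A. \<not> S \<subseteq> P}"
    unfolding openin_zariski by blast
  then have "C = prime_locus A S" using C unfolding prime_locus_def by blast
  with S show "\<exists>S\<subseteq>carrier A. C = prime_locus A S" by blast
next
  assume "\<exists>S\<subseteq>carrier A. C = prime_locus A S"
  then obtain S where S: "S \<subseteq> carrier A" "C = prime_locus A S" by blast
  have "prime_spectrum A - C = {P \<in> prime_spectrum A. \<not> S \<subseteq> P}"
    unfolding S(2) prime_locus_def by blast
  then have "openin (zariski A) (prime_spectrum A - C)" using S(1) unfolding openin_zariski by blast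
  then show "closedin (zariski A) C"
    using S(2) by (simp add: closedin_def topspace_zariski prime_locus_def)
qed

lemma prime_locus_mono_iff:
  assumes "primeideal P A"
  shows "prime_locus A P \<subseteq> prime_locus A S \<longleftrightarrow> S \<subseteq> P"
  using assms unfolding prime_locus_def prime_spectrum_def by blast

lemma prime_locus_closed: "primeideal P A \<Longrightarrow> closedin (zariski A) (prime_locus A P)"
  unfolding closedin_zariski using primeideal_subset_carrier by blast

lemma prime_locus_irreducible:
  assumes P: "primeideal P A"
  shows "irreducible_in (zariski A) (prime_locus A P)"
  unfolding irreducible_in_def topspace_zariski
proof (intro conjI allI impI)
  show "prime_locus A P \<subseteq> prime_spectrum A" by (auto simp: prime_locus_def)
  have mem: "P \<in> prime_locus A P" using P by (simp add: prime_locus_def prime_spectrum_def)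
  then show "prime_locus A P \<noteq> {}" by blast
  fix C D
  assume C: "closedin (zariski A) C" and D: "closedin (zariski A) D" and sub: "prime_locus A P \<subseteq> C \<union> D"
  have "prime_locus A P \<subseteq> Z" if "closedin (zariski A) Z" "P \<in> Z" for Z
    using that unfolding closedin_zariski prime_locus_def by blast
  then show "prime_locus A P \<subseteq> C \<or> prime_locus A P \<subseteq> D" using C D sub mem by blast
qed

text \<open>The generic point of an irreducible closed set is the intersection of its points.\<close>

lemma irreducible_closed_generic_prime:
  assumes A: "cring A" and C: "closedin (zariski A) C" "irreducible_in (zariski A) C"
  shows "primeideal (\<Inter>C) A" "C = prime_locus A (\<Inter>C)"
proof -
  interpret cring A by (rule A)
  obtain S where S: "S \<subseteq> carrier A" "C = prime_locus A S" using C(1) unfolding closedin_zariski by blast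
  have ne: "C \<noteq> {}" using C(2) by (simp add: irreducible_in_def)
  have prime: "primeideal P A" if "P \<in> C" for P
    using that S(2) by (simp add: prime_locus_def prime_spectrum_def)
  show "C = prime_locus A (\<Inter>C)"
  proof
    show "C \<subseteq> prime_locus A (\<Inter>C)" using prime by (auto simp: prime_locus_def prime_spectrum_def)
    have "S \<subseteq> \<Inter>C" using S(2) by (auto simp: prime_locus_def)
    then show "prime_locus A (\<Inter>C) \<subseteq> C" unfolding S(2) by (auto simp: prime_locus_def)
  qed
  show "primeideal (\<Inter>C) A"
  proof (rule primeidealI)
    show "ideal (\<Inter>C) A"
      using prime ne by (intro i_Intersect) (auto intro: primeideal.axioms(1))
    show "carrier A \<noteq> \<Inter>C"
    proof
      assume eq: "carrier A = \<Inter>C"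
      obtain P where "P \<in> C" using ne by blast
      then have "carrier A \<subseteq> P" unfolding eq by blast
      then show False
        using primeideal_subset_carrier[OF prime[OF \<open>P \<in> C\<close>]]
          primeideal.I_notcarr[OF prime[OF \<open>P \<in> C\<close>]] by (simp add: subset_antisym)
    qed
    fix a b assume ab: "a \<in> carrier A" "b \<in> carrier A" "a \<otimes>\<^bsub>A\<^esub> b \<in> \<Inter>C"
    have "C \<subseteq> prime_locus A {a} \<union> prime_locus A {b}"
    proof
      fix P assume P: "P \<in> C"
      then have "a \<in> P \<or> b \<in> P" using ab by (intro primeideal.I_prime[OF prime[OF P]]) auto
      then show "P \<in> prime_locus A {a} \<union> prime_locus A {b}"
        using prime[OF P] by (auto simp: prime_locus_def prime_spectrum_def)
    qed
    moreover have "closedin (zariski A) (prime_locus A {a})" "closedin (zariski A) (prime_locus A {b})"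
      using ab unfolding closedin_zariski by blast+
    ultimately have "C \<subseteq> prime_locus A {a} \<or> C \<subseteq> prime_locus A {b}"
      using C(2) unfolding irreducible_in_def by blast
    then show "a \<in> \<Inter>C \<or> b \<in> \<Inter>C" by (auto simp: prime_locus_def)
  qed (rule A)
qed

lemma irreducible_in_closed_subtopology:
  assumes Z: "closedin T Z"
  shows "irreducible_in (subtopology T Z) S \<longleftrightarrow> irreducible_in T S \<and> S \<subseteq> Z"
proof
  assume S: "irreducible_in (subtopology T Z) S"
  then have sub: "S \<subseteq> topspace T" "S \<subseteq> Z" "S \<noteq> {}" by (auto simp: irreducible_in_def)
  have "S \<subseteq> C \<or> S \<subseteq> D" if "closedin T C" "closedin T D" "S \<subseteq> C \<union> D" for C D
  proof -
    have "closedin (subtopology T Z) (C \<inter> Z)" "closedin (subtopology T Z) (D \<inter> Z)"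
      using that Z by (auto simp: closedin_closed_subtopology)
    moreover have "S \<subseteq> (C \<inter> Z) \<union> (D \<inter> Z)" using that sub by blast
    ultimately have "S \<subseteq> C \<inter> Z \<or> S \<subseteq> D \<inter> Z" using S unfolding irreducible_in_def by blast
    then show ?thesis by blast
  qed
  then show "irreducible_in T S \<and> S \<subseteq> Z" using sub unfolding irreducible_in_def by blast
next
  assume S: "irreducible_in T S \<and> S \<subseteq> Z"
  then show "irreducible_in (subtopology T Z) S"
    using Z unfolding irreducible_in_def
    by (auto simp: closedin_closed_subtopology)
qed

text \<open>Irreducible closed subsets correspond to primes with inclusions reversed, so chains are read
  backwards.\<close>

lemma krull_dim_prime_locus:
  assumes A: "cring A" and P: "primeideal P A"
    and upper: "\<And>n Q. \<forall>i\<le>n. primeideal (Q i) A \<Longrightarrow> P \<subseteq> Q 0 \<Longrightarrow> \<forall>i<n. Q i \<subset> Q (Suc i) \<Longrightarrow> n \<le> d"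
    and lower: "\<forall>i\<le>d. primeideal (Q i) A" "P \<subseteq> Q 0" "\<forall>i<d. Q i \<subset> Q (Suc i)"
  shows "krull_dim (subtopology (zariski A) (prime_locus A P)) = enat d"
proof -
  let ?T = "zariski A" and ?Z = "prime_locus A P"
  have Z: "closedin ?T ?Z" by (rule prime_locus_closed[OF P])
  let ?N = "{n. \<exists>Z. (\<forall>i\<le>n. closedin (subtopology ?T ?Z) (Z i) \<and>
      irreducible_in (subtopology ?T ?Z) (Z i)) \<and> (\<forall>i<n. Z i \<subset> Z (Suc i))}"
  have "n \<le> d" if n: "n \<in> ?N" for n
  proof -
    obtain Z' where Z': "\<And>i. i \<le> n \<Longrightarrow> closedin ?T (Z' i)" "\<And>i. i \<le> n \<Longrightarrow> Z' i \<subseteq> ?Z"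
      "\<And>i. i \<le> n \<Longrightarrow> irreducible_in ?T (Z' i)" "\<And>i. i < n \<Longrightarrow> Z' i \<subset> Z' (Suc i)"
      using n unfolding mem_Collect_eq closedin_closed_subtopology[OF Z]
        irreducible_in_closed_subtopology[OF Z] by blast
    define Q where "Q i = \<Inter>(Z' (n - i))" for i
    have gen: "primeideal (Q i) A" "Z' (n - i) = prime_locus A (Q i)" for i
      unfolding Q_def by (rule irreducible_closed_generic_prime[OF A Z'(1) Z'(3)]; simp)+
    show ?thesis
    proof (rule upper[of n Q])
      show "\<forall>i\<le>n. primeideal (Q i) A" using gen by blast
      show "P \<subseteq> Q 0"
        using Z'(2)[of n] gen(2)[of 0] prime_locus_mono_iff[OF gen(1)[of 0], of P] by simp
      show "\<forall>i<n. Q i \<subset> Q (Suc i)"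
      proof (intro allI impI)
        fix i assume i: "i < n"
        then have "Suc (n - Suc i) = n - i" by simp
        then have "Z' (n - Suc i) \<subset> Z' (n - i)" using Z'(4)[of "n - Suc i"] i by simp
        then have less: "prime_locus A (Q (Suc i)) \<subset> prime_locus A (Q i)"
          unfolding gen(2)[symmetric] .
        then have "prime_locus A (Q (Suc i)) \<subseteq> prime_locus A (Q i)" by (rule psubset_imp_subset)
        then have "Q i \<subseteq> Q (Suc i)" by (simp only: prime_locus_mono_iff[OF gen(1)])
        moreover have "Q i \<noteq> Q (Suc i)" using less by auto
        ultimately show "Q i \<subset> Q (Suc i)" by (rule psubsetI)
      qed
    qed
  qed
  moreover have "d \<in> ?N"
  proof -
    let ?Y = "\<lambda>i. prime_locus A (Q (d - i))"
    have mono: "P \<subseteq> Q i" if "i \<le> d" for i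
      using that
    proof (induction i)
      case (Suc i)
      then have "P \<subseteq> Q i" "Q i \<subset> Q (Suc i)" using lower(3) by simp_all
      then show ?case by blast
    qed (use lower(2) in simp)
    have "closedin ?T (?Y i) \<and> ?Y i \<subseteq> ?Z \<and> irreducible_in ?T (?Y i)" if "i \<le> d" for i
    proof -
      have Q: "primeideal (Q (d - i)) A" using lower(1) by simp
      have "?Y i \<subseteq> ?Z" using mono[of "d - i"] prime_locus_mono_iff[OF Q, of P] by simp
      then show ?thesis using prime_locus_closed[OF Q] prime_locus_irreducible[OF Q] by blast
    qed
    moreover have "?Y i \<subset> ?Y (Suc i)" if "i < d" for i
    proof -
      have eq: "d - i = Suc (d - Suc i)" using that by simp
      have Q: "primeideal (Q (d - i)) A" "primeideal (Q (d - Suc i)) A" using lower(1) by simp_all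
      have less: "Q (d - Suc i) \<subset> Q (d - i)" using lower(3) that unfolding eq by simp
      then have "?Y i \<subseteq> ?Y (Suc i)" using prime_locus_mono_iff[OF Q(1), of "Q (d - Suc i)"] by simp
      moreover have "\<not> ?Y (Suc i) \<subseteq> ?Y i"
        using less prime_locus_mono_iff[OF Q(2), of "Q (d - i)"] by simp
      ultimately show ?thesis by (simp add: less_le_not_le)
    qed
    ultimately show ?thesis
      unfolding mem_Collect_eq closedin_closed_subtopology[OF Z]
        irreducible_in_closed_subtopology[OF Z]
      by (intro exI[of _ ?Y]) blast
  qed
  ultimately show ?thesis
    unfolding krull_dim_def by (intro antisym SUP_least SUP_upper) simp_all
qed

lemma irreducible_components_two:
  assumes P: "primeideal P\<^sub>1 A" "primeideal P\<^sub>2 A" "\<not> P\<^sub>1 \<subseteq> P\<^sub>2" "\<not> P\<^sub>2 \<subseteq> P\<^sub>1"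
    and cover: "\<And>Q. primeideal Q A \<Longrightarrow> P\<^sub>1 \<subseteq> Q \<or> P\<^sub>2 \<subseteq> Q"
  shows "irreducible_components (zariski A) = {prime_locus A P\<^sub>1, prime_locus A P\<^sub>2}"
proof -
  have split: "S \<subseteq> prime_locus A P\<^sub>1 \<or> S \<subseteq> prime_locus A P\<^sub>2" if S: "irreducible_in (zariski A) S" for S
  proof -
    have "S \<subseteq> prime_spectrum A" using S by (simp add: irreducible_in_def topspace_zariski)
    then have "S \<subseteq> prime_locus A P\<^sub>1 \<union> prime_locus A P\<^sub>2"
      using cover unfolding prime_locus_def prime_spectrum_def by blast
    then show ?thesis
      using S prime_locus_closed[OF P(1)] prime_locus_closed[OF P(2)] unfolding irreducible_in_def by blast
  qed
  have nsub: "\<not> prime_locus A P\<^sub>1 \<subseteq> prime_locus A P\<^sub>2" "\<not> prime_locus A P\<^sub>2 \<subseteq> prime_locus A P\<^sub>1"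
    using P prime_locus_mono_iff by blast+
  note irr = prime_locus_irreducible[OF P(1)] prime_locus_irreducible[OF P(2)]
  have max: "S = prime_locus A P'"
    if S: "irreducible_in (zariski A) S" "prime_locus A P' \<subseteq> S"
      and P': "P' = P\<^sub>1 \<or> P' = P\<^sub>2" for S P'
    using P'
  proof
    assume "P' = P\<^sub>1"
    then show ?thesis using split[OF S(1)] nsub(1) S(2) by auto
  next
    assume "P' = P\<^sub>2"
    then show ?thesis using split[OF S(1)] nsub(2) S(2) by auto
  qed
  show ?thesis
    unfolding irreducible_components_def
  proof (intro equalityI subsetI)
    fix S assume "S \<in> {S. irreducible_in (zariski A) S \<and>
      (\<forall>S'. irreducible_in (zariski A) S' \<longrightarrow> S \<subseteq> S' \<longrightarrow> S' = S)}"
    then have S: "irreducible_in (zariski A) S"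
      "\<And>S'. irreducible_in (zariski A) S' \<Longrightarrow> S \<subseteq> S' \<Longrightarrow> S' = S" by simp_all
    from split[OF S(1)] show "S \<in> {prime_locus A P\<^sub>1, prime_locus A P\<^sub>2}"
      using S(2)[OF irr(1)] S(2)[OF irr(2)] by auto
  next
    fix S assume "S \<in> {prime_locus A P\<^sub>1, prime_locus A P\<^sub>2}"
    then show "S \<in> {S. irreducible_in (zariski A) S \<and>
      (\<forall>S'. irreducible_in (zariski A) S' \<longrightarrow> S \<subseteq> S' \<longrightarrow> S' = S)}"
      using irr max[of _ P\<^sub>1] max[of _ P\<^sub>2] by auto
  qed
qed

section \<open>Primes of the invariant ring\<close>

definition adhm_class :: "'k::comm_ring_1 adhm_poly \<Rightarrow> 'k adhm_poly set" where
  "adhm_class f = adhm_ideal +>\<^bsub>ring_of_type_algebra\<^esub> f"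

lemma adhm_class_eq_iff: "adhm_class f = adhm_class g \<longleftrightarrow> f - g \<in> adhm_ideal"
proof -
  have mem: "h \<in> adhm_class f \<longleftrightarrow> h - f \<in> adhm_ideal" for h f :: "'a adhm_poly"
  proof -
    have "adhm_class f = {i + f | i. i \<in> adhm_ideal}"
      by (auto simp: adhm_class_def a_r_coset_def r_coset_def)
    then show ?thesis by (auto intro!: exI[of _ "h - f"])
  qed
  show ?thesis
  proof
    assume "adhm_class f = adhm_class g"
    then have "f \<in> adhm_class g" using mem[of f f] adhm_ideal_zero by auto
    then show "f - g \<in> adhm_ideal" using mem by blast
  next
    assume fg: "f - g \<in> adhm_ideal"
    have "h - f \<in> adhm_ideal \<longleftrightarrow> h - g \<in> adhm_ideal" for h
      using adhm_ideal_add[OF _ fg, of "h - f"] adhm_ideal_diff[OF _ fg, of "h - g"] by auto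
    then show "adhm_class f = adhm_class g" using mem by blast
  qed
qed

lemma carrier_invariant_ring: "carrier adhm_invariant_ring = adhm_class ` invariants"
  by (auto simp: adhm_invariant_ring_def invariants_def simp flip: adhm_class_def simp: adhm_class_eq_iff)

lemma invariant_ring_ops:
  fixes f g :: "'k::comm_ring_1 adhm_poly"
  shows "adhm_class f \<otimes>\<^bsub>adhm_invariant_ring\<^esub> adhm_class g = adhm_class (f * g)"
  "adhm_class f \<oplus>\<^bsub>adhm_invariant_ring\<^esub> adhm_class g = adhm_class (f + g)"
  "\<one>\<^bsub>adhm_invariant_ring\<^esub> = (adhm_class 1 :: 'k adhm_poly set)"
  "\<zero>\<^bsub>adhm_invariant_ring\<^esub> = (adhm_class 0 :: 'k adhm_poly set)"
proof -
  interpret ideal adhm_ideal "ring_of_type_algebra :: 'k adhm_poly ring" by (rule ideal_adhm_ideal)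
  show "adhm_class f \<otimes>\<^bsub>adhm_invariant_ring\<^esub> adhm_class g = adhm_class (f * g)"
    using rcoset_mult_add[of f g]
    by (simp add: adhm_class_def adhm_invariant_ring_def adhm_coordinate_ring_def FactRing_def)
  show "adhm_class f \<oplus>\<^bsub>adhm_invariant_ring\<^esub> adhm_class g = adhm_class (f + g)"
    using a_rcos_sum[of f g]
    by (simp add: adhm_class_def adhm_invariant_ring_def adhm_coordinate_ring_def FactRing_def)
  show "\<one>\<^bsub>adhm_invariant_ring\<^esub> = (adhm_class 1 :: 'k adhm_poly set)"
    by (simp add: adhm_class_def adhm_invariant_ring_def adhm_coordinate_ring_def FactRing_def)
  have "adhm_class 0 = (adhm_ideal :: 'k adhm_poly set)"
    by (auto simp: adhm_class_def a_r_coset_def r_coset_def)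
  then show "\<zero>\<^bsub>adhm_invariant_ring\<^esub> = (adhm_class 0 :: 'k adhm_poly set)"
    by (simp add: adhm_invariant_ring_def adhm_coordinate_ring_def FactRing_def)
qed

lemma cring_invariant_ring: "cring (adhm_invariant_ring :: 'k::comm_ring_1 adhm_poly set ring)"
proof (rule cringI)
  let ?A = "adhm_invariant_ring :: 'k adhm_poly set ring"
  show "abelian_group ?A"
  proof (rule abelian_groupI)
    show "\<exists>y\<in>carrier ?A. y \<oplus>\<^bsub>?A\<^esub> x = \<zero>\<^bsub>?A\<^esub>" if "x \<in> carrier ?A" for x
    proof -
      obtain f where f: "f \<in> invariants" "x = adhm_class f"
        using \<open>x \<in> carrier ?A\<close> by (auto simp: carrier_invariant_ring)
      show ?thesis
        by (rule bexI[of _ "adhm_class (- f)"])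
          (use f in \<open>auto simp: carrier_invariant_ring invariant_ring_ops invariants_uminus\<close>)
    qed
  qed (auto simp: carrier_invariant_ring invariant_ring_ops add_ac invariants_add invariants_0)
  show "Group.comm_monoid ?A"
    by (rule comm_monoidI)
      (auto simp: carrier_invariant_ring invariant_ring_ops mult_ac invariants_mult invariants_1)
qed (auto simp: carrier_invariant_ring invariant_ring_ops distrib_right)

definition contract :: "'k::comm_ring_1 adhm_poly set set \<Rightarrow> 'k adhm_poly set" where
  "contract P = {f \<in> invariants. adhm_class f \<in> P}"

lemma contract_mono_iff:
  "P \<subseteq> carrier adhm_invariant_ring \<Longrightarrow> contract P \<subseteq> contract P' \<longleftrightarrow> P \<subseteq> P'"
  by (auto simp: contract_def carrier_invariant_ring)

lemma adhm_ideal_subset_contract: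
  assumes P: "primeideal P adhm_invariant_ring"
  shows "adhm_ideal \<subseteq> contract P"
proof
  interpret primeideal P adhm_invariant_ring by (rule P)
  fix f :: "'a adhm_poly" assume f: "f \<in> adhm_ideal"
  then have "adhm_class f = \<zero>\<^bsub>adhm_invariant_ring\<^esub>" by (simp add: invariant_ring_ops adhm_class_eq_iff)
  then show "f \<in> contract P"
    using f adhm_ideal_subset_invariants zero_closed additive_subgroup.zero_closed[OF additive_subgroup_axioms]
    by (auto simp: contract_def)
qed

lemma prime_of_contract:
  assumes P: "primeideal P adhm_invariant_ring"
  shows "prime_of invariants (contract P)"
proof -
  interpret primeideal P adhm_invariant_ring by (rule P)
  have cls: "adhm_class f \<in> carrier adhm_invariant_ring" if "f \<in> invariants" for f
    using that by (auto simp: carrier_invariant_ring)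
  show ?thesis
    unfolding prime_of_def
  proof (intro conjI ballI impI)
    show "contract P \<subseteq> invariants" by (auto simp: contract_def)
    show "1 \<notin> contract P"
    proof
      assume "1 \<in> contract P"
      then have "\<one>\<^bsub>adhm_invariant_ring\<^esub> \<in> P" by (simp add: contract_def invariant_ring_ops)
      then show False using one_imp_carrier I_notcarr by simp
    qed
    show "x + y \<in> contract P" if "x \<in> contract P" "y \<in> contract P" for x y
      using that additive_subgroup.a_closed[OF ideal.axioms(1)[OF primeideal.axioms(1)[OF P]],
          of "adhm_class x" "adhm_class y"]
      by (simp add: contract_def invariants_add invariant_ring_ops)
    show "r * x \<in> contract P" if "r \<in> invariants" "x \<in> contract P" for r x
      using that I_l_closed[of "adhm_class x" "adhm_class r"] cls[of r]
      by (simp add: contract_def invariants_mult invariant_ring_ops)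
    show "x \<in> contract P \<or> y \<in> contract P"
      if "x \<in> invariants" "y \<in> invariants" "x * y \<in> contract P" for x y
      using that I_prime[of "adhm_class x" "adhm_class y"] cls[of x] cls[of y]
      by (simp add: contract_def invariant_ring_ops)
  qed
qed

lemma primeideal_adhm_class:
  assumes Q: "prime_of invariants Q" and I: "adhm_ideal \<subseteq> Q"
  shows "primeideal (adhm_class ` Q) adhm_invariant_ring" "contract (adhm_class ` Q) = Q"
proof -
  interpret A: cring "adhm_invariant_ring :: 'a adhm_poly set ring" by (rule cring_invariant_ring)
  have sub: "Q \<subseteq> invariants" using Q by (simp add: prime_of_def)
  have mem: "f \<in> Q" if f: "adhm_class f \<in> adhm_class ` Q" for f
  proof -
    obtain g where g: "g \<in> Q" "f - g \<in> adhm_ideal" using f by (auto simp: adhm_class_eq_iff)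
    then have "f - g + g \<in> Q" using I by (intro prime_ofD(1)[OF Q]) auto
    then show ?thesis by simp
  qed
  show "contract (adhm_class ` Q) = Q"
  proof (intro equalityI subsetI)
    show "f \<in> Q" if "f \<in> contract (adhm_class ` Q)" for f
      by (rule mem) (use that in \<open>simp add: contract_def\<close>)
    show "f \<in> contract (adhm_class ` Q)" if "f \<in> Q" for f
      using that sub unfolding contract_def by blast
  qed
  show "primeideal (adhm_class ` Q) adhm_invariant_ring"
  proof (rule primeidealI)
    show "ideal (adhm_class ` Q) adhm_invariant_ring"
    proof (rule idealI)
      show "subgroup (adhm_class ` Q) (add_monoid adhm_invariant_ring)"
      proof (rule A.add.subgroupI)
        show "adhm_class ` Q \<subseteq> carrier adhm_invariant_ring" using sub by (auto simp: carrier_invariant_ring)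
        show "adhm_class ` Q \<noteq> {}" using I adhm_ideal_zero by blast
        show "a \<oplus>\<^bsub>adhm_invariant_ring\<^esub> b \<in> adhm_class ` Q" if "a \<in> adhm_class ` Q" "b \<in> adhm_class ` Q" for a b
          using that prime_ofD(1)[OF Q] by (auto simp: invariant_ring_ops)
        show "\<ominus>\<^bsub>adhm_invariant_ring\<^esub> a \<in> adhm_class ` Q" if a: "a \<in> adhm_class ` Q" for a
        proof -
          obtain f where f: "f \<in> Q" "a = adhm_class f" using a by blast
          have "- 1 * f \<in> Q" using f invariants_uminus[OF invariants_1] by (intro prime_ofD(2)[OF Q])
          moreover have "\<ominus>\<^bsub>adhm_invariant_ring\<^esub> a = adhm_class (- f)"
            using f sub by (intro A.minus_equality)
              (auto simp: invariant_ring_ops carrier_invariant_ring invariants_uminus)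
          ultimately show ?thesis by simp
        qed
      qed
    next
      have mult: "adhm_class f \<otimes>\<^bsub>adhm_invariant_ring\<^esub> adhm_class g \<in> adhm_class ` Q"
        "adhm_class g \<otimes>\<^bsub>adhm_invariant_ring\<^esub> adhm_class f \<in> adhm_class ` Q"
        if "f \<in> invariants" "g \<in> Q" for f g
        using prime_ofD(2)[OF Q that] by (simp_all add: invariant_ring_ops mult.commute[of g f])
      show "x \<otimes>\<^bsub>adhm_invariant_ring\<^esub> a \<in> adhm_class ` Q" "a \<otimes>\<^bsub>adhm_invariant_ring\<^esub> x \<in> adhm_class ` Q"
        if "a \<in> adhm_class ` Q" "x \<in> carrier adhm_invariant_ring" for a x
        using that mult by (auto simp: carrier_invariant_ring)
    qed (rule A.ring_axioms)
    show "carrier adhm_invariant_ring \<noteq> adhm_class ` Q"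
    proof
      assume "carrier adhm_invariant_ring = adhm_class ` Q"
      then have "adhm_class 1 \<in> adhm_class ` Q" using invariants_1 by (auto simp: carrier_invariant_ring)
      then have "1 \<in> Q" by (rule mem)
      then show False using Q by (simp add: prime_of_def)
    qed
    fix a b :: "'a adhm_poly set"
    assume "a \<in> carrier adhm_invariant_ring" "b \<in> carrier adhm_invariant_ring"
      and ab: "a \<otimes>\<^bsub>adhm_invariant_ring\<^esub> b \<in> adhm_class ` Q"
    then obtain f g where fg: "f \<in> invariants" "g \<in> invariants" "a = adhm_class f" "b = adhm_class g"
      by (auto simp: carrier_invariant_ring)
    have "f * g \<in> Q" by (rule mem) (use ab in \<open>simp add: fg invariant_ring_ops\<close>)
    then have "f \<in> Q \<or> g \<in> Q" using fg by (intro prime_ofD(3)[OF Q])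
    then show "a \<in> adhm_class ` Q \<or> b \<in> adhm_class ` Q" using fg by blast
  qed (rule cring_invariant_ring)
qed

section \<open>Dimensions of the components\<close>

lemma vars_below_add: "F \<in> vars_below d \<Longrightarrow> G \<in> vars_below d \<Longrightarrow> F + G \<in> vars_below d"
proof -
  assume "F \<in> vars_below d" "G \<in> vars_below d"
  then obtain M N where "F \<in> degrees_le d M" "G \<in> degrees_le d N" by (auto simp: vars_below_def)
  then have "F \<in> degrees_le d (max M N)" "G \<in> degrees_le d (max M N)"
    using degrees_le_mono[of M "max M N" d] degrees_le_mono[of N "max M N" d] by auto
  then have "F + G \<in> degrees_le d (max M N)"
    using keys_add[of F G] unfolding degrees_le_def by blast
  then show ?thesis unfolding vars_below_def by blast
qed

lemma vars_below_mult: "F \<in> vars_below d \<Longrightarrow> G \<in> vars_below d \<Longrightarrow> F * G \<in> vars_below d"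
  by (auto simp: vars_below_def intro: degrees_le_mult)

lemma vars_below_Const: "Const c \<in> vars_below d"
proof -
  have "Const c \<in> degrees_le d 0" by (simp add: degrees_le_def Const_def)
  then show ?thesis unfolding vars_below_def by blast
qed

lemma vars_below_0: "0 \<in> vars_below d" and vars_below_1: "1 \<in> vars_below d"
  using vars_below_Const[of 0 d] vars_below_Const[of 1 d] by (simp_all add: Const_hom)

lemma vars_below_diff: "F \<in> vars_below d \<Longrightarrow> G \<in> vars_below d \<Longrightarrow> F - G \<in> vars_below d"
  using vars_below_add[of F d "Const (- 1) * G"] vars_below_mult[OF vars_below_Const, of G d "- 1"]
  by (simp add: Const_hom)

lemma vars_below_Var: "v < d \<Longrightarrow> Var v \<in> vars_below d"
proof -
  assume "v < d"
  then have "Var v \<in> degrees_le d 1" by (simp add: degrees_le_def Var_def lookup_single when_def)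
  then show ?thesis unfolding vars_below_def by blast
qed

lemma vars_below_power: "F \<in> vars_below d \<Longrightarrow> F ^ n \<in> vars_below d"
  by (induction n) (auto intro: vars_below_1 vars_below_mult)

lemma vars_below_subst:
  fixes f :: "('v \<Rightarrow>\<^sub>0 nat) \<Rightarrow>\<^sub>0 'k::comm_ring_1"
  assumes "\<And>v. \<sigma> v \<in> vars_below d"
  shows "subst_poly \<sigma> f \<in> vars_below d"
proof -
  have prod: "(\<Prod>v\<in>A. g v) \<in> vars_below d" if "\<And>v. g v \<in> vars_below d" for g and A :: "'v set"
    using that by (induction A rule: infinite_finite_induct) (auto intro: vars_below_1 vars_below_mult)
  have sum: "(\<Sum>m\<in>A. g m) \<in> vars_below d" if "\<And>m. g m \<in> vars_below d" for g and A :: "('v \<Rightarrow>\<^sub>0 nat) set"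
    using that by (induction A rule: infinite_finite_induct) (auto intro: vars_below_0 vars_below_add)
  show ?thesis
    unfolding eval_poly_def monom_eval_def
    by (intro sum vars_below_mult vars_below_Const prod vars_below_power assms)
qed

lemma const_subring_invariants: "const_subring (invariants :: 'k::field adhm_poly set)"
  by unfold_locales (auto intro: invariants_add invariants_mult invariants_Const)

definition restriction_kernel ::
    "('k::comm_ring_1 adhm_poly \<Rightarrow> 'k npoly) \<Rightarrow> 'k adhm_poly set" where
  "restriction_kernel \<rho> = {f \<in> invariants. \<rho> f = 0}"

text \<open>The element \<open>w\<close> shows that setting the next variable of the list to zero strictly enlarges the prime.\<close>

definition separates ::
    "('k::comm_ring_1 adhm_poly \<Rightarrow> 'k npoly) \<Rightarrow> nat list \<Rightarrow> nat \<Rightarrow> 'k adhm_poly \<Rightarrow> bool"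
  where "separates \<rho> ns i w \<longleftrightarrow>
    (\<forall>\<tau>. (\<forall>n\<in>set (take (Suc i) ns). \<tau> n = 0) \<longrightarrow> at_point \<tau> (\<rho> w) = 0) \<and>
    (\<exists>\<tau>. (\<forall>n\<in>set (take i ns). \<tau> n = 0) \<and> at_point \<tau> (\<rho> w) \<noteq> 0)"

abbreviation restriction_prime ::
    "('k::comm_ring_1 adhm_poly \<Rightarrow> 'k npoly) \<Rightarrow> 'k adhm_poly set set" where
  "restriction_prime \<rho> \<equiv> adhm_class ` restriction_kernel \<rho>"

text \<open>Restriction of polynomials to a family of ADHM data parametrized by an affine space.\<close>

locale restriction =
  fixes \<rho> :: "'k::field_char_0 adhm_poly \<Rightarrow> 'k npoly"
  assumes hom: "ring_map \<rho>" and const: "\<rho> (Const c) = Const c"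
    and ideal: "f \<in> adhm_ideal \<Longrightarrow> \<rho> f = 0"
begin

definition coordinate_prime :: "nat set \<Rightarrow> 'k adhm_poly set" where
  "coordinate_prime N =
     {f \<in> invariants. \<forall>\<tau>. (\<forall>n\<in>N. \<tau> n = 0) \<longrightarrow> at_point \<tau> (\<rho> f) = 0}"

lemma prime_of_coordinate_prime: "prime_of invariants (coordinate_prime N)"
proof -
  interpret hom: ring_map \<rho> by (rule hom)
  define kill where "kill = subst_poly (\<lambda>n. if n \<in> N then 0 else Var n :: 'k npoly)"
  interpret kill: ring_map kill unfolding kill_def by (rule ring_map_eval_poly[OF ring_map_Const])
  have at: "at_point \<tau> (kill F) = at_point (\<lambda>n. if n \<in> N then 0 else \<tau> n) F" for \<tau> F
    unfolding kill_def at_point_subst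
    by (rule arg_cong[where f = "\<lambda>\<sigma>. at_point \<sigma> F"]) (auto simp: at_point_simps)
  have iff: "f \<in> coordinate_prime N \<longleftrightarrow> f \<in> invariants \<and> kill (\<rho> f) = 0" for f
  proof -
    have "kill (\<rho> f) = 0" if v: "\<forall>\<tau>. (\<forall>n\<in>N. \<tau> n = 0) \<longrightarrow> at_point \<tau> (\<rho> f) = 0"
      by (rule poly_eq_0_if_vanishes) (use v in \<open>simp add: at\<close>)
    moreover have "at_point \<tau> (\<rho> f) = 0" if k: "kill (\<rho> f) = 0" and \<tau>: "\<forall>n\<in>N. \<tau> n = 0" for \<tau>
    proof -
      have "(\<lambda>n. if n \<in> N then 0 else \<tau> n) = \<tau>" using \<tau> by auto
      then show ?thesis using at[of \<tau> "\<rho> f"] k by (simp add: at_point_simps)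
    qed
    ultimately show ?thesis by (auto simp: coordinate_prime_def)
  qed
  show ?thesis
    unfolding prime_of_def
    by (auto simp: iff hom.hom kill.hom invariants_add invariants_mult)
qed

lemma adhm_ideal_subset_coordinate_prime: "adhm_ideal \<subseteq> coordinate_prime N"
  using adhm_ideal_subset_invariants by (auto simp: coordinate_prime_def ideal at_point_simps)

lemma coordinate_prime_empty: "coordinate_prime {} = restriction_kernel \<rho>"
  using poly_eq_0_if_vanishes by (auto simp: coordinate_prime_def restriction_kernel_def at_point_simps)

lemma primeideal_restriction_kernel:
  "primeideal (restriction_prime \<rho>) adhm_invariant_ring"
  "contract (restriction_prime \<rho>) = restriction_kernel \<rho>"
  using primeideal_adhm_class[OF prime_of_coordinate_prime[of "{}"] adhm_ideal_subset_coordinate_prime]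
  by (simp_all add: coordinate_prime_empty)

lemma krull_dim_restriction:
  assumes vars: "\<And>f. \<rho> f \<in> vars_below d" and len: "length ns = d"
    and witness: "\<And>i. i < d \<Longrightarrow> \<exists>w\<in>invariants. separates \<rho> ns i w"
  shows "krull_dim (subtopology (zariski adhm_invariant_ring)
    (prime_locus adhm_invariant_ring (restriction_prime \<rho>))) = enat d"
proof (rule krull_dim_prime_locus[OF cring_invariant_ring primeideal_restriction_kernel(1)])
  let ?A = "adhm_invariant_ring :: 'k adhm_poly set ring"
  fix n and Q :: "nat \<Rightarrow> 'k adhm_poly set set"
  assume Q: "\<forall>i\<le>n. primeideal (Q i) ?A" "restriction_prime \<rho> \<subseteq> Q 0" "\<forall>i<n. Q i \<subset> Q (Suc i)"
  have carrier: "Q i \<subseteq> carrier ?A" if "i \<le> n" for i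
    using Q(1) that primeideal_subset_carrier by blast
  show "n \<le> d"
  proof (rule const_subring.prime_chain_length[OF const_subring_invariants hom const vars,
        where Q = "\<lambda>i. contract (Q i)" and n = n])
    show "f \<in> contract (Q 0)" if "f \<in> invariants" "\<rho> f = 0" for f
      using that Q(2) by (auto simp: contract_def restriction_kernel_def)
    show "prime_of invariants (contract (Q i))" if "i \<le> n" for i
      using Q(1) that by (simp add: prime_of_contract)
    show "contract (Q i) \<subset> contract (Q (Suc i))" if "i < n" for i
      using Q(3) that contract_mono_iff[OF carrier, of i "Q (Suc i)"]
        contract_mono_iff[OF carrier, of "Suc i" "Q i"] by (simp add: less_le_not_le)
  qed
next
  let ?Q = "\<lambda>i. adhm_class ` coordinate_prime (set (take i ns))"
  note Q = primeideal_adhm_class[OF prime_of_coordinate_prime adhm_ideal_subset_coordinate_prime]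
  show "\<forall>i\<le>d. primeideal (?Q i) adhm_invariant_ring" using Q(1) by blast
  show "restriction_prime \<rho> \<subseteq> ?Q 0" by (simp add: coordinate_prime_empty)
  show "\<forall>i<d. ?Q i \<subset> ?Q (Suc i)"
  proof (intro allI impI)
    fix i assume i: "i < d"
    have "set (take i ns) \<subseteq> set (take (Suc i) ns)" by (rule set_take_subset_set_take) simp
    then have "coordinate_prime (set (take i ns)) \<subseteq> coordinate_prime (set (take (Suc i) ns))"
      unfolding coordinate_prime_def by blast
    then have "?Q i \<subseteq> ?Q (Suc i)" by (rule image_mono)
    moreover have "\<not> ?Q (Suc i) \<subseteq> ?Q i"
    proof
      assume "?Q (Suc i) \<subseteq> ?Q i"
      then have "contract (?Q (Suc i)) \<subseteq> contract (?Q i)" unfolding contract_def by blast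
      then have sub: "coordinate_prime (set (take (Suc i) ns)) \<subseteq> coordinate_prime (set (take i ns))"
        unfolding Q(2) .
      obtain w where w: "w \<in> invariants"
        "\<forall>\<tau>. (\<forall>n\<in>set (take (Suc i) ns). \<tau> n = 0) \<longrightarrow> at_point \<tau> (\<rho> w) = 0"
        "\<exists>\<tau>. (\<forall>n\<in>set (take i ns). \<tau> n = 0) \<and> at_point \<tau> (\<rho> w) \<noteq> 0"
        using witness[OF i] unfolding separates_def by blast
      then have "w \<in> coordinate_prime (set (take (Suc i) ns))" by (simp add: coordinate_prime_def)
      then have "w \<in> coordinate_prime (set (take i ns))" using sub by blast
      then show False using w(3) by (auto simp: coordinate_prime_def)
    qed
    ultimately show "?Q i \<subset> ?Q (Suc i)" by (simp only: less_le_not_le simp_thms)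
  qed
qed

end

lemma restriction_subst:
  assumes "adhm_data (D :: 2 \<Rightarrow> 2 \<Rightarrow> ('k::field_char_0 npoly) ^ 2 ^ 2)"
  shows "restriction (subst_poly (entry D))"
  by (rule restriction.intro)
    (simp_all add: ring_map_eval_poly[OF ring_map_Const] eval_poly_Const[OF ring_map_Const]
      adhm_ideal_vanishes[OF ring_map_Const assms])

interpretation split: restriction split_restrict
  unfolding split_restrict_def by (rule restriction_subst[OF adhm_data_split])

interpretation pencil: restriction pencil_restrict
  unfolding pencil_restrict_def by (rule restriction_subst[OF adhm_data_pencil])

interpretation cross: restriction cross_restrict
  unfolding cross_restrict_def by (rule restriction_subst[OF adhm_data_split])

lemma split_vars: "split_restrict f \<in> vars_below 8"
  unfolding split_restrict_def
proof (rule vars_below_subst)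
  fix v :: adhm_var
  obtain j l a b where v: "v = (j, l, a, b)" by (rule prod_cases4)
  show "entry (split_data (\<lambda>j l. Var (code4 j l)) (\<lambda>j l. Var (4 + code4 j l))) v \<in> vars_below 8"
    using code4_less[of j l]
    by (simp add: v split_data_def vars_below_0 vars_below_add vars_below_diff vars_below_Var)
qed

lemma pencil_vars: "pencil_restrict f \<in> vars_below 8"
  unfolding pencil_restrict_def
proof (rule vars_below_subst)
  fix v :: adhm_var
  obtain j l a b where v: "v = (j, l, a, b)" by (rule prod_cases4)
  show "entry (pencil_data (\<lambda>j l. Var (code4 j l)) (Var 4) (Var 5) (Var 6) (Var 7)) v \<in> vars_below 8"
    using code4_less[of j l]
    by (simp add: v pencil_data_def Let_def vars_below_0 vars_below_1 vars_below_add vars_below_mult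
        vars_below_Var)
qed

lemma cross_vars: "cross_restrict f \<in> vars_below 7"
  unfolding cross_restrict_def
proof (rule vars_below_subst)
  fix v :: adhm_var
  obtain j l a b where v: "v = (j, l, a, b)" by (rule prod_cases4)
  show "entry (split_data (\<lambda>j l. Var (code4 j l))
      (\<lambda>j l. pencil_scale l (Var 4) * Var (5 + code2 j))) v \<in> vars_below 7"
    using code4_less[of j l] code2_less[of j]
    by (simp add: v split_data_def pencil_scale_def vars_below_0 vars_below_1 vars_below_add
        vars_below_diff vars_below_mult vars_below_Var)
qed

text \<open>The Gram determinant of two of the traceless matrices, up to a factor. It vanishes on diagonal data,
  where these are proportional.\<close>

definition pencil_witness :: "'k::comm_ring_1 adhm_poly" where
  "pencil_witness = gram_poly 1 1 1 1 * gram_poly 2 1 2 1 - gram_poly 1 1 2 1 * gram_poly 1 1 2 1"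

lemma pencil_witness_invariant: "pencil_witness \<in> invariants"
  by (simp add: pencil_witness_def invariants_diff invariants_mult gram_poly_invariant)

lemma split_witness_zero: "split_restrict pencil_witness = 0"
  by (simp add: pencil_witness_def split_restrict_def subst_poly_simps
      eval_gram_split[OF ring_map_Const])

lemma split_values:
  "at_point \<tau> (split_restrict (trace_poly j l)) = 2 * \<tau> (code4 j l)"
  "at_point \<tau> (split_restrict (gram_poly j l j' l')) = 4 * (\<tau> (4 + code4 j l) * \<tau> (4 + code4 j' l'))"
  by (simp_all add: at_point_split_restrict eval_trace_split[OF ring_map_id]
      eval_gram_split[OF ring_map_id])

lemma cross_values:
  "at_point \<tau> (cross_restrict (trace_poly j l)) = 2 * \<tau> (code4 j l)"
  "at_point \<tau> (cross_restrict (gram_poly j l j' l')) =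
    4 * ((pencil_scale l (\<tau> 4) * \<tau> (5 + code2 j)) * (pencil_scale l' (\<tau> 4) * \<tau> (5 + code2 j')))"
  by (simp_all add: at_point_cross_restrict eval_trace_split[OF ring_map_id]
      eval_gram_split[OF ring_map_id])

lemma pencil_values:
  "at_point \<tau> (pencil_restrict (trace_poly j l)) =
    2 * \<tau> (code4 j l) + pencil_scale l (\<tau> 4) * (if j = 1 then \<tau> 5 else \<tau> 6)"
  "at_point \<tau> (pencil_restrict (gram_poly 1 l 1 l')) =
    pencil_scale l (\<tau> 4) * pencil_scale l' (\<tau> 4) * (\<tau> 5 * \<tau> 5)"
  "at_point \<tau> (pencil_restrict (gram_poly 2 l 2 l')) =
    pencil_scale l (\<tau> 4) * pencil_scale l' (\<tau> 4) * (\<tau> 6 * \<tau> 6)"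
  "at_point \<tau> (pencil_restrict pencil_witness) =
    \<tau> 5 * \<tau> 5 * (\<tau> 6 * \<tau> 6) - (\<tau> 5 * \<tau> 6 + 2 * \<tau> 7) * (\<tau> 5 * \<tau> 6 + 2 * \<tau> 7)"
  by (simp_all add: at_point_pencil_restrict eval_trace_pencil[OF ring_map_id]
      eval_gram_pencil[OF ring_map_id] pencil_witness_def at_point_simps pencil_scale_def)

lemmas witness_invariants = trace_poly_invariant gram_poly_invariant pencil_witness_invariant

lemma separatesI:
  assumes "\<And>\<tau>. \<forall>n\<in>set (take (Suc i) ns). \<tau> n = 0 \<Longrightarrow> at_point \<tau> (\<rho> w) = 0"
    and "\<forall>n\<in>set (take i ns). n \<notin> N" and "at_point (\<lambda>n. if n \<in> N then 1 else 0) (\<rho> w) \<noteq> 0"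
  shows "separates \<rho> ns i w"
  unfolding separates_def
  using assms by (intro conjI allI impI exI[of _ "\<lambda>n. if n \<in> N then 1 else 0"]) auto

lemma split_witnesses:
  assumes i: "i < 8"
  shows "\<exists>w\<in>(invariants :: 'k::field_char_0 adhm_poly set).
    separates split_restrict [4, 5, 6, 7, 0, 1, 2, 3] i w"
proof -
  from i have "i \<in> {0, 1, 2, 3, 4, 5, 6, 7}" by auto
  then show ?thesis
    by (elim insertE emptyE;
        intro bexI[of _ "[gram_poly 1 1 1 1, gram_poly 1 2 1 2, gram_poly 2 1 2 1, gram_poly 2 2 2 2,
        trace_poly 1 1, trace_poly 1 2, trace_poly 2 1, trace_poly 2 2] ! i"]
          separatesI[where N = "[{4}, {5}, {6}, {7}, {0}, {1}, {2}, {3}] ! i"])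
      (auto simp: witness_invariants split_values pencil_scale_def)
qed

text \<open>The parameter \<open>p\<close> goes first, then \<open>c\<close>, \<open>b\<close> and \<open>a\<close>: once \<open>c\<close> is zero, the Gram determinant vanishes while the
  squares of \<open>a\<close> and \<open>b\<close> survive. The traces involve \<open>a\<close> and \<open>b\<close> and come last.\<close>

lemma pencil_witnesses:
  assumes i: "i < 8"
  shows "\<exists>w\<in>(invariants :: 'k::field_char_0 adhm_poly set).
    separates pencil_restrict [4, 7, 6, 5, 0, 1, 2, 3] i w"
proof -
  from i have "i \<in> {0, 1, 2, 3, 4, 5, 6, 7}" by auto
  then show ?thesis
    by (elim insertE emptyE;
        intro bexI[of _ "[gram_poly 1 2 1 2, pencil_witness, gram_poly 2 1 2 1, gram_poly 1 1 1 1,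
        trace_poly 1 1, trace_poly 1 2, trace_poly 2 1, trace_poly 2 2] ! i"]
          separatesI[where N = "[{4, 5}, {7}, {6}, {5}, {0}, {1}, {2}, {3}] ! i"])
      (auto simp: witness_invariants pencil_values pencil_scale_def)
qed

lemma cross_witnesses:
  assumes i: "i < 7"
  shows "\<exists>w\<in>(invariants :: 'k::field_char_0 adhm_poly set).
    separates cross_restrict [4, 5, 6, 0, 1, 2, 3] i w"
proof -
  from i have "i \<in> {0, 1, 2, 3, 4, 5, 6}" by auto
  then show ?thesis
    by (elim insertE emptyE;
        intro bexI[of _ "[gram_poly 1 2 1 2, gram_poly 1 1 1 1, gram_poly 2 1 2 1,
        trace_poly 1 1, trace_poly 1 2, trace_poly 2 1, trace_poly 2 2] ! i"]
          separatesI[where N = "[{4, 5}, {5}, {6}, {0}, {1}, {2}, {3}] ! i"])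
      (auto simp: witness_invariants cross_values pencil_scale_def)
qed

section \<open>The components of the moduli space\<close>

text \<open>A prime that contains a product contains one of its factors.\<close>

lemma kernel_cover:
  fixes Q :: "'k::{alg_closed_field, field_char_0} adhm_poly set set"
  assumes Q: "primeideal Q adhm_invariant_ring"
  shows "restriction_prime split_restrict \<subseteq> Q \<or>
    restriction_prime pencil_restrict \<subseteq> Q"
proof (rule ccontr)
  assume "\<not> ?thesis"
  then obtain f g where f: "f \<in> restriction_kernel split_restrict" "adhm_class f \<notin> Q"
    and g: "g \<in> restriction_kernel pencil_restrict" "adhm_class g \<notin> Q" by blast
  then have fg: "f \<in> invariants" "split_restrict f = 0" "g \<in> invariants" "pencil_restrict g = 0"
    by (simp_all add: restriction_kernel_def)
  have "f * g \<in> contract Q"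
    using kernel_product_in_ideal[OF fg] adhm_ideal_subset_contract[OF Q] by blast
  then have "f \<in> contract Q \<or> g \<in> contract Q"
    by (rule prime_ofD(3)[OF prime_of_contract[OF Q] fg(1,3)])
  then show False using f g by (simp add: contract_def)
qed

lemma cross_kernel_iff:
  fixes Q :: "'k::{alg_closed_field, field_char_0} adhm_poly set set"
  assumes Q: "primeideal Q adhm_invariant_ring"
  shows "restriction_prime cross_restrict \<subseteq> Q \<longleftrightarrow>
    restriction_prime split_restrict \<subseteq> Q \<and>
    restriction_prime pencil_restrict \<subseteq> Q"
proof (intro iffI conjI)
  have "restriction_kernel split_restrict \<subseteq> (restriction_kernel cross_restrict :: 'k adhm_poly set)"
    by (auto simp: restriction_kernel_def split_kernel_subset_cross_kernel)
  moreover have "restriction_kernel pencil_restrict \<subseteq> (restriction_kernel cross_restrict :: 'k adhm_poly set)"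
    by (auto simp: restriction_kernel_def pencil_kernel_subset_cross_kernel)
  moreover assume "restriction_prime cross_restrict \<subseteq> Q"
  ultimately show "restriction_prime split_restrict \<subseteq> Q"
    "restriction_prime pencil_restrict \<subseteq> Q" by blast+
next
  assume sub: "restriction_prime split_restrict \<subseteq> Q \<and>
    restriction_prime pencil_restrict \<subseteq> Q"
  have contr: "f \<in> contract Q" if "f \<in> invariants" "split_restrict f = 0 \<or> pencil_restrict f = 0" for f
    using that sub by (auto simp: contract_def restriction_kernel_def)
  note prime = prime_of_contract[OF Q]
  show "restriction_prime cross_restrict \<subseteq> Q"
  proof (rule image_subsetI)
    fix f :: "'k adhm_poly" assume "f \<in> restriction_kernel cross_restrict"
    then have f: "f \<in> invariants" "cross_restrict f = 0" by (simp_all add: restriction_kernel_def)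
    obtain g where g: "g \<in> invariants" "split_restrict (f - cross_invariant * g) = 0"
      using cross_kernel_decomposition[OF f] by blast
    have "f - cross_invariant * g \<in> contract Q"
      by (rule contr) (simp_all add: f g invariants_diff invariants_mult cross_invariant_invariant)
    moreover have "g * cross_invariant \<in> contract Q"
      by (intro prime_ofD(2)[OF prime g(1)] contr)
        (simp_all add: cross_invariant_invariant pencil_restrict_cross_invariant)
    ultimately have "(f - cross_invariant * g) + g * cross_invariant \<in> contract Q"
      by (rule prime_ofD(1)[OF prime])
    then show "adhm_class f \<in> Q" by (simp add: contract_def mult.commute)
  qed
qed

text \<open>The components are the closures of the split data and of the pencils.\<close>

theorem corollary5p12:
  fixes M :: "'k::{alg_closed_field, field_char_0} adhm_poly set set topology"
  defines "M \<equiv> perverse_instanton_moduli TYPE('k)"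
  shows "\<exists>Z\<^sub>1 Z\<^sub>2.
      Z\<^sub>1 \<noteq> Z\<^sub>2 \<and> irreducible_components M = {Z\<^sub>1, Z\<^sub>2} \<and>
      krull_dim (subtopology M Z\<^sub>1) = 8 \<and>
      krull_dim (subtopology M Z\<^sub>2) = 8 \<and>
      irreducible_in M (Z\<^sub>1 \<inter> Z\<^sub>2) \<and>
      krull_dim (subtopology M (Z\<^sub>1 \<inter> Z\<^sub>2)) = 7"
proof -
  let ?A = "adhm_invariant_ring :: 'k adhm_poly set ring"
  have M: "M = zariski ?A" by (simp add: M_def perverse_instanton_moduli_def)
  define P\<^sub>1 P\<^sub>2 P\<^sub>3 :: "'k adhm_poly set set" where
    "P\<^sub>1 = restriction_prime split_restrict" and
    "P\<^sub>2 = restriction_prime pencil_restrict" and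
    "P\<^sub>3 = restriction_prime cross_restrict"
  have prime: "primeideal P\<^sub>1 ?A" "primeideal P\<^sub>2 ?A" "primeideal P\<^sub>3 ?A"
    unfolding P\<^sub>1_def P\<^sub>2_def P\<^sub>3_def
    by (rule split.primeideal_restriction_kernel pencil.primeideal_restriction_kernel
        cross.primeideal_restriction_kernel)+
  have contract: "contract P\<^sub>1 = restriction_kernel split_restrict"
    "contract P\<^sub>2 = restriction_kernel pencil_restrict"
    unfolding P\<^sub>1_def P\<^sub>2_def
    by (rule split.primeideal_restriction_kernel pencil.primeideal_restriction_kernel)+
  have "\<not> P\<^sub>1 \<subseteq> P\<^sub>2"
  proof
    assume "P\<^sub>1 \<subseteq> P\<^sub>2"
    then have "contract P\<^sub>1 \<subseteq> contract P\<^sub>2" unfolding contract_def by blast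
    moreover have "pencil_witness \<in> contract P\<^sub>1"
      by (simp add: contract restriction_kernel_def pencil_witness_invariant split_witness_zero)
    ultimately have "pencil_restrict (pencil_witness :: 'k adhm_poly) = 0"
      by (auto simp: contract restriction_kernel_def)
    then show False
      using pencil_values(4)[of "\<lambda>n. if n = 7 then 1 else 0 :: 'k"] by (simp add: at_point_simps)
  qed
  moreover have "\<not> P\<^sub>2 \<subseteq> P\<^sub>1"
  proof
    assume "P\<^sub>2 \<subseteq> P\<^sub>1"
    then have "contract P\<^sub>2 \<subseteq> contract P\<^sub>1" unfolding contract_def by blast
    moreover have "cross_invariant \<in> contract P\<^sub>2"
      by (simp add: contract restriction_kernel_def cross_invariant_invariant
          pencil_restrict_cross_invariant)
    ultimately have "split_restrict (cross_invariant :: 'k adhm_poly) = 0"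
      by (auto simp: contract restriction_kernel_def)
    then have "at_point (\<lambda>n. if n = 4 \<or> n = 7 then 1 else 0 :: 'k) (4 * cross_det) = 0"
      by (simp add: split_restrict_cross_invariant at_point_simps)
    then show False by (simp add: cross_det_def at_point_simps)
  qed
  moreover have "P\<^sub>1 \<subseteq> Q \<or> P\<^sub>2 \<subseteq> Q" if "primeideal Q ?A" for Q
    unfolding P\<^sub>1_def P\<^sub>2_def by (rule kernel_cover[OF that])
  ultimately have components: "irreducible_components M = {prime_locus ?A P\<^sub>1, prime_locus ?A P\<^sub>2}"
    and neq: "prime_locus ?A P\<^sub>1 \<noteq> prime_locus ?A P\<^sub>2"
    using irreducible_components_two[OF prime(1,2)] prime_locus_mono_iff[OF prime(1), of P\<^sub>2]
    unfolding M by auto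
  have inter: "prime_locus ?A P\<^sub>1 \<inter> prime_locus ?A P\<^sub>2 = prime_locus ?A P\<^sub>3"
  proof -
    have "P\<^sub>3 \<subseteq> Q \<longleftrightarrow> P\<^sub>1 \<subseteq> Q \<and> P\<^sub>2 \<subseteq> Q" if "primeideal Q ?A" for Q
      unfolding P\<^sub>1_def P\<^sub>2_def P\<^sub>3_def by (rule cross_kernel_iff[OF that])
    then show ?thesis by (auto simp: prime_locus_def prime_spectrum_def)
  qed
  have "krull_dim (subtopology M (prime_locus ?A P\<^sub>1)) = enat 8"
    unfolding M P\<^sub>1_def
    by (rule split.krull_dim_restriction[OF split_vars _ split_witnesses]) simp_all
  moreover have "krull_dim (subtopology M (prime_locus ?A P\<^sub>2)) = enat 8"
    unfolding M P\<^sub>2_def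
    by (rule pencil.krull_dim_restriction[OF pencil_vars _ pencil_witnesses]) simp_all
  moreover have "krull_dim (subtopology M (prime_locus ?A P\<^sub>3)) = enat 7"
    unfolding M P\<^sub>3_def
    by (rule cross.krull_dim_restriction[OF cross_vars _ cross_witnesses]) simp_all
  moreover have "irreducible_in M (prime_locus ?A P\<^sub>3)"
    unfolding M by (rule prime_locus_irreducible[OF prime(3)])
  ultimately show ?thesis
    using components neq
    by (intro exI[of _ "prime_locus ?A P\<^sub>1"] exI[of _ "prime_locus ?A P\<^sub>2"])
      (simp add: inter numeral_eq_enat)
qed

end
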